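(* Let $\{S,T,E,N,\mathbf x\}$ be an admissible data set for the problem $\mathbf{AIP}_{\mathcal H(K_S)}$ (as defined in the context), and assume that $P:=M_{F^S}^{[*]}M_{F^S}\ge \mathbf x\mathbf x^*$. Let $\Sigma=\begin{bmatrix}\Sigma_{11}&\Sigma_{12}\\ \Sigma_{21}&\Sigma_{22}\end{bmatrix}$ be the function constructed from $\{P,T,E,N\}$ as in the context, let $\mathcal E\in\mathcal S(\widetilde\Delta,\widetilde\Delta_* )$ be a Schur-class function such that $S=\mathcal R_\Sigma[\mathcal E]$, let $$G(z)=\Sigma_{12}(z)(I-\mathcal E(z)\Sigma_{22}(z))^{-1},\qquad \Gamma(z)=\left(C_1+G(z)\mathcal E(z)C_2\right)(I-zA)^{-1}\qquad(z\in\mathbb D),$$ and let $\widetilde{\mathbf x}$ be the unique vector in $\mathcal X_0=\overline{\mathrm{Ran}}\,P^{1/2}$ such that $\mathbf x=P^{1/2}\widetilde{\mathbf x}$. Then: (1) The set of solutions $f$ of the problem $\mathbf{AIP}_{\mathcal H(K_S)}$ is given by the formula $$f(z)=\Gamma(z)\widetilde{\mathbf x}+G(z)h(z)$$ with parameter $h\in\mathcal H(K_{\mathcal E})$ subject to $\|h\|_{\mathcal H(K_{\mathcal E})}\le\sqrt{1-\|\widetilde{\mathbf x}\|^2}$. (2) For $f$ defined by the formula in (1), $$\|f\|^2_{\mathcal H(K_S)}=\|M_\Gamma\widetilde{\mathbf x}\|^2_{\mathcal H(K_S)}+\|M_Gh\|^2_{\mathcal H(K_S)}=\|\widetilde{\mathbf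 x}\|^2+\|P_{\mathcal H(K_{\mathcal E})\ominus\ker M_G}h\|^2_{\mathcal H(K_{\mathcal E})},$$ where $P_{\mathcal H(K_{\mathcal E})\ominus\ker M_G}$ is the orthogonal projection of $\mathcal H(K_{\mathcal E})$ onto $\mathcal H(K_{\mathcal E})\ominus\ker M_G$; hence $f_{\min}(z)=\Gamma(z)\widetilde{\mathbf x}$ is the unique minimal-norm solution. (3) The problem $\mathbf{AIP}_{\mathcal H(K_S)}$ admits a unique solution if and only if $\|\widetilde{\mathbf x}\|=1$ or $\overline{\mathrm{Ran}}\,M_{F^S}=\mathcal H(K_S)$.
   Context: Notation. All spaces $\mathcal X,\mathcal U,\mathcal Y$ are complex Hilbert spaces; $\mathcal L(\mathcal U,\mathcal Y)$ is the space of bounded operators, $\mathcal L(\mathcal X)=\mathcal L(\mathcal X,\mathcal X)$; $\mathbb D$ is the open unit disk; $\mathrm{Hol}_{\mathcal Y}(\mathbb D)$ is the space of $\mathcal Y$-valued holomorphic functions on $\mathbb D$. The Schur class $\mathcal S(\mathcal U,\mathcal Y)$ is the set of analytic functions on $\mathbb D$ whose values are contractions in $\mathcal L(\mathcal U,\mathcal Y)$. For $S\in\mathcal S(\mathcal U,\mathcal Y)$, $\mathcal H(K_S)$ is the de Branges–Rovnyak space: the reproducing kernel Hilbert space of $\mathcal Y$-valued functions with kernel $K_S(z,\zeta)=\frac{I_{\mathcal Y}-S(z)S(\zeta)^*}{1-z\bar\zeta}$. For an operator $A$ into $\mathcal H(K_S)$, $A^{[*]}$ is the adjoint with respect to the inner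 product of $\mathcal H(K_S)$. $M_F$ denotes multiplication by $F$. For $\mathbf x\in\mathcal X$, $\mathbf x\mathbf x^*$ is the operator $y\mapsto\langle y,\mathbf x\rangle\mathbf x$. Admissible data and the problem. $(E,T)$ with $E\in\mathcal L(\mathcal X,\mathcal Y)$, $T\in\mathcal L(\mathcal X)$ is an analytic output pair if $\mathcal O_{E,T}:x\mapsto E(I-zT)^{-1}x=\sum_{n\ge0}z^nET^nx$ maps $\mathcal X$ into $\mathrm{Hol}_{\mathcal Y}(\mathbb D)$. A data set $\{S,T,E,N,\mathbf x\}$ with $S\in\mathcal S(\mathcal U,\mathcal Y)$, $T\in\mathcal L(\mathcal X)$, $E\in\mathcal L(\mathcal X,\mathcal Y)$, $N\in\mathcal L(\mathcal X,\mathcal U)$, $\mathbf x\in\mathcal X$ is $\mathbf{AIP}_{\mathcal H(K_S)}$-admissible if (i) $(E,T)$ and $(N,T)$ are analytic output pairs; (ii) with $F^S(z)=(E-S(z)N)(I-zT)^{-1}$, the operator $M_{F^S}:x\mapsto F^Sx$, i.e. $M_{F^S}=\mathcal O_{E,T}-M_S\mathcal O_{N,T}$, maps $\mathcal X$ into $\mathcal H(K_S)$; (iii) $P:=M_{F^S}^{[*]}M_{F^S}$ satisfies $P-T^*PT=E^*E-N^*N$. The problem $\mathbf{AIP}_{\mathcal H(K_S)}$: find all $f\in\mathcal H(K_S)$ with $M_{F^S}^{[*]}f=\mathbf x$ and $\|f\|_{\mathcal H(K_S)}\le1$. Construction of $\Sigma$ and $\mathcal R_\Sigma$. Put $\mathcal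 X_0=\overline{\mathrm{Ran}}\,P^{1/2}$; $P^{1/2}$ is regarded as an operator $\mathcal X\to\mathcal X_0$ or $\mathcal X_0\to\mathcal X$ as needed. The equation in (iii) yields a unique isometry $V$ from $\mathcal D_V=\overline{\mathrm{Ran}}\begin{bmatrix}P^{1/2}\\ N\end{bmatrix}\subseteq\mathcal X_0\oplus\mathcal U$ onto $\mathcal R_V=\overline{\mathrm{Ran}}\begin{bmatrix}P^{1/2}T\\ E\end{bmatrix}\subseteq\mathcal X_0\oplus\mathcal Y$ with $V\begin{bmatrix}P^{1/2}x\\ Nx\end{bmatrix}=\begin{bmatrix}P^{1/2}Tx\\ Ex\end{bmatrix}$ for $x\in\mathcal X$. Let $\Delta=(\mathcal X_0\oplus\mathcal U)\ominus\mathcal D_V$, $\Delta_*=(\mathcal X_0\oplus\mathcal Y)\ominus\mathcal R_V$, and let $\mathbf i:\Delta\to\widetilde\Delta$, $\mathbf i_*:\Delta_*\to\widetilde\Delta_*$ be unitary maps onto isomorphic copies. The unitary operator $\mathbf U:\mathcal X_0\oplus\mathcal U\oplus\widetilde\Delta_*\to\mathcal X_0\oplus\mathcal Y\oplus\widetilde\Delta$ acts as $V$ from $\mathcal D_V$ onto $\mathcal R_V$, as $\mathbf i$ from $\Delta$ onto $\widetilde\Delta$, and as $\mathbf i_*^*$ from $\widetilde\Delta_*$ onto $\Delta_*$. Write it as $$\mathbf U=\begin{bmatrix}A&B_1&B_2\\ C_1&D_{11}&D_{12}\\ C_2&D_{21}&0\end{bmatrix},\qquad \Sigma(z)=\begin{bmatrix}\Sigma_{11}(z)&\Sigma_{12}(z)\\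 \Sigma_{21}(z)&\Sigma_{22}(z)\end{bmatrix}=\begin{bmatrix}D_{11}&D_{12}\\ D_{21}&0\end{bmatrix}+z\begin{bmatrix}C_1\\ C_2\end{bmatrix}(I-zA)^{-1}\begin{bmatrix}B_1&B_2\end{bmatrix},$$ with $\Sigma(z):\mathcal U\oplus\widetilde\Delta_*\to\mathcal Y\oplus\widetilde\Delta$. For $\mathcal E\in\mathcal S(\widetilde\Delta,\widetilde\Delta_* )$ the Redheffer transform is $\mathcal R_\Sigma[\mathcal E]=\Sigma_{11}+\Sigma_{12}(I-\mathcal E\Sigma_{22})^{-1}\mathcal E\Sigma_{21}\in\mathcal S(\mathcal U,\mathcal Y)$. It is known that at least one $\mathcal E$ with $S=\mathcal R_\Sigma[\mathcal E]$ exists for admissible data. $M_G$ is viewed as an operator $\mathcal H(K_{\mathcal E})\to\mathcal H(K_S)$ and $M_\Gamma$ as an operator $\mathcal X_0\to\mathcal H(K_S)$. *)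

theory Defs
  imports "HOL-Analysis.Analysis"
begin

section \<open>Complex Hilbert spaces\<close>

text \<open>The inner product is linear in its first argument. Norm and metric are those of the
  underlying real Hilbert space, whose inner product is the real part of \<open>cinner\<close>.\<close>

class complex_hilbert = real_inner + complete_space +
  fixes scaleC :: "complex \<Rightarrow> 'a \<Rightarrow> 'a" (infixr "*\<^sub>C" 75)
    and cinner :: "'a \<Rightarrow> 'a \<Rightarrow> complex"
  assumes scaleC_add_right: "c *\<^sub>C (x + y) = c *\<^sub>C x + c *\<^sub>C y"
    and scaleC_add_left: "(c + d) *\<^sub>C x = c *\<^sub>C x + d *\<^sub>C x"
    and scaleC_scaleC: "c *\<^sub>C d *\<^sub>C x = (c * d) *\<^sub>C x"
    and scaleC_of_real: "complex_of_real r *\<^sub>C x = r *\<^sub>R x"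
    and cinner_commute: "cinner x y = cnj (cinner y x)"
    and cinner_add_left: "cinner (x + y) z = cinner x z + cinner y z"
    and cinner_scaleC_left: "cinner (c *\<^sub>C x) y = c * cinner x y"
    and Re_cinner: "Re (cinner x y) = inner x y"

instantiation complex :: complex_hilbert
begin

definition scaleC_complex :: "complex \<Rightarrow> complex \<Rightarrow> complex"
  where "scaleC_complex c x = c * x"

definition cinner_complex :: "complex \<Rightarrow> complex \<Rightarrow> complex"
  where "cinner_complex x y = x * cnj y"

instance
  by standard
    (simp_all add: scaleC_complex_def cinner_complex_def algebra_simps inner_complex_def
      scaleR_conv_of_real)

end

instantiation prod :: (complex_hilbert, complex_hilbert) complex_hilbert
begin

definition scaleC_prod :: "complex \<Rightarrow> 'a \<times> 'b \<Rightarrow> 'a \<times> 'b"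
  where "scaleC_prod c p = (c *\<^sub>C fst p, c *\<^sub>C snd p)"

definition cinner_prod :: "'a \<times> 'b \<Rightarrow> 'a \<times> 'b \<Rightarrow> complex"
  where "cinner_prod p q = cinner (fst p) (fst q) + cinner (snd p) (snd q)"

instance
proof
  fix p q :: "'a \<times> 'b"
  show "cinner p q = cnj (cinner q p)"
    unfolding cinner_prod_def complex_cnj_add by (metis cinner_commute)
qed (simp_all add: scaleC_prod_def cinner_prod_def scaleC_add_right scaleC_add_left
      scaleC_scaleC scaleC_of_real cinner_add_left cinner_scaleC_left Re_cinner
      inner_prod_def scaleR_prod_def algebra_simps)

end

section \<open>Operators\<close>

definition bounded_clinear :: "('a::complex_hilbert \<Rightarrow> 'b::complex_hilbert) \<Rightarrow> bool"
  where "bounded_clinear A \<longleftrightarrow> bounded_linear A \<and> (\<forall>c v. A (c *\<^sub>C v) = c *\<^sub>C A v)"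

definition cadj :: "('a::complex_hilbert \<Rightarrow> 'b::complex_hilbert) \<Rightarrow> 'b \<Rightarrow> 'a"
  where "cadj A y = (THE x. \<forall>v. cinner (A v) y = cinner v x)"

definition positive_op :: "('a::complex_hilbert \<Rightarrow> 'a) \<Rightarrow> bool"
  where "positive_op A \<longleftrightarrow> (\<forall>v. cinner (A v) v \<in> \<real> \<and> 0 \<le> Re (cinner (A v) v))"

definition op_le :: "('a::complex_hilbert \<Rightarrow> 'a) \<Rightarrow> ('a \<Rightarrow> 'a) \<Rightarrow> bool"
  where "op_le A B \<longleftrightarrow> positive_op (\<lambda>v. B v - A v)"

definition rank_one :: "'a::complex_hilbert \<Rightarrow> 'a \<Rightarrow> 'a"
  where "rank_one x y = cinner y x *\<^sub>C x"

definition is_positive_sqrt :: "('a::complex_hilbert \<Rightarrow> 'a) \<Rightarrow> ('a \<Rightarrow> 'a) \<Rightarrow> bool"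
  where "is_positive_sqrt P R \<longleftrightarrow> bounded_clinear R \<and> positive_op R \<and> (\<forall>v. R (R v) = P v)"

definition ominus :: "'a::complex_hilbert set \<Rightarrow> 'a set \<Rightarrow> 'a set" (infixl "\<ominus>" 65)
  where "A \<ominus> B = {a \<in> A. \<forall>b\<in>B. cinner a b = 0}"

text \<open>\<open>W\<close>, restricted to the subspace \<open>M\<close>, is a linear isometry of \<open>M\<close> onto \<open>L\<close>.
  Values of \<open>W\<close> outside \<open>M\<close> are irrelevant.\<close>

definition unitary_onto ::
    "('a::complex_hilbert \<Rightarrow> 'b::complex_hilbert) \<Rightarrow> 'a set \<Rightarrow> 'b set \<Rightarrow> bool"
  where "unitary_onto W M L \<longleftrightarrow>
    (\<forall>a\<in>M. \<forall>b\<in>M. W (a + b) = W a + W b) \<and>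
    (\<forall>c. \<forall>a\<in>M. W (c *\<^sub>C a) = c *\<^sub>C W a) \<and>
    (\<forall>a\<in>M. \<forall>b\<in>M. cinner (W a) (W b) = cinner a b) \<and>
    W ` M = L"

section \<open>Analytic functions on the disk\<close>

abbreviation disk :: "complex set"  ("\<bbbD>")
  where "\<bbbD> \<equiv> ball 0 1"

definition hol_disk :: "(complex \<Rightarrow> 'a::complex_hilbert) \<Rightarrow> bool"
  where "hol_disk f \<longleftrightarrow>
    (\<forall>z\<in>\<bbbD>. \<exists>d. ((\<lambda>w. inverse (w - z) *\<^sub>C (f w - f z)) \<longlongrightarrow> d) (at z))"

definition op_hol_disk ::
    "(complex \<Rightarrow> 'a::complex_hilbert \<Rightarrow> 'b::complex_hilbert) \<Rightarrow> bool"
  where "op_hol_disk S \<longleftrightarrow>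
    (\<forall>z\<in>\<bbbD>. \<exists>D. bounded_clinear D \<and>
      ((\<lambda>w. onorm (\<lambda>u. inverse (w - z) *\<^sub>C (S w u - S z u) - D u)) \<longlongrightarrow> 0) (at z))"

definition schur_class ::
    "(complex \<Rightarrow> 'a::complex_hilbert \<Rightarrow> 'b::complex_hilbert) set"
  where "schur_class =
    {S. (\<forall>z\<in>\<bbbD>. bounded_clinear (S z) \<and> onorm (S z) \<le> 1) \<and> op_hol_disk S}"

text \<open>Functions on the disk are represented by functions on \<open>\<complex>\<close> that vanish off the disk.\<close>

definition on_disk :: "(complex \<Rightarrow> 'a::complex_hilbert) \<Rightarrow> complex \<Rightarrow> 'a"
  where "on_disk f = (\<lambda>z. if z \<in> \<bbbD> then f z else 0)"

section \<open>Hilbert spaces of functions on the disk\<close>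

record 'a fun_space =
  fcarrier :: "(complex \<Rightarrow> 'a) set"
  finner :: "(complex \<Rightarrow> 'a) \<Rightarrow> (complex \<Rightarrow> 'a) \<Rightarrow> complex"

definition fnorm :: "'a fun_space \<Rightarrow> (complex \<Rightarrow> 'a) \<Rightarrow> real"
  where "fnorm H f = sqrt (Re (finner H f f))"

definition fun_hilbert :: "'a::complex_hilbert fun_space \<Rightarrow> bool"
  where "fun_hilbert H \<longleftrightarrow>
    (\<forall>f\<in>fcarrier H. on_disk f = f) \<and>
    (\<lambda>z. 0) \<in> fcarrier H \<and>
    (\<forall>f\<in>fcarrier H. \<forall>g\<in>fcarrier H. (\<lambda>z. f z + g z) \<in> fcarrier H) \<and>
    (\<forall>c. \<forall>f\<in>fcarrier H. (\<lambda>z. c *\<^sub>C f z) \<in> fcarrier H) \<and>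
    (\<forall>f\<in>fcarrier H. \<forall>g\<in>fcarrier H. finner H f g = cnj (finner H g f)) \<and>
    (\<forall>f\<in>fcarrier H. \<forall>g\<in>fcarrier H. \<forall>k\<in>fcarrier H.
      finner H (\<lambda>z. f z + g z) k = finner H f k + finner H g k) \<and>
    (\<forall>c. \<forall>f\<in>fcarrier H. \<forall>g\<in>fcarrier H. finner H (\<lambda>z. c *\<^sub>C f z) g = c * finner H f g) \<and>
    (\<forall>f\<in>fcarrier H. 0 \<le> Re (finner H f f)) \<and>
    (\<forall>f\<in>fcarrier H. finner H f f = 0 \<longrightarrow> f = (\<lambda>z. 0)) \<and>
    (\<forall>\<phi>. (\<forall>n. \<phi> n \<in> fcarrier H) \<and>
         (\<forall>e>0. \<exists>n0. \<forall>m\<ge>n0. \<forall>n\<ge>n0. fnorm H (\<lambda>z. \<phi> m z - \<phi> n z) < e) \<longrightarrow>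
       (\<exists>f\<in>fcarrier H. (\<lambda>n. fnorm H (\<lambda>z. \<phi> n z - f z)) \<longlonglongrightarrow> 0))"

definition is_rkhs :: "(complex \<Rightarrow> complex \<Rightarrow> 'a \<Rightarrow> 'a) \<Rightarrow> 'a::complex_hilbert fun_space \<Rightarrow> bool"
  where "is_rkhs K H \<longleftrightarrow> fun_hilbert H \<and>
    (\<forall>\<zeta>\<in>\<bbbD>. \<forall>y. on_disk (\<lambda>z. K z \<zeta> y) \<in> fcarrier H \<and>
      (\<forall>f\<in>fcarrier H. finner H f (on_disk (\<lambda>z. K z \<zeta> y)) = cinner (f \<zeta>) y))"

definition dbr_kernel ::
    "(complex \<Rightarrow> 'u::complex_hilbert \<Rightarrow> 'y::complex_hilbert) \<Rightarrow> complex \<Rightarrow> complex \<Rightarrow> 'y \<Rightarrow> 'y"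
  where "dbr_kernel S z \<zeta> y = inverse (1 - z * cnj \<zeta>) *\<^sub>C (y - S z (cadj (S \<zeta>) y))"

text \<open>\<open>dbr_space S H\<close>: \<open>H\<close> is the de Branges--Rovnyak space of \<open>S\<close>. A reproducing kernel
  Hilbert space is determined by its kernel, so the carrier of \<open>H\<close> and the inner product on it
  are determined by \<open>S\<close>.\<close>

definition dbr_space ::
    "(complex \<Rightarrow> 'u::complex_hilbert \<Rightarrow> 'y::complex_hilbert) \<Rightarrow> 'y fun_space \<Rightarrow> bool"
  where "dbr_space S H \<longleftrightarrow> is_rkhs (dbr_kernel S) H"

definition fadj ::
    "'y fun_space \<Rightarrow> ('x::complex_hilbert \<Rightarrow> complex \<Rightarrow> 'y) \<Rightarrow> (complex \<Rightarrow> 'y) \<Rightarrow> 'x"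
  where "fadj H M f = (THE x. \<forall>v. finner H (M v) f = cinner v x)"

definition fominus :: "'y fun_space \<Rightarrow> (complex \<Rightarrow> 'y) set \<Rightarrow> (complex \<Rightarrow> 'y) set"
  where "fominus H L = {g \<in> fcarrier H. \<forall>k\<in>L. finner H g k = 0}"

definition fproj ::
    "'y::complex_hilbert fun_space \<Rightarrow> (complex \<Rightarrow> 'y) set \<Rightarrow> (complex \<Rightarrow> 'y) \<Rightarrow> complex \<Rightarrow> 'y"
  where "fproj H L h = (THE g. g \<in> L \<and> (\<forall>k\<in>L. finner H (\<lambda>z. h z - g z) k = 0))"

definition fclosure ::
    "'y::complex_hilbert fun_space \<Rightarrow> (complex \<Rightarrow> 'y) set \<Rightarrow> (complex \<Rightarrow> 'y) set"
  where "fclosure H L =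
    {f \<in> fcarrier H. \<forall>e>0. \<exists>g\<in>L. fnorm H (\<lambda>z. f z - g z) < e}"

section \<open>The interpolation problem\<close>

text \<open>\<open>I - zT\<close> need not be invertible on all of the disk, so \<open>E (I - zT)\<^sup>-\<^sup>1 x\<close> is read as the sum
  of its Taylor series.\<close>

definition out_op ::
    "('x::complex_hilbert \<Rightarrow> 'y::complex_hilbert) \<Rightarrow> ('x \<Rightarrow> 'x) \<Rightarrow> 'x \<Rightarrow> complex \<Rightarrow> 'y"
  where "out_op E T x = on_disk (\<lambda>z. \<Sum>n. z ^ n *\<^sub>C E ((T ^^ n) x))"

definition analytic_output_pair ::
    "('x::complex_hilbert \<Rightarrow> 'y::complex_hilbert) \<Rightarrow> ('x \<Rightarrow> 'x) \<Rightarrow> bool"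
  where "analytic_output_pair E T \<longleftrightarrow> (\<forall>x.
    (\<forall>z\<in>\<bbbD>. summable (\<lambda>n. z ^ n *\<^sub>C E ((T ^^ n) x))) \<and> hol_disk (out_op E T x))"

text \<open>The operator \<open>M\<^bsub>F\<^esub>\<close> for \<open>F = F\<^sup>S\<close>, i.e. \<open>O\<^bsub>E,T\<^esub> - M\<^sub>S O\<^bsub>N,T\<^esub>\<close>.\<close>

definition M_F ::
    "(complex \<Rightarrow> 'u::complex_hilbert \<Rightarrow> 'y::complex_hilbert) \<Rightarrow> ('x::complex_hilbert \<Rightarrow> 'x) \<Rightarrow>
     ('x \<Rightarrow> 'y) \<Rightarrow> ('x \<Rightarrow> 'u) \<Rightarrow> 'x \<Rightarrow> complex \<Rightarrow> 'y"
  where "M_F S T E N x = on_disk (\<lambda>z. out_op E T x z - S z (out_op N T x z))"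

definition aip_gram ::
    "'y::complex_hilbert fun_space \<Rightarrow> (complex \<Rightarrow> 'u::complex_hilbert \<Rightarrow> 'y) \<Rightarrow>
     ('x::complex_hilbert \<Rightarrow> 'x) \<Rightarrow> ('x \<Rightarrow> 'y) \<Rightarrow> ('x \<Rightarrow> 'u) \<Rightarrow> 'x \<Rightarrow> 'x"
  where "aip_gram H S T E N x = fadj H (M_F S T E N) (M_F S T E N x)"

definition aip_admissible ::
    "'y::complex_hilbert fun_space \<Rightarrow> (complex \<Rightarrow> 'u::complex_hilbert \<Rightarrow> 'y) \<Rightarrow>
     ('x::complex_hilbert \<Rightarrow> 'x) \<Rightarrow> ('x \<Rightarrow> 'y) \<Rightarrow> ('x \<Rightarrow> 'u) \<Rightarrow> bool"
  where "aip_admissible H S T E N \<longleftrightarrow>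
    S \<in> schur_class \<and> bounded_clinear T \<and> bounded_clinear E \<and> bounded_clinear N \<and>
    analytic_output_pair E T \<and> analytic_output_pair N T \<and>
    (\<forall>v. M_F S T E N v \<in> fcarrier H) \<and>
    (\<forall>v. aip_gram H S T E N v - cadj T (aip_gram H S T E N (T v)) =
         cadj E (E v) - cadj N (N v))"

definition aip_solutions ::
    "'y::complex_hilbert fun_space \<Rightarrow> (complex \<Rightarrow> 'u::complex_hilbert \<Rightarrow> 'y) \<Rightarrow>
     ('x::complex_hilbert \<Rightarrow> 'x) \<Rightarrow> ('x \<Rightarrow> 'y) \<Rightarrow> ('x \<Rightarrow> 'u) \<Rightarrow> 'x \<Rightarrow> (complex \<Rightarrow> 'y) set"
  where "aip_solutions H S T E N x =
    {f \<in> fcarrier H. fadj H (M_F S T E N) f = x \<and> fnorm H f \<le> 1}"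

section \<open>The universal colligation\<close>

text \<open>In this section \<open>R\<close> stands for \<open>P\<^bsup>1/2\<^esup>\<close>.\<close>

definition X0 :: "('x::complex_hilbert \<Rightarrow> 'x) \<Rightarrow> 'x set"
  where "X0 R = closure (range R)"

definition dom_V ::
    "('x::complex_hilbert \<Rightarrow> 'x) \<Rightarrow> ('x \<Rightarrow> 'u::complex_hilbert) \<Rightarrow> ('x \<times> 'u) set"
  where "dom_V R N = closure (range (\<lambda>v. (R v, N v)))"

definition ran_V ::
    "('x::complex_hilbert \<Rightarrow> 'x) \<Rightarrow> ('x \<Rightarrow> 'x) \<Rightarrow> ('x \<Rightarrow> 'y::complex_hilbert) \<Rightarrow> ('x \<times> 'y) set"
  where "ran_V R T E = closure (range (\<lambda>v. (R (T v), E v)))"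

definition defect ::
    "('x::complex_hilbert \<Rightarrow> 'x) \<Rightarrow> ('x \<Rightarrow> 'u::complex_hilbert) \<Rightarrow> ('x \<times> 'u) set"
  where "defect R N = (X0 R \<times> UNIV) \<ominus> dom_V R N"

definition defect_star ::
    "('x::complex_hilbert \<Rightarrow> 'x) \<Rightarrow> ('x \<Rightarrow> 'x) \<Rightarrow> ('x \<Rightarrow> 'y::complex_hilbert) \<Rightarrow> ('x \<times> 'y) set"
  where "defect_star R T E = (X0 R \<times> UNIV) \<ominus> ran_V R T E"

text \<open>The isomorphic copies of the two defect spaces are the types \<open>'d\<close> and \<open>'e\<close>.
  The condition on \<open>istar\<close> in the last line says that \<open>U\<close> acts as the adjoint (= inverse) of
  \<open>istar\<close> on \<open>'e\<close>.\<close>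

definition universal_colligation ::
    "('x::complex_hilbert \<Rightarrow> 'x) \<Rightarrow> ('x \<Rightarrow> 'x) \<Rightarrow> ('x \<Rightarrow> 'y::complex_hilbert) \<Rightarrow>
     ('x \<Rightarrow> 'u::complex_hilbert) \<Rightarrow>
     ('x \<times> 'u \<Rightarrow> 'x \<times> 'y) \<Rightarrow> ('x \<times> 'u \<Rightarrow> 'd::complex_hilbert) \<Rightarrow>
     ('x \<times> 'y \<Rightarrow> 'e::complex_hilbert) \<Rightarrow> ('x \<times> 'u \<times> 'e \<Rightarrow> 'x \<times> 'y \<times> 'd) \<Rightarrow> bool"
  where "universal_colligation R T E N V i istar U \<longleftrightarrow>
    unitary_onto V (dom_V R N) (ran_V R T E) \<and>
    (\<forall>v. V (R v, N v) = (R (T v), E v)) \<and>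
    unitary_onto i (defect R N) UNIV \<and>
    unitary_onto istar (defect_star R T E) UNIV \<and>
    unitary_onto U (X0 R \<times> UNIV \<times> UNIV) (X0 R \<times> UNIV \<times> UNIV) \<and>
    (\<forall>(a, u) \<in> dom_V R N. U (a, u, 0) = (fst (V (a, u)), snd (V (a, u)), 0)) \<and>
    (\<forall>(a, u) \<in> defect R N. U (a, u, 0) = (0, 0, i (a, u))) \<and>
    (\<forall>(a, y) \<in> defect_star R T E. U (0, 0, istar (a, y)) = (a, y, 0))"

context
  fixes U :: "'x::complex_hilbert \<times> 'u::complex_hilbert \<times> 'e::complex_hilbert \<Rightarrow>
    'x \<times> 'y::complex_hilbert \<times> 'd::complex_hilbert"
begin

definition blk_A :: "'x \<Rightarrow> 'x" where "blk_A a = fst (U (a, 0, 0))"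
definition blk_B1 :: "'u \<Rightarrow> 'x" where "blk_B1 u = fst (U (0, u, 0))"
definition blk_B2 :: "'e \<Rightarrow> 'x" where "blk_B2 w = fst (U (0, 0, w))"
definition blk_C1 :: "'x \<Rightarrow> 'y" where "blk_C1 a = fst (snd (U (a, 0, 0)))"
definition blk_D11 :: "'u \<Rightarrow> 'y" where "blk_D11 u = fst (snd (U (0, u, 0)))"
definition blk_D12 :: "'e \<Rightarrow> 'y" where "blk_D12 w = fst (snd (U (0, 0, w)))"
definition blk_C2 :: "'x \<Rightarrow> 'd" where "blk_C2 a = snd (snd (U (a, 0, 0)))"
definition blk_D21 :: "'u \<Rightarrow> 'd" where "blk_D21 u = snd (snd (U (0, u, 0)))"

context
  fixes X\<^sub>0 :: "'x set"
begin

text \<open>The inverse of \<open>I - zA\<close> as an operator on the state space \<open>X\<^sub>0\<close>.\<close>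

definition resolv :: "complex \<Rightarrow> 'x \<Rightarrow> 'x"
  where "resolv z = inv_into X\<^sub>0 (\<lambda>a. a - z *\<^sub>C blk_A a)"

definition Sigma11 :: "complex \<Rightarrow> 'u \<Rightarrow> 'y"
  where "Sigma11 z u = blk_D11 u + z *\<^sub>C blk_C1 (resolv z (blk_B1 u))"
definition Sigma12 :: "complex \<Rightarrow> 'e \<Rightarrow> 'y"
  where "Sigma12 z w = blk_D12 w + z *\<^sub>C blk_C1 (resolv z (blk_B2 w))"
definition Sigma21 :: "complex \<Rightarrow> 'u \<Rightarrow> 'd"
  where "Sigma21 z u = blk_D21 u + z *\<^sub>C blk_C2 (resolv z (blk_B1 u))"
definition Sigma22 :: "complex \<Rightarrow> 'e \<Rightarrow> 'd"
  where "Sigma22 z w = z *\<^sub>C blk_C2 (resolv z (blk_B2 w))"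

context
  fixes \<E> :: "complex \<Rightarrow> 'd \<Rightarrow> 'e"
begin

definition G_fun :: "complex \<Rightarrow> 'e \<Rightarrow> 'y"
  where "G_fun z w = Sigma12 z (inv (\<lambda>w'. w' - \<E> z (Sigma22 z w')) w)"

definition redheffer :: "complex \<Rightarrow> 'u \<Rightarrow> 'y"
  where "redheffer z u =
    Sigma11 z u + Sigma12 z (inv (\<lambda>w. w - \<E> z (Sigma22 z w)) (\<E> z (Sigma21 z u)))"

definition Gamma_fun :: "complex \<Rightarrow> 'x \<Rightarrow> 'y"
  where "Gamma_fun z a = blk_C1 (resolv z a) + G_fun z (\<E> z (blk_C2 (resolv z a)))"

definition M_G :: "(complex \<Rightarrow> 'e) \<Rightarrow> complex \<Rightarrow> 'y"
  where "M_G h = on_disk (\<lambda>z. G_fun z (h z))"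

definition M_Gamma :: "'x \<Rightarrow> complex \<Rightarrow> 'y"
  where "M_Gamma a = on_disk (\<lambda>z. Gamma_fun z a)"

end
end
end

definition ker_M :: "'e fun_space \<Rightarrow> ((complex \<Rightarrow> 'e) \<Rightarrow> complex \<Rightarrow> 'y::zero) \<Rightarrow> (complex \<Rightarrow> 'e) set"
  where "ker_M H M = {h \<in> fcarrier H. M h = (\<lambda>z. 0)}"

end

theory Submission
  imports Defs
begin

text \<open>Close the unitary colligation \<open>U(a, u, e) = (b, y, d)\<close> by \<open>a = zb + a\<^sub>0\<close> and \<open>e = \<E>(z)d + w\<close>. The
  output is then \<open>y = \<Gamma>(z)a\<^sub>0 + S(z)u + G(z)w\<close>. Closing \<open>U\<^sup>*\<close> in the same way with \<open>\<E>(\<zeta>)\<^sup>*\<close> computes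
  \<open>\<Gamma>(\<zeta>)\<^sup>*y\<close>, \<open>S(\<zeta>)\<^sup>*y\<close> and \<open>G(\<zeta>)\<^sup>*y\<close>, and feeding these vectors back into the first loop gives
  \<open>K\<^sub>S(z, \<zeta>) = \<Gamma>(z)\<Gamma>(\<zeta>)\<^sup>* + G(z)K\<^sub>\<E>(z, \<zeta>)G(\<zeta>)\<^sup>*\<close>. Hence \<open>[M\<^sub>\<Gamma>  M\<^sub>G]\<close> is a coisometry from
  \<open>X\<^sub>0 \<oplus> H(K\<^sub>\<E>)\<close> onto \<open>H(K\<^sub>S)\<close>. Since \<open>M\<^sub>F = M\<^sub>\<Gamma>P\<^bsup>1/2\<^esup>\<close>, the operator \<open>M\<^sub>\<Gamma>\<close> is isometric, so \<open>M\<^sub>G\<close> is a partial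
  isometry onto the orthogonal complement of its range. A function \<open>M\<^sub>\<Gamma>a + M\<^sub>Gh\<close> satisfies the
  interpolation condition exactly when \<open>a\<close> is the vector representing \<open>x\<close>.\<close>

section \<open>Complex Hilbert spaces\<close>

text \<open>Boundedness of \<open>M_F\<close>, \<open>M_Gamma\<close> and \<open>M_G\<close> is not
  part of the data, and \<open>cadj\<close>, \<open>fadj\<close> and \<open>fproj\<close> are
  definite descriptions, so every adjoint and every projection has to be shown to exist. A single
  Riesz theorem does this for Hilbert space types, for the closed subspace \<open>X0 R\<close> and
  for its direct sum with the space of \<open>\<E>\<close>, since all of them are encoded as
  function spaces. The coisometry is what provides the adjoint vectors of \<open>M_F\<close>.
  Through them the definition of P becomes an equation between inner products, which makes
  \<open>M_Gamma\<close> isometric on the range of \<open>R\<close> and, by density, on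
  \<open>X0 R\<close>. The operator \<open>\<E> z\<close> may have norm 1, so solvability of the
  loop is sought in the state equation, where \<open>cmod z < 1\<close> gives a strict contraction.
  The zero corner of \<open>U\<close> permits the reduction to the state, and the inverse of
  \<open>U\<close> has a zero corner as well. As I - zT may fail to be invertible, the factorization
  of \<open>M_F\<close> through \<open>R\<close> is a limit statement and not pure algebra.\<close>

lemma scaleC_0_left [simp]: "0 *\<^sub>C (v::'a::complex_hilbert) = 0"
  using scaleC_of_real[of 0 v] by simp

lemma scaleC_1 [simp]: "1 *\<^sub>C (v::'a::complex_hilbert) = v"
  using scaleC_of_real[of 1 v] by simp

lemma scaleC_0_right [simp]: "c *\<^sub>C (0::'a::complex_hilbert) = 0"
  using scaleC_add_right[of c 0 "0::'a"] by simp

lemma scaleC_minus_right: "c *\<^sub>C (- v) = - (c *\<^sub>C (v::'a::complex_hilbert))"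
  by (metis add.inverse_unique add.right_inverse scaleC_0_right scaleC_add_right)

lemma scaleC_minus_left: "(- c) *\<^sub>C v = - (c *\<^sub>C (v::'a::complex_hilbert))"
  by (metis add.inverse_unique add.right_inverse scaleC_0_left scaleC_add_left)

lemma scaleC_minus1: "(- 1) *\<^sub>C v = - (v::'a::complex_hilbert)"
  by (simp add: scaleC_minus_left)

lemma scaleC_diff_right: "c *\<^sub>C (v - w) = c *\<^sub>C v - c *\<^sub>C (w::'a::complex_hilbert)"
  by (simp add: diff_conv_add_uminus scaleC_add_right scaleC_minus_right del: add_uminus_conv_diff)

lemma scaleC_diff_left: "(c - d) *\<^sub>C v = c *\<^sub>C v - d *\<^sub>C (v::'a::complex_hilbert)"
  by (simp add: diff_conv_add_uminus scaleC_add_left scaleC_minus_left del: add_uminus_conv_diff)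

lemma cinner_add_right: "cinner z (x + y) = cinner z x + cinner z (y::'a::complex_hilbert)"
  by (metis cinner_add_left cinner_commute complex_cnj_add)

lemma cinner_scaleC_right: "cinner x (c *\<^sub>C y) = cnj c * cinner x (y::'a::complex_hilbert)"
  by (metis cinner_commute cinner_scaleC_left complex_cnj_mult)

lemma cinner_minus_left: "cinner (- x) y = - cinner x (y::'a::complex_hilbert)"
  by (metis cinner_scaleC_left scaleC_minus1 mult_minus1)

lemma cinner_minus_right: "cinner x (- y) = - cinner x (y::'a::complex_hilbert)"
  by (metis cinner_commute cinner_minus_left complex_cnj_minus)

lemma cinner_diff_left: "cinner (x - y) z = cinner x z - cinner y (z::'a::complex_hilbert)"
  by (metis cinner_add_left cinner_minus_left diff_conv_add_uminus)

lemma cinner_diff_right: "cinner z (x - y) = cinner z x - cinner z (y::'a::complex_hilbert)"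
  by (metis cinner_add_right cinner_minus_right diff_conv_add_uminus)

lemma cinner_zero_left [simp]: "cinner 0 (y::'a::complex_hilbert) = 0"
  by (metis cinner_diff_left diff_self)

lemma cinner_zero_right [simp]: "cinner (y::'a::complex_hilbert) 0 = 0"
  by (metis cinner_diff_right diff_self)

lemmas cinner_sesquilinear =
  cinner_add_left cinner_add_right cinner_diff_left cinner_diff_right
  cinner_scaleC_left cinner_scaleC_right cinner_minus_left cinner_minus_right

lemma cinner_self: "cinner v v = complex_of_real ((norm (v::'a::complex_hilbert))\<^sup>2)"
proof (rule complex_eqI)
  show "Re (cinner v v) = Re (complex_of_real ((norm v)\<^sup>2))"
    by (simp add: Re_cinner power2_norm_eq_inner)
  have "Im (cinner v v) = - Im (cinner v v)"
    by (metis cinner_commute cnj.simps(2))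
  then show "Im (cinner v v) = Im (complex_of_real ((norm v)\<^sup>2))"
    by simp
qed

lemma cinner_self_eq_0_iff: "cinner v v = 0 \<longleftrightarrow> (v::'a::complex_hilbert) = 0"
  by (simp add: cinner_self)

text \<open>The norm comes from the real structure, whose axioms cover real scalars only;
  homogeneity for complex scalars is extracted from the sesquilinear form.\<close>

lemma norm_scaleC: "norm (c *\<^sub>C v) = cmod c * norm (v::'a::complex_hilbert)"
proof -
  have "complex_of_real ((norm (c *\<^sub>C v))\<^sup>2) = complex_of_real ((cmod c * norm v)\<^sup>2)"
    unfolding cinner_self[symmetric] power_mult_distrib of_real_mult complex_norm_square
    by (simp add: cinner_sesquilinear mult.commute cinner_complex_def)
  then have "(norm (c *\<^sub>C v))\<^sup>2 = (cmod c * norm v)\<^sup>2"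
    using of_real_eq_iff by blast
  then show ?thesis
    by (simp add: power2_eq_iff_nonneg)
qed

lemma cinner_ext:
  assumes "\<And>w. cinner a w = cinner b w"
  shows "a = (b::'a::complex_hilbert)"
  using assms[of "a - b"] cinner_self_eq_0_iff[of "a - b"]
  by (simp add: cinner_diff_left)

lemma cinner_ext_right:
  assumes "\<And>w. cinner w a = cinner w b"
  shows "a = (b::'a::complex_hilbert)"
  by (rule cinner_ext) (metis assms cinner_commute)

text \<open>A unimodular factor \<open>c\<close> turns \<open>cinner a b\<close> into its modulus,
  which is then a value of the real inner product, where the real Cauchy-Schwarz inequality
  applies.\<close>

lemma norm_cinner_le: "cmod (cinner a b) \<le> norm a * norm (b::'a::complex_hilbert)"
proof (cases "cinner a b = 0")
  case False
  define c where "c = cnj (cinner a b) / cmod (cinner a b)"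
  have "cmod c = 1"
    using False by (simp add: c_def norm_divide)
  have "c * cinner a b = complex_of_real (cmod (cinner a b))"
    using False by (simp add: c_def mult.commute[of "cnj _"] complex_norm_square[symmetric] power2_eq_square)
  then have "cmod (cinner a b) = inner (c *\<^sub>C a) b"
    by (metis Re_cinner Re_complex_of_real cinner_scaleC_left)
  also have "\<dots> \<le> norm (c *\<^sub>C a) * norm b"
    by (rule norm_cauchy_schwarz)
  finally show ?thesis
    by (simp add: norm_scaleC \<open>cmod c = 1\<close>)
qed simp

definition csubspace :: "'a::complex_hilbert set \<Rightarrow> bool"
  where "csubspace L \<longleftrightarrow>
    0 \<in> L \<and> (\<forall>a\<in>L. \<forall>b\<in>L. a + b \<in> L) \<and> (\<forall>c. \<forall>a\<in>L. c *\<^sub>C a \<in> L)"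

lemma csubspace_diff: "csubspace L \<Longrightarrow> a \<in> L \<Longrightarrow> b \<in> L \<Longrightarrow> a - b \<in> L"
  unfolding csubspace_def by (metis add_uminus_conv_diff scaleC_minus1)

lemma csubspace_UNIV: "csubspace UNIV"
  by (simp add: csubspace_def)

lemma bounded_clinear_simps:
  assumes "bounded_clinear A"
  shows "A (a + b) = A a + A b" "A (a - b) = A a - A b" "A 0 = 0" "A (c *\<^sub>C a) = c *\<^sub>C A a"
  using assms unfolding bounded_clinear_def
  by (auto simp: linear_simps)

lemma tendsto_scaleC:
  assumes "(f \<longlongrightarrow> (l::'a::complex_hilbert)) F"
  shows "((\<lambda>n. c *\<^sub>C f n) \<longlongrightarrow> c *\<^sub>C l) F"
proof -
  have "((\<lambda>n. cmod c * norm (f n - l)) \<longlongrightarrow> 0) F"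
    using assms by (auto intro!: tendsto_mult_right_zero tendsto_norm_zero simp: LIM_zero)
  moreover have "\<forall>\<^sub>F n in F. norm (c *\<^sub>C f n - c *\<^sub>C l) \<le> cmod c * norm (f n - l)"
    by (simp add: norm_scaleC scaleC_diff_right[symmetric])
  ultimately have "((\<lambda>n. c *\<^sub>C f n - c *\<^sub>C l) \<longlongrightarrow> 0) F"
    by (rule Lim_null_comparison[rotated])
  then show ?thesis
    by (rule LIM_zero_cancel)
qed

lemma tendsto_cinner_left:
  assumes "(f \<longlongrightarrow> (l::'a::complex_hilbert)) F"
  shows "((\<lambda>n. cinner (f n) b) \<longlongrightarrow> cinner l b) F"
proof -
  have "((\<lambda>n. norm (f n - l) * norm b) \<longlongrightarrow> 0) F"
    using assms by (auto intro!: tendsto_mult_left_zero tendsto_norm_zero simp: LIM_zero)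
  moreover have "\<forall>\<^sub>F n in F. cmod (cinner (f n) b - cinner l b) \<le> norm (f n - l) * norm b"
    by (simp add: norm_cinner_le cinner_diff_left[symmetric])
  ultimately have "((\<lambda>n. cinner (f n) b - cinner l b) \<longlongrightarrow> 0) F"
    by (rule Lim_null_comparison[rotated])
  then show ?thesis
    by (rule LIM_zero_cancel)
qed

lemma csubspace_range:
  assumes "bounded_clinear A"
  shows "csubspace (range A)"
  unfolding csubspace_def
  by (auto intro: range_eqI simp: bounded_clinear_simps[OF assms, symmetric])

lemma csubspace_closure:
  assumes L: "csubspace L"
  shows "csubspace (closure L)"
  unfolding csubspace_def
proof (intro conjI ballI allI)
  show "0 \<in> closure L"
    using L closure_subset unfolding csubspace_def by blast
next
  fix a b assume "a \<in> closure L" "b \<in> closure L"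
  then obtain s t where "\<And>n::nat. s n \<in> L" "s \<longlonglongrightarrow> a" "\<And>n::nat. t n \<in> L" "t \<longlonglongrightarrow> b"
    unfolding closure_sequential by metis
  then show "a + b \<in> closure L"
    using L unfolding closure_sequential csubspace_def
    by (intro exI[of _ "\<lambda>n. s n + t n"]) (auto intro: tendsto_add)
next
  fix c a assume "a \<in> closure L"
  then obtain s where "\<And>n::nat. s n \<in> L" "s \<longlonglongrightarrow> a"
    unfolding closure_sequential by metis
  then show "c *\<^sub>C a \<in> closure L"
    using L unfolding closure_sequential csubspace_def
    by (intro exI[of _ "\<lambda>n. c *\<^sub>C s n"]) (auto intro: tendsto_scaleC)
qed

section \<open>Hilbert spaces of functions\<close>

text \<open>A \<open>fun_space\<close> is a value and not a type, so facts about the class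
  \<open>complex_hilbert\<close> do not reach it; the sesquilinear calculus is redone here with
  carrier premises.\<close>

locale function_hilbert_space =
  fixes H :: "'a::complex_hilbert fun_space"
  assumes H: "fun_hilbert H"
begin

lemma off_disk: "f \<in> fcarrier H \<Longrightarrow> on_disk f = f"
  using H unfolding fun_hilbert_def by (elim conjE) blast

lemma zero_mem: "(\<lambda>z. 0) \<in> fcarrier H"
  using H unfolding fun_hilbert_def by (elim conjE) blast

lemma add_mem: "f \<in> fcarrier H \<Longrightarrow> g \<in> fcarrier H \<Longrightarrow> (\<lambda>z. f z + g z) \<in> fcarrier H"
  using H unfolding fun_hilbert_def by (elim conjE) blast

lemma scale_mem: "f \<in> fcarrier H \<Longrightarrow> (\<lambda>z. c *\<^sub>C f z) \<in> fcarrier H"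
  using H unfolding fun_hilbert_def by (elim conjE) blast

lemma finner_commute: "f \<in> fcarrier H \<Longrightarrow> g \<in> fcarrier H \<Longrightarrow> finner H f g = cnj (finner H g f)"
  using H unfolding fun_hilbert_def by (elim conjE) blast

lemma finner_add_left:
  "f \<in> fcarrier H \<Longrightarrow> g \<in> fcarrier H \<Longrightarrow> k \<in> fcarrier H \<Longrightarrow>
    finner H (\<lambda>z. f z + g z) k = finner H f k + finner H g k"
  using H unfolding fun_hilbert_def by (elim conjE) blast

lemma finner_scale_left:
  "f \<in> fcarrier H \<Longrightarrow> g \<in> fcarrier H \<Longrightarrow> finner H (\<lambda>z. c *\<^sub>C f z) g = c * finner H f g"
  using H unfolding fun_hilbert_def by (elim conjE) blast

lemma finner_nonneg: "f \<in> fcarrier H \<Longrightarrow> 0 \<le> Re (finner H f f)"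
  using H unfolding fun_hilbert_def by (elim conjE) blast

lemma finner_definite: "f \<in> fcarrier H \<Longrightarrow> finner H f f = 0 \<Longrightarrow> f = (\<lambda>z. 0)"
  using H unfolding fun_hilbert_def by (elim conjE) blast

lemma fnorm_complete:
  assumes "\<And>n. \<phi> n \<in> fcarrier H"
    and "\<And>e. e > 0 \<Longrightarrow> \<exists>n0. \<forall>m\<ge>n0. \<forall>n\<ge>n0. fnorm H (\<lambda>z. \<phi> m z - \<phi> n z) < e"
  obtains f where "f \<in> fcarrier H" "(\<lambda>n. fnorm H (\<lambda>z. \<phi> n z - f z)) \<longlonglongrightarrow> 0"
  using H assms unfolding fun_hilbert_def by blast

lemma minus_mem: "f \<in> fcarrier H \<Longrightarrow> (\<lambda>z. - f z) \<in> fcarrier H"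
  using scale_mem[of f "- 1"] by (simp add: scaleC_minus1)

lemma diff_mem: "f \<in> fcarrier H \<Longrightarrow> g \<in> fcarrier H \<Longrightarrow> (\<lambda>z. f z - g z) \<in> fcarrier H"
  using add_mem[of f "\<lambda>z. - g z"] by (simp add: minus_mem)

lemma finner_add_right:
  "f \<in> fcarrier H \<Longrightarrow> g \<in> fcarrier H \<Longrightarrow> k \<in> fcarrier H \<Longrightarrow>
    finner H k (\<lambda>z. f z + g z) = finner H k f + finner H k g"
  using finner_commute[of k "\<lambda>z. f z + g z"] finner_commute[of k f] finner_commute[of k g]
  by (simp add: add_mem finner_add_left)

lemma finner_scale_right:
  "f \<in> fcarrier H \<Longrightarrow> g \<in> fcarrier H \<Longrightarrow> finner H g (\<lambda>z. c *\<^sub>C f z) = cnj c * finner H g f"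
  using finner_commute[of g "\<lambda>z. c *\<^sub>C f z"] finner_commute[of g f]
  by (simp add: scale_mem finner_scale_left)

lemma finner_minus_left:
  "f \<in> fcarrier H \<Longrightarrow> g \<in> fcarrier H \<Longrightarrow> finner H (\<lambda>z. - f z) g = - finner H f g"
  using finner_scale_left[of f g "- 1"] by (simp add: scaleC_minus1)

lemma finner_minus_right:
  "f \<in> fcarrier H \<Longrightarrow> g \<in> fcarrier H \<Longrightarrow> finner H g (\<lambda>z. - f z) = - finner H g f"
  using finner_scale_right[of f g "- 1"] by (simp add: scaleC_minus1)

lemma finner_diff_left:
  "f \<in> fcarrier H \<Longrightarrow> g \<in> fcarrier H \<Longrightarrow> k \<in> fcarrier H \<Longrightarrow>
    finner H (\<lambda>z. f z - g z) k = finner H f k - finner H g k"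
  using finner_add_left[of f "\<lambda>z. - g z" k] by (simp add: minus_mem finner_minus_left)

lemma finner_diff_right:
  "f \<in> fcarrier H \<Longrightarrow> g \<in> fcarrier H \<Longrightarrow> k \<in> fcarrier H \<Longrightarrow>
    finner H k (\<lambda>z. f z - g z) = finner H k f - finner H k g"
  using finner_add_right[of f "\<lambda>z. - g z" k] by (simp add: minus_mem finner_minus_right)

lemma finner_zero_left: "f \<in> fcarrier H \<Longrightarrow> finner H (\<lambda>z. 0) f = 0"
  using finner_scale_left[OF zero_mem, of f 0] by simp

lemma finner_zero_right: "f \<in> fcarrier H \<Longrightarrow> finner H f (\<lambda>z. 0) = 0"
  using finner_scale_right[OF zero_mem, of f 0] by simp

lemmas mem = zero_mem add_mem scale_mem minus_mem diff_mem

lemmas finner_sesquilinear =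
  finner_add_left finner_add_right finner_diff_left finner_diff_right finner_scale_left
  finner_scale_right finner_minus_left finner_minus_right finner_zero_left finner_zero_right

lemma fnorm_square: "f \<in> fcarrier H \<Longrightarrow> (fnorm H f)\<^sup>2 = Re (finner H f f)"
  by (simp add: fnorm_def finner_nonneg)

lemma fnorm_nonneg: "f \<in> fcarrier H \<Longrightarrow> 0 \<le> fnorm H f"
  by (simp add: fnorm_def finner_nonneg)

lemma finner_self: "f \<in> fcarrier H \<Longrightarrow> finner H f f = complex_of_real ((fnorm H f)\<^sup>2)"
  by (rule complex_eqI) (auto simp: fnorm_square, metis Reals_cnj_iff complex_is_Real_iff finner_commute)

lemma fnorm_zero: "fnorm H (\<lambda>z. 0) = 0"
  by (simp add: fnorm_def finner_zero_left zero_mem)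

lemma fnorm_eq_0: "f \<in> fcarrier H \<Longrightarrow> fnorm H f = 0 \<Longrightarrow> f = (\<lambda>z. 0)"
  by (rule finner_definite) (simp_all add: finner_self)

lemma fnorm_scale: "f \<in> fcarrier H \<Longrightarrow> fnorm H (\<lambda>z. c *\<^sub>C f z) = cmod c * fnorm H f"
proof -
  assume f: "f \<in> fcarrier H"
  then have "finner H (\<lambda>z. c *\<^sub>C f z) (\<lambda>z. c *\<^sub>C f z) = complex_of_real ((cmod c * fnorm H f)\<^sup>2)"
    unfolding power_mult_distrib of_real_mult complex_norm_square[of c]
    by (simp add: finner_scale_left finner_scale_right scale_mem finner_self)
  then show ?thesis
    using f by (simp add: fnorm_def[of _ "\<lambda>z. c *\<^sub>C f z"] fnorm_nonneg)
qed

lemma fnorm_diff_commute: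
  "f \<in> fcarrier H \<Longrightarrow> g \<in> fcarrier H \<Longrightarrow> fnorm H (\<lambda>z. f z - g z) = fnorm H (\<lambda>z. g z - f z)"
  using fnorm_scale[of "\<lambda>z. f z - g z" "- 1"] by (simp add: scaleC_minus1 diff_mem)

lemma cauchy_schwarz:
  assumes f: "f \<in> fcarrier H" and g: "g \<in> fcarrier H"
  shows "cmod (finner H f g) \<le> fnorm H f * fnorm H g"
proof (cases "fnorm H g = 0")
  case True
  then have "g = (\<lambda>z. 0)"
    using g by (simp add: fnorm_eq_0)
  then show ?thesis
    using f g by (simp add: finner_zero_right fnorm_zero)
next
  case False
  define n where "n = (fnorm H g)\<^sup>2"
  have n: "n > 0"
    using False by (simp add: n_def)
  \<comment> \<open>\<open>c\<close> times \<open>g\<close> is the orthogonal projection of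
    \<open>f\<close> onto the line spanned by \<open>g\<close>; what follows is nonnegativity of the
    squared residual.\<close>
  define c where "c = finner H f g / n"
  have gf: "finner H g f = cnj (finner H f g)"
    using f g by (rule finner_commute[rotated])
  have "0 \<le> Re (finner H (\<lambda>z. f z - c *\<^sub>C g z) (\<lambda>z. f z - c *\<^sub>C g z))"
    using f g by (simp add: finner_nonneg mem)
  also have "finner H (\<lambda>z. f z - c *\<^sub>C g z) (\<lambda>z. f z - c *\<^sub>C g z)
      = (fnorm H f)\<^sup>2 - finner H f g * cnj (finner H f g) / n"
    using f g n by (simp add: finner_sesquilinear mem finner_self gf n_def[symmetric] c_def field_simps)
  also have "finner H f g * cnj (finner H f g) = complex_of_real ((cmod (finner H f g))\<^sup>2)"
    by (simp only: complex_norm_square)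
  finally have "(cmod (finner H f g))\<^sup>2 / n \<le> (fnorm H f)\<^sup>2"
    by simp
  then have "(cmod (finner H f g))\<^sup>2 \<le> (fnorm H f * fnorm H g)\<^sup>2"
    using n by (simp add: n_def field_simps power_mult_distrib)
  then show ?thesis
    using f g by (meson fnorm_nonneg mult_nonneg_nonneg power2_le_imp_le)
qed

end

section \<open>Riesz representation and orthogonal projection\<close>

context function_hilbert_space
begin

lemma tendsto_finner_left:
  assumes "\<And>n. F n \<in> fcarrier H" "g \<in> fcarrier H" "f \<in> fcarrier H"
    and lim: "(\<lambda>n. fnorm H (\<lambda>z. F n z - g z)) \<longlonglongrightarrow> 0"
  shows "(\<lambda>n. finner H (F n) f) \<longlonglongrightarrow> finner H g f"
proof -
  have "(\<lambda>n. fnorm H (\<lambda>z. F n z - g z) * fnorm H f) \<longlonglongrightarrow> 0"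
    by (rule tendsto_mult_left_zero[OF lim])
  moreover have "\<forall>\<^sub>F n in sequentially.
      cmod (finner H (F n) f - finner H g f) \<le> fnorm H (\<lambda>z. F n z - g z) * fnorm H f"
    using assms by (simp add: finner_diff_left[symmetric] cauchy_schwarz diff_mem)
  ultimately have "(\<lambda>n. finner H (F n) f - finner H g f) \<longlonglongrightarrow> 0"
    by (rule Lim_null_comparison[rotated])
  then show ?thesis
    by (rule LIM_zero_cancel)
qed

text \<open>The representing vector is the limit of a minimizing sequence of
  \<open>f \<mapsto> \<parallel>f\<parallel>\<^sup>2 - 2 Re (\<phi> f)\<close>.\<close>

lemma riesz_on_subspace:
  assumes D: "D \<subseteq> fcarrier H" "(\<lambda>z. 0) \<in> D"
      "\<And>f g. f \<in> D \<Longrightarrow> g \<in> D \<Longrightarrow> (\<lambda>z. f z + g z) \<in> D"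
      "\<And>c f. f \<in> D \<Longrightarrow> (\<lambda>z. c *\<^sub>C f z) \<in> D"
    and \<phi>_add: "\<And>f g. f \<in> D \<Longrightarrow> g \<in> D \<Longrightarrow> \<phi> (\<lambda>z. f z + g z) = \<phi> f + \<phi> g"
    and \<phi>_scale: "\<And>c f. f \<in> D \<Longrightarrow> \<phi> (\<lambda>z. c *\<^sub>C f z) = c * \<phi> f"
    and \<phi>_bound: "\<And>f. f \<in> D \<Longrightarrow> cmod (\<phi> f) \<le> C * fnorm H f"
  obtains g where "g \<in> fclosure H D" "\<And>f. f \<in> D \<Longrightarrow> \<phi> f = finner H f g"
proof -
  define J where "J f = Re (finner H f f) - 2 * Re (\<phi> f)" for f
  define s where "s = Inf (J ` D)"
  have DH: "f \<in> fcarrier H" if "f \<in> D" for f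
    using D that by blast
  have "- C\<^sup>2 \<le> J f" if f: "f \<in> D" for f
  proof -
    have "Re (\<phi> f) \<le> C * fnorm H f"
      using \<phi>_bound[OF f] complex_Re_le_cmod order_trans by blast
    then have "J f \<ge> (fnorm H f)\<^sup>2 - 2 * (C * fnorm H f)"
      using f by (simp add: J_def fnorm_square DH)
    moreover have "0 \<le> (fnorm H f - C)\<^sup>2"
      by simp
    ultimately show ?thesis
      by (simp add: power2_diff algebra_simps)
  qed
  then have bdd: "bdd_below (J ` D)"
    by (intro bdd_belowI2)
  have s_le: "s \<le> J f" if "f \<in> D" for f
    unfolding s_def using bdd that by (intro cInf_lower) auto
  have "\<exists>f\<in>D. J f < s + 1 / real (Suc n)" for n
    using cInf_lessD[of "J ` D" "s + 1 / real (Suc n)"] D(2) by (auto simp: s_def)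
  then obtain F where F: "\<And>n. F n \<in> D" "\<And>n. J (F n) < s + 1 / real (Suc n)"
    by metis
  have FH: "F n \<in> fcarrier H" for n
    using F DH by blast
  \<comment> \<open>Parallelogram law for \<open>J\<close>: in \<open>J f + J g - 2 * J ?m\<close>
    the linear parts cancel and half of the squared distance remains, while \<open>J ?m\<close> is
    at least \<open>s\<close>.\<close>
  have para: "(fnorm H (\<lambda>z. f z - g z))\<^sup>2 \<le> 2 * (J f - s) + 2 * (J g - s)"
    if f: "f \<in> D" and g: "g \<in> D" for f g
  proof -
    let ?m = "\<lambda>z. (1/2) *\<^sub>C (f z + g z)"
    have fg: "f \<in> fcarrier H" "g \<in> fcarrier H"
      using f g DH by auto
    have "s \<le> J ?m"
      by (intro s_le D f g)
    moreover have "Re (finner H ?m ?m)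
        = (Re (finner H f f) + Re (finner H f g) + Re (finner H g f) + Re (finner H g g)) / 4"
      using fg by (simp add: finner_scale_left finner_scale_right finner_add_left finner_add_right
          add_mem scale_mem)
    moreover have "Re (\<phi> ?m) = (Re (\<phi> f) + Re (\<phi> g)) / 2"
      using f g D \<phi>_add \<phi>_scale by simp
    moreover have "(fnorm H (\<lambda>z. f z - g z))\<^sup>2
        = Re (finner H f f) - Re (finner H f g) - Re (finner H g f) + Re (finner H g g)"
      using fg by (simp add: fnorm_square finner_diff_left finner_diff_right diff_mem)
    ultimately show ?thesis
      unfolding J_def by argo
  qed
  have cauchy: "\<exists>n0. \<forall>m\<ge>n0. \<forall>n\<ge>n0. fnorm H (\<lambda>z. F m z - F n z) < e" if e: "e > 0" for e
  proof -
    \<comment> \<open>Both excesses over \<open>s\<close> are below a quarter of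
      \<open>e\<^sup>2\<close>, and \<open>para\<close> doubles each of them.\<close>
    obtain n0 where n0: "1 / real (Suc n0) < e\<^sup>2 / 4"
      using nat_approx_posE[of "e\<^sup>2 / 4"] e by auto
    have "fnorm H (\<lambda>z. F m z - F n z) < e" if mn: "m \<ge> n0" "n \<ge> n0" for m n
    proof -
      have "1 / real (Suc m) \<le> 1 / real (Suc n0)" "1 / real (Suc n) \<le> 1 / real (Suc n0)"
        using mn by (simp_all add: field_simps)
      then have "(fnorm H (\<lambda>z. F m z - F n z))\<^sup>2 < e\<^sup>2"
        using para[OF F(1)[of m] F(1)[of n]] F(2)[of m] F(2)[of n] n0 by argo
      then show ?thesis
        using e by (simp add: power2_less_imp_less)
    qed
    then show ?thesis
      by blast
  qed
  obtain g where g: "g \<in> fcarrier H" and lim: "(\<lambda>n. fnorm H (\<lambda>z. F n z - g z)) \<longlonglongrightarrow> 0"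
    using fnorm_complete[of F] FH cauchy by blast
  have closure: "g \<in> fclosure H D"
    unfolding fclosure_def
  proof (intro CollectI conjI allI impI g)
    fix e :: real assume "e > 0"
    then obtain n where "fnorm H (\<lambda>z. F n z - g z) < e"
      using order_tendstoD(2)[OF lim] by (meson eventually_happens trivial_limit_sequentially)
    then show "\<exists>k\<in>D. fnorm H (\<lambda>z. g z - k z) < e"
      using F(1) FH g fnorm_diff_commute by (intro bexI[of _ "F n"]) auto
  qed
  have Re_eq: "Re (\<phi> f) = Re (finner H f g)" if f: "f \<in> D" for f
  proof -
    define q where "q = Re (finner H f f)"
    define b where "b = Re (finner H g f) - Re (\<phi> f)"
    have q: "0 \<le> q"
      using f by (simp add: q_def finner_nonneg DH)
    have ineq: "0 \<le> t\<^sup>2 * q + 2 * t * b" for t :: real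
    proof -
      have "- (1 / real (Suc n)) \<le> t\<^sup>2 * q + 2 * t * (Re (finner H (F n) f) - Re (\<phi> f))" for n
      proof -
        let ?v = "\<lambda>z. F n z + of_real t *\<^sub>C f z"
        have fH: "f \<in> fcarrier H" "F n \<in> fcarrier H"
          using f DH FH by auto
        have "s \<le> J ?v"
          by (intro s_le D f F)
        moreover have "finner H f (F n) = cnj (finner H (F n) f)"
          using fH by (rule finner_commute)
        moreover have "finner H ?v ?v = finner H (F n) (F n)
            + t * (finner H (F n) f + finner H f (F n)) + t\<^sup>2 * finner H f f"
          using fH by (simp add: finner_scale_left finner_scale_right finner_add_left
              finner_add_right add_mem scale_mem algebra_simps power2_eq_square)
        moreover have "\<phi> ?v = \<phi> (F n) + t * \<phi> f"
          using f F D \<phi>_add \<phi>_scale by simp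
        ultimately have "s \<le> J (F n) + 2 * t * Re (finner H (F n) f) + t\<^sup>2 * q - 2 * t * Re (\<phi> f)"
          by (simp add: J_def q_def algebra_simps flip: of_real_power)
        then show ?thesis
          using F(2)[of n] by (simp add: algebra_simps)
      qed
      moreover have "(\<lambda>n. t\<^sup>2 * q + 2 * t * (Re (finner H (F n) f) - Re (\<phi> f)))
          \<longlonglongrightarrow> t\<^sup>2 * q + 2 * t * b"
        unfolding b_def using FH g f lim DH by (intro tendsto_intros tendsto_finner_left) auto
      moreover have "(\<lambda>n. - (1 / real (Suc n))) \<longlonglongrightarrow> 0"
        using tendsto_minus[OF LIMSEQ_inverse_real_of_nat] by (simp add: inverse_eq_divide)
      ultimately show ?thesis
        by (meson LIMSEQ_le)
    qed
    have "b = 0"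
    proof (rule ccontr)
      assume b: "b \<noteq> 0"
      \<comment> \<open>The optimal \<open>t\<close> would be \<open>- b / q\<close>; the added 1
        covers \<open>q = 0\<close> and still leaves a negative value.\<close>
      have "0 \<le> (- b / (q + 1))\<^sup>2 * q + 2 * (- b / (q + 1)) * b"
        by (rule ineq)
      also have "\<dots> = b\<^sup>2 * (- q - 2) / (q + 1)\<^sup>2"
        using q by (simp add: power2_eq_square divide_simps) (simp add: algebra_simps)
      also have "\<dots> < 0"
        using b q by (intro divide_neg_pos mult_pos_neg) auto
      finally show False
        by simp
    qed
    moreover have "Re (finner H g f) = Re (finner H f g)"
      using finner_commute[OF DH[OF f] g] by simp
    ultimately show ?thesis
      by (simp add: b_def)
  qed
  have "\<phi> f = finner H f g" if f: "f \<in> D" for f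
  proof (rule complex_eqI)
    show "Re (\<phi> f) = Re (finner H f g)"
      by (rule Re_eq[OF f])
    \<comment> \<open>A complex linear functional is determined by its real part: the imaginary part
      at \<open>f\<close> is minus the real part at \<open>\<i>\<close> times
      \<open>f\<close>.\<close>
    show "Im (\<phi> f) = Im (finner H f g)"
      using Re_eq[OF D(4)[OF f, of \<i>]] f g by (simp add: \<phi>_scale finner_scale_left DH)
  qed
  with closure show thesis
    by (rule that)
qed

lemma fominus_mem: "g \<in> fominus H B \<Longrightarrow> g \<in> fcarrier H"
  by (simp add: fominus_def)

text \<open>Riesz for the functional \<open>f \<mapsto> finner H f h\<close> on the annihilator
  yields the projection of \<open>h\<close>, a priori only in the closure; the epsilon argument
  shows that an annihilator is closed.\<close>

lemma projection_fominus:
  assumes B: "B \<subseteq> fcarrier H" and h: "h \<in> fcarrier H"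
  obtains g where "g \<in> fominus H B" "\<And>k. k \<in> fominus H B \<Longrightarrow> finner H (\<lambda>z. h z - g z) k = 0"
proof -
  let ?L = "fominus H B"
  have BH: "b \<in> fcarrier H" if "b \<in> B" for b
    using B that by blast
  obtain g where cl: "g \<in> fclosure H ?L" and g: "\<And>f. f \<in> ?L \<Longrightarrow> finner H f h = finner H f g"
  proof (rule riesz_on_subspace[of ?L "\<lambda>f. finner H f h" "fnorm H h"])
    show "cmod (finner H f h) \<le> fnorm H h * fnorm H f" if "f \<in> ?L" for f
      using cauchy_schwarz[OF fominus_mem[OF that] h] by (simp add: mult.commute)
  qed (use h BH in \<open>auto simp: fominus_def mem finner_add_left finner_scale_left finner_zero_left\<close>)
  have gH: "g \<in> fcarrier H"
    using cl by (simp add: fclosure_def)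
  have "finner H g b = 0" if b: "b \<in> B" for b
  proof -
    have "cmod (finner H g b) \<le> e" if e: "e > 0" for e
    proof -
      define d where "d = e / (fnorm H b + 1)"
      have pos: "0 < fnorm H b + 1"
        using fnorm_nonneg[OF BH[OF b]] by simp
      then have "d > 0"
        using e by (simp add: d_def)
      then obtain k where k: "k \<in> ?L" "fnorm H (\<lambda>z. g z - k z) < d"
        using cl unfolding fclosure_def by blast
      have "finner H g b = finner H (\<lambda>z. g z - k z) b"
        using k b gH BH by (simp add: finner_diff_left fominus_def)
      also have "cmod \<dots> \<le> fnorm H (\<lambda>z. g z - k z) * fnorm H b"
        using k b gH BH by (intro cauchy_schwarz mem) (auto simp: fominus_def)
      also have "\<dots> \<le> d * (fnorm H b + 1)"
        using k pos \<open>d > 0\<close> fnorm_nonneg[OF BH[OF b]] by (intro mult_mono) auto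
      also have "\<dots> = e"
        using pos by (simp add: d_def)
      finally show ?thesis .
    qed
    then show ?thesis
      using field_le_epsilon[of "cmod (finner H g b)" 0] by simp
  qed
  then have gL: "g \<in> ?L"
    using gH by (simp add: fominus_def)
  moreover have "finner H (\<lambda>z. h z - g z) k = 0" if k: "k \<in> ?L" for k
  proof -
    have "finner H k (\<lambda>z. h z - g z) = 0"
      using g[OF k] fominus_mem[OF k] h gH by (simp add: finner_diff_right)
    then show ?thesis
      using finner_commute[of "\<lambda>z. h z - g z" k] fominus_mem[OF k] h gH by (simp add: diff_mem)
  qed
  ultimately show thesis
    by (rule that)
qed

text \<open>Two candidates for the projection differ by an element of the annihilator that is
  orthogonal to itself. This uniqueness is what allows the definite description \<open>fproj\<close>
  to be evaluated.\<close>

lemma fproj_eqI: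
  assumes B: "B \<subseteq> fcarrier H" and h: "h \<in> fcarrier H" and g: "g \<in> fominus H B"
    and orth: "\<And>k. k \<in> fominus H B \<Longrightarrow> finner H (\<lambda>z. h z - g z) k = 0"
  shows "fproj H (fominus H B) h = g"
  unfolding fproj_def
proof (rule the_equality)
  fix g' assume g': "g' \<in> fominus H B \<and> (\<forall>k\<in>fominus H B. finner H (\<lambda>z. h z - g' z) k = 0)"
  let ?d = "\<lambda>z. g z - g' z"
  have gH: "g \<in> fcarrier H" "g' \<in> fcarrier H"
    using g g' by (auto simp: fominus_def)
  have d: "?d \<in> fominus H B"
    using g g' B by (auto simp: fominus_def mem finner_diff_left subset_iff)
  have "finner H h ?d = finner H g ?d" "finner H h ?d = finner H g' ?d"
    using orth[OF d] g' d gH h by (auto simp: finner_diff_left mem)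
  then have "finner H ?d ?d = 0"
    using gH by (simp add: finner_diff_left[of g g' ?d] mem)
  then have "?d = (\<lambda>z. 0)"
    using gH by (intro finner_definite) (simp_all add: mem)
  then show "g' = g"
    by (auto simp: fun_eq_iff)
qed (use g orth in auto)

end

text \<open>Vectors become functions constant on the disk and are recovered at its point 0. A
  Hilbert space type, a closed subspace and a direct sum with a function space thus all fall under
  the one predicate \<open>fun_hilbert\<close>.\<close>

definition const_space :: "'a::complex_hilbert set \<Rightarrow> 'a fun_space"
  where "const_space L = \<lparr>fcarrier = (\<lambda>a. on_disk (\<lambda>z. a)) ` L, finner = \<lambda>f g. cinner (f 0) (g 0)\<rparr>"

definition prod_space ::
    "'a::complex_hilbert fun_space \<Rightarrow> 'b::complex_hilbert fun_space \<Rightarrow> ('a \<times> 'b) fun_space"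
  where "prod_space H1 H2 =
    \<lparr>fcarrier = {p. (\<lambda>z. fst (p z)) \<in> fcarrier H1 \<and> (\<lambda>z. snd (p z)) \<in> fcarrier H2},
     finner = \<lambda>p q. finner H1 (\<lambda>z. fst (p z)) (\<lambda>z. fst (q z))
       + finner H2 (\<lambda>z. snd (p z)) (\<lambda>z. snd (q z))\<rparr>"

lemma on_disk_0 [simp]: "on_disk f 0 = f 0"
  by (simp add: on_disk_def)

lemma on_disk_eq [simp]: "z \<in> \<bbbD> \<Longrightarrow> on_disk f z = f z"
  by (simp add: on_disk_def)

lemma fnorm_const_space: "fnorm (const_space L) f = norm (f 0)"
  by (simp add: fnorm_def const_space_def Re_cinner norm_eq_sqrt_inner)

lemma fun_hilbert_const_space:
  assumes L: "csubspace L" and cl: "closed L"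
  shows "fun_hilbert (const_space L)"
  unfolding fun_hilbert_def
proof (intro conjI ballI allI impI)
  fix f assume "f \<in> fcarrier (const_space L)"
  then show "on_disk f = f"
    by (auto simp: const_space_def on_disk_def)
next
  show "(\<lambda>z. 0) \<in> fcarrier (const_space L)"
    using L unfolding csubspace_def by (auto simp: const_space_def on_disk_def intro!: image_eqI[of _ _ 0])
next
  fix f g assume "f \<in> fcarrier (const_space L)" "g \<in> fcarrier (const_space L)"
  then obtain a b where "a \<in> L" "b \<in> L" "f = on_disk (\<lambda>z. a)" "g = on_disk (\<lambda>z. b)"
    by (auto simp: const_space_def)
  then show "(\<lambda>z. f z + g z) \<in> fcarrier (const_space L)"
    using L unfolding csubspace_def
    by (auto simp: const_space_def on_disk_def fun_eq_iff intro!: image_eqI[of _ _ "a + b"])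
next
  fix c f assume "f \<in> fcarrier (const_space L)"
  then obtain a where "a \<in> L" "f = on_disk (\<lambda>z. a)"
    by (auto simp: const_space_def)
  then show "(\<lambda>z. c *\<^sub>C f z) \<in> fcarrier (const_space L)"
    using L unfolding csubspace_def
    by (auto simp: const_space_def on_disk_def fun_eq_iff intro!: image_eqI[of _ _ "c *\<^sub>C a"])
next
  fix f g assume "f \<in> fcarrier (const_space L)" "g \<in> fcarrier (const_space L)"
  show "finner (const_space L) f g = cnj (finner (const_space L) g f)"
    unfolding const_space_def by (simp, rule cinner_commute)
next
  fix f assume "f \<in> fcarrier (const_space L)" "finner (const_space L) f f = 0"
  then show "f = (\<lambda>z. 0)"
    by (auto simp: const_space_def cinner_self_eq_0_iff on_disk_def)
next
  fix f
  show "0 \<le> Re (finner (const_space L) f f)"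
    by (simp add: const_space_def Re_cinner)
next
  fix \<phi> :: "nat \<Rightarrow> complex \<Rightarrow> 'a" assume *: "(\<forall>n. \<phi> n \<in> fcarrier (const_space L)) \<and>
    (\<forall>e>0. \<exists>n0. \<forall>m\<ge>n0. \<forall>n\<ge>n0. fnorm (const_space L) (\<lambda>z. \<phi> m z - \<phi> n z) < e)"
  then have "\<forall>n. \<exists>a\<in>L. \<phi> n = on_disk (\<lambda>z. a)"
    by (auto simp: const_space_def)
  then obtain a where a: "\<And>n. a n \<in> L" "\<And>n. \<phi> n = on_disk (\<lambda>z. a n)"
    by metis
  have "Cauchy a"
    using * by (simp add: Cauchy_def dist_norm fnorm_const_space a)
  then obtain l where l: "a \<longlonglongrightarrow> l"
    using Cauchy_convergent convergent_def by blast
  then have "l \<in> L"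
    using a cl closed_sequentially by blast
  moreover have "(\<lambda>n. norm (a n - l)) \<longlonglongrightarrow> 0"
    using l LIM_zero tendsto_norm_zero by blast
  ultimately show "\<exists>f\<in>fcarrier (const_space L).
      (\<lambda>n. fnorm (const_space L) (\<lambda>z. \<phi> n z - f z)) \<longlonglongrightarrow> 0"
    by (intro bexI[of _ "on_disk (\<lambda>z. l)"]) (auto simp: fnorm_const_space a, simp add: const_space_def)
qed (simp_all add: const_space_def cinner_sesquilinear)

lemma fnorm_prod_space:
  assumes "fun_hilbert H1" "fun_hilbert H2" "p \<in> fcarrier (prod_space H1 H2)"
  shows "(fnorm (prod_space H1 H2) p)\<^sup>2 =
    (fnorm H1 (\<lambda>z. fst (p z)))\<^sup>2 + (fnorm H2 (\<lambda>z. snd (p z)))\<^sup>2"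
proof -
  interpret H1: function_hilbert_space H1 by standard (rule assms)
  interpret H2: function_hilbert_space H2 by standard (rule assms)
  show ?thesis
    using assms(3) H1.finner_nonneg H2.finner_nonneg
    by (simp add: fnorm_def prod_space_def)
qed

lemma fun_hilbert_prod_space:
  assumes "fun_hilbert H1" "fun_hilbert H2"
  shows "fun_hilbert (prod_space H1 H2)"
proof -
  interpret H1: function_hilbert_space H1 by standard (rule assms)
  interpret H2: function_hilbert_space H2 by standard (rule assms)
  let ?P = "prod_space H1 H2"
  have fst_scale: "fst (c *\<^sub>C p) = c *\<^sub>C fst p" and snd_scale: "snd (c *\<^sub>C p) = c *\<^sub>C snd p"
    for c and p :: "'a \<times> 'b"
    by (simp_all add: scaleC_prod_def)
  have carrier: "p \<in> fcarrier ?P \<longleftrightarrow>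
      (\<lambda>z. fst (p z)) \<in> fcarrier H1 \<and> (\<lambda>z. snd (p z)) \<in> fcarrier H2" for p
    by (simp add: prod_space_def)
  have inner: "finner ?P p q = finner H1 (\<lambda>z. fst (p z)) (\<lambda>z. fst (q z))
      + finner H2 (\<lambda>z. snd (p z)) (\<lambda>z. snd (q z))" for p q
    by (simp add: prod_space_def)
  show ?thesis
    unfolding fun_hilbert_def
  proof (intro conjI ballI allI impI)
    fix f assume "f \<in> fcarrier ?P"
    then have "on_disk (\<lambda>z. fst (f z)) = (\<lambda>z. fst (f z))" "on_disk (\<lambda>z. snd (f z)) = (\<lambda>z. snd (f z))"
      using H1.off_disk H2.off_disk by (auto simp: carrier)
    then show "on_disk f = f"
      by (auto simp: on_disk_def fun_eq_iff prod_eq_iff split: if_splits)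
  next
    fix f g assume fg: "f \<in> fcarrier ?P" "g \<in> fcarrier ?P"
    then show "finner ?P f g = cnj (finner ?P g f)"
      using H1.finner_commute[of "\<lambda>z. fst (f z)" "\<lambda>z. fst (g z)"]
        H2.finner_commute[of "\<lambda>z. snd (f z)" "\<lambda>z. snd (g z)"]
      by (simp add: carrier inner)
  next
    fix f assume f: "f \<in> fcarrier ?P"
    then show "0 \<le> Re (finner ?P f f)"
      by (simp add: carrier inner H1.finner_nonneg H2.finner_nonneg)
    assume "finner ?P f f = 0"
    then have "(fnorm H1 (\<lambda>z. fst (f z)))\<^sup>2 + (fnorm H2 (\<lambda>z. snd (f z)))\<^sup>2 = 0"
      using f by (simp add: carrier inner H1.finner_self H2.finner_self flip: of_real_power of_real_add)
    then have "fnorm H1 (\<lambda>z. fst (f z)) = 0" "fnorm H2 (\<lambda>z. snd (f z)) = 0"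
      by (simp_all add: sum_power2_eq_zero_iff)
    then have "(\<lambda>z. fst (f z)) = (\<lambda>z. 0)" "(\<lambda>z. snd (f z)) = (\<lambda>z. 0)"
      using f H1.fnorm_eq_0 H2.fnorm_eq_0 by (auto simp: carrier)
    then show "f = (\<lambda>z. 0)"
      by (auto simp: fun_eq_iff prod_eq_iff)
  next
    fix \<phi> :: "nat \<Rightarrow> complex \<Rightarrow> 'a \<times> 'b" assume *: "(\<forall>n. \<phi> n \<in> fcarrier ?P) \<and>
      (\<forall>e>0. \<exists>n0. \<forall>m\<ge>n0. \<forall>n\<ge>n0. fnorm ?P (\<lambda>z. \<phi> m z - \<phi> n z) < e)"
    have c1: "(\<lambda>z. fst (\<phi> n z)) \<in> fcarrier H1" and c2: "(\<lambda>z. snd (\<phi> n z)) \<in> fcarrier H2" for n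
      using * by (auto simp: carrier)
    have sq: "(fnorm ?P (\<lambda>z. p z - q z))\<^sup>2 = (fnorm H1 (\<lambda>z. fst (p z) - fst (q z)))\<^sup>2
        + (fnorm H2 (\<lambda>z. snd (p z) - snd (q z)))\<^sup>2"
      if "p \<in> fcarrier ?P" "q \<in> fcarrier ?P" for p q
      using fnorm_prod_space[OF assms, of "\<lambda>z. p z - q z"] that
      by (simp add: carrier H1.diff_mem H2.diff_mem)
    have nn: "0 \<le> fnorm ?P f" if "f \<in> fcarrier ?P" for f
      using that by (simp add: fnorm_def carrier inner H1.finner_nonneg H2.finner_nonneg)
    have diffP: "(\<lambda>z. p z - q z) \<in> fcarrier ?P" if "p \<in> fcarrier ?P" "q \<in> fcarrier ?P" for p q
      using that by (simp add: carrier H1.diff_mem H2.diff_mem)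
    \<comment> \<open>The coordinate projections are contractive, which passes the Cauchy property
      on to each factor.\<close>
    have le: "fnorm H1 (\<lambda>z. fst (p z) - fst (q z)) \<le> fnorm ?P (\<lambda>z. p z - q z)"
        "fnorm H2 (\<lambda>z. snd (p z) - snd (q z)) \<le> fnorm ?P (\<lambda>z. p z - q z)"
      if "p \<in> fcarrier ?P" "q \<in> fcarrier ?P" for p q
      by (rule power2_le_imp_le; use sq[OF that] nn[OF diffP[OF that]] in simp)+
    obtain f1 where f1: "f1 \<in> fcarrier H1" "(\<lambda>n. fnorm H1 (\<lambda>z. fst (\<phi> n z) - f1 z)) \<longlonglongrightarrow> 0"
    proof (rule H1.fnorm_complete[of "\<lambda>n z. fst (\<phi> n z)"])
      fix e :: real assume "e > 0"
      then obtain n0 where n0: "\<And>m n. m \<ge> n0 \<Longrightarrow> n \<ge> n0 \<Longrightarrow> fnorm ?P (\<lambda>z. \<phi> m z - \<phi> n z) < e"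
        using * by blast
      show "\<exists>n0. \<forall>m\<ge>n0. \<forall>n\<ge>n0. fnorm H1 (\<lambda>z. fst (\<phi> m z) - fst (\<phi> n z)) < e"
        using le(1) n0 * by (intro exI[of _ n0] allI impI le_less_trans[OF le(1) n0]) auto
    qed (rule c1)
    obtain f2 where f2: "f2 \<in> fcarrier H2" "(\<lambda>n. fnorm H2 (\<lambda>z. snd (\<phi> n z) - f2 z)) \<longlonglongrightarrow> 0"
    proof (rule H2.fnorm_complete[of "\<lambda>n z. snd (\<phi> n z)"])
      fix e :: real assume "e > 0"
      then obtain n0 where n0: "\<And>m n. m \<ge> n0 \<Longrightarrow> n \<ge> n0 \<Longrightarrow> fnorm ?P (\<lambda>z. \<phi> m z - \<phi> n z) < e"
        using * by blast
      show "\<exists>n0. \<forall>m\<ge>n0. \<forall>n\<ge>n0. fnorm H2 (\<lambda>z. snd (\<phi> m z) - snd (\<phi> n z)) < e"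
        using le(2) n0 * by (intro exI[of _ n0] allI impI le_less_trans[OF le(2) n0]) auto
    qed (rule c2)
    let ?f = "\<lambda>z. (f1 z, f2 z)"
    have f: "?f \<in> fcarrier ?P"
      using f1 f2 by (simp add: carrier)
    have "(\<lambda>n. sqrt ((fnorm H1 (\<lambda>z. fst (\<phi> n z) - f1 z))\<^sup>2 + (fnorm H2 (\<lambda>z. snd (\<phi> n z) - f2 z))\<^sup>2))
        \<longlonglongrightarrow> sqrt (0\<^sup>2 + 0\<^sup>2)"
      by (intro tendsto_intros f1 f2)
    moreover have "sqrt ((fnorm H1 (\<lambda>z. fst (\<phi> n z) - f1 z))\<^sup>2 + (fnorm H2 (\<lambda>z. snd (\<phi> n z) - f2 z))\<^sup>2)
        = fnorm ?P (\<lambda>z. \<phi> n z - ?f z)" for n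
      using sq[of "\<phi> n" ?f] f * nn[OF diffP[of "\<phi> n" ?f]] by (simp add: real_sqrt_unique)
    ultimately have "(\<lambda>n. fnorm ?P (\<lambda>z. \<phi> n z - ?f z)) \<longlonglongrightarrow> 0"
      by simp
    with f show "\<exists>f\<in>fcarrier ?P. (\<lambda>n. fnorm ?P (\<lambda>z. \<phi> n z - f z)) \<longlonglongrightarrow> 0"
      by (intro bexI[of _ ?f])
  qed (simp_all add: carrier inner H1.mem H2.mem H1.finner_sesquilinear H2.finner_sesquilinear
      fst_scale snd_scale ring_distribs)
qed

text \<open>The function-space Riesz theorem transported along \<open>const_space UNIV\<close>. The
  subspace \<open>D\<close> need not be closed, which is why the vector is located in its closure;
  \<open>douglas_vector\<close> takes \<open>D = range R\<close>.\<close>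

lemma riesz_on_csubspace:
  fixes D :: "'a::complex_hilbert set"
  assumes D: "csubspace D"
    and \<phi>_add: "\<And>a b. a \<in> D \<Longrightarrow> b \<in> D \<Longrightarrow> \<phi> (a + b) = \<phi> a + \<phi> b"
    and \<phi>_scale: "\<And>c a. a \<in> D \<Longrightarrow> \<phi> (c *\<^sub>C a) = c * \<phi> a"
    and \<phi>_bound: "\<And>a. a \<in> D \<Longrightarrow> cmod (\<phi> a) \<le> C * norm a"
  obtains g where "g \<in> closure D" "\<And>a. a \<in> D \<Longrightarrow> \<phi> a = cinner a g"
proof -
  interpret K: function_hilbert_space "const_space (UNIV :: 'a set)"
    by standard (simp add: fun_hilbert_const_space csubspace_UNIV)
  let ?H = "const_space (UNIV :: 'a set)"
  let ?D = "(\<lambda>a. on_disk (\<lambda>z. a)) ` D"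
  obtain g where g: "g \<in> fclosure ?H ?D" "\<And>f. f \<in> ?D \<Longrightarrow> \<phi> (f 0) = finner ?H f g"
  proof (rule K.riesz_on_subspace[of ?D "\<lambda>f. \<phi> (f 0)" C])
    show "?D \<subseteq> fcarrier ?H"
      by (auto simp: const_space_def)
    show "(\<lambda>z. 0) \<in> ?D"
      using D unfolding csubspace_def by (auto simp: on_disk_def intro!: image_eqI[of _ _ 0])
    show "(\<lambda>z. f z + g z) \<in> ?D" if "f \<in> ?D" "g \<in> ?D" for f g
    proof -
      from that obtain a b where "a \<in> D" "b \<in> D" "f = on_disk (\<lambda>z. a)" "g = on_disk (\<lambda>z. b)"
        by auto
      then show ?thesis
        using D unfolding csubspace_def
        by (auto simp: on_disk_def fun_eq_iff intro!: image_eqI[of _ _ "a + b"])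
    qed
    show "(\<lambda>z. c *\<^sub>C f z) \<in> ?D" if "f \<in> ?D" for c f
    proof -
      from that obtain a where "a \<in> D" "f = on_disk (\<lambda>z. a)"
        by auto
      then show ?thesis
        using D unfolding csubspace_def
        by (auto simp: on_disk_def fun_eq_iff intro!: image_eqI[of _ _ "c *\<^sub>C a"])
    qed
  qed (auto simp: \<phi>_add \<phi>_scale \<phi>_bound fnorm_const_space)
  have "g 0 \<in> closure D"
    unfolding closure_approachable
  proof (intro allI impI)
    fix e :: real assume "e > 0"
    then obtain k where "k \<in> ?D" "fnorm ?H (\<lambda>z. g z - k z) < e"
      using g(1) unfolding fclosure_def by blast
    then show "\<exists>y\<in>D. dist y (g 0) < e"
      by (auto simp: fnorm_const_space dist_norm norm_minus_commute)
  qed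
  moreover have "\<phi> a = cinner a (g 0)" if "a \<in> D" for a
    using g(2)[of "on_disk (\<lambda>z. a)"] that by (simp add: const_space_def)
  ultimately show thesis
    by (rule that)
qed

text \<open>\<open>cadj\<close> is a definite description, so the adjoint relation requires a
  representing vector: Riesz provides it, and nondegeneracy makes it unique.\<close>

lemma cinner_cadj:
  assumes A: "bounded_clinear A"
  shows "cinner (A v) y = cinner v (cadj A y)"
proof -
  obtain C where C: "\<And>v. norm (A v) \<le> norm v * C"
    using A bounded_linear.bounded unfolding bounded_clinear_def by blast
  obtain g where g: "\<And>v. cinner (A v) y = cinner v g"
  proof (rule riesz_on_csubspace[of UNIV "\<lambda>v. cinner (A v) y" "C * norm y"])
    show "cmod (cinner (A v) y) \<le> C * norm y * norm v" for v
    proof -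
      have "cmod (cinner (A v) y) \<le> norm (A v) * norm y"
        by (rule norm_cinner_le)
      also have "\<dots> \<le> (norm v * C) * norm y"
        by (intro mult_right_mono C) simp
      finally show ?thesis
        by (simp add: algebra_simps)
    qed
  qed (auto simp: csubspace_UNIV bounded_clinear_simps[OF A] cinner_sesquilinear)
  have "cadj A y = g"
    unfolding cadj_def using g by (intro the_equality) (auto intro: cinner_ext_right)
  then show ?thesis
    by (simp add: g)
qed

lemma cadj_eqI:
  assumes "\<And>v. cinner (A v) y = cinner v g"
  shows "cadj A y = g"
  unfolding cadj_def using assms by (intro the_equality) (auto intro: cinner_ext_right)

lemma norm_cadj_le:
  assumes A: "bounded_clinear A" and contr: "\<And>v. norm (A v) \<le> norm v"
  shows "norm (cadj A y) \<le> norm y"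
proof (cases "cadj A y = 0")
  case False
  have "(norm (cadj A y))\<^sup>2 = cmod (cinner (A (cadj A y)) y)"
    by (simp add: cinner_cadj[OF A] cinner_self norm_power)
  also have "\<dots> \<le> norm (A (cadj A y)) * norm y"
    by (rule norm_cinner_le)
  also have "\<dots> \<le> norm (cadj A y) * norm y"
    by (intro mult_right_mono contr) simp
  finally show ?thesis
    using False by (simp add: power2_eq_square)
qed simp

lemma cadj_linear:
  assumes A: "bounded_clinear A"
  shows "cadj A (y + z) = cadj A y + cadj A z" "cadj A (c *\<^sub>C y) = c *\<^sub>C cadj A y"
  by (rule cadj_eqI; simp add: cinner_add_right cinner_scaleC_right cinner_cadj[OF A])+

text \<open>The graph of \<open>M\<close> in the direct sum of \<open>H\<close> and \<open>P\<close> is the annihilator of all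
  \<open>(K\<^sub>\<zeta>y, - k\<^sub>\<zeta>y)\<close>; everything follows by projecting \<open>(g, 0)\<close> and \<open>(0, p)\<close> onto it.\<close>

lemma coisometry_of_kernel:
  fixes H :: "'a::complex_hilbert fun_space" and P :: "'b::complex_hilbert fun_space"
    and M :: "(complex \<Rightarrow> 'b) \<Rightarrow> complex \<Rightarrow> 'a"
  assumes rk: "is_rkhs K H" and P: "fun_hilbert P"
    and k: "\<And>\<zeta> y. \<zeta> \<in> \<bbbD> \<Longrightarrow> k \<zeta> y \<in> fcarrier P"
    and ev: "\<And>\<zeta> y p. \<zeta> \<in> \<bbbD> \<Longrightarrow> p \<in> fcarrier P \<Longrightarrow> cinner (M p \<zeta>) y = finner P p (k \<zeta> y)"
    and Mk: "\<And>\<zeta> y z. \<zeta> \<in> \<bbbD> \<Longrightarrow> z \<in> \<bbbD> \<Longrightarrow> M (k \<zeta> y) z = K z \<zeta> y"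
    and off: "\<And>p. on_disk (M p) = M p"
  shows "M ` fcarrier P = fcarrier H" (is ?surj)
    and "\<And>p. p \<in> fcarrier P \<Longrightarrow>
      \<exists>r\<in>fcarrier P. M r = M p \<and> (\<forall>q\<in>fcarrier P. finner P q r = finner H (M q) (M p))"
      (is "\<And>p. p \<in> _ \<Longrightarrow> ?partial p")
proof -
  have H: "fun_hilbert H"
    using rk by (simp add: is_rkhs_def)
  interpret H: function_hilbert_space H by standard (rule H)
  interpret P: function_hilbert_space P by standard (rule P)
  interpret D: function_hilbert_space "prod_space H P"
    by standard (rule fun_hilbert_prod_space[OF H P])
  let ?D = "prod_space H P"
  define \<kappa> where "\<kappa> \<zeta> y = on_disk (\<lambda>z. K z \<zeta> y)" for \<zeta> y
  have \<kappa>: "\<kappa> \<zeta> y \<in> fcarrier H" "f \<in> fcarrier H \<Longrightarrow> finner H f (\<kappa> \<zeta> y) = cinner (f \<zeta>) y"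
    if "\<zeta> \<in> \<bbbD>" for \<zeta> y f
    using rk that unfolding is_rkhs_def \<kappa>_def by blast+
  have M_off: "M p z = 0" if "z \<notin> \<bbbD>" for p z
    using fun_cong[OF off, of p z] that by (simp add: on_disk_def split: if_splits)
  have H_off: "f z = 0" if "f \<in> fcarrier H" "z \<notin> \<bbbD>" for f z
    using fun_cong[OF H.off_disk, of f z] that by (simp add: on_disk_def split: if_splits)
  \<comment> \<open>So far \<open>M p\<close> is a mere function on the disk. Its membership in
    \<open>H\<close> is a result, obtained in \<open>half\<close> and \<open>M_mem\<close> by
    identifying \<open>M p\<close> with a function known to lie in \<open>H\<close>.\<close>
  have M_eqI: "M p = f"
    if "p \<in> fcarrier P" "f \<in> fcarrier H"
      "\<And>\<zeta> y. \<zeta> \<in> \<bbbD> \<Longrightarrow> finner P p (k \<zeta> y) = cinner (f \<zeta>) y" for p f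
  proof
    fix z show "M p z = f z"
    proof (cases "z \<in> \<bbbD>")
      case True
      show ?thesis
        by (rule cinner_ext) (use that(1) that(3)[OF True] ev[OF True that(1)] in simp)
    next
      case False
      then show ?thesis
        using M_off H_off that by simp
    qed
  qed
  have M\<kappa>: "M (k \<zeta> y) = \<kappa> \<zeta> y" if "\<zeta> \<in> \<bbbD>" for \<zeta> y
    using M_off that by (auto simp: fun_eq_iff \<kappa>_def on_disk_def Mk)
  have carrier: "(\<lambda>z. (f z, p z)) \<in> fcarrier ?D \<longleftrightarrow> f \<in> fcarrier H \<and> p \<in> fcarrier P" for f p
    by (simp add: prod_space_def)
  have inner: "finner ?D (\<lambda>z. (f z, p z)) (\<lambda>z. (f' z, p' z)) = finner H f f' + finner P p p'" for f p f' p'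
    by (simp add: prod_space_def)
  define B where "B = {\<lambda>z. (\<kappa> \<zeta> y z, - k \<zeta> y z) | \<zeta> y. \<zeta> \<in> \<bbbD>}"
  have B: "B \<subseteq> fcarrier ?D"
    by (auto simp: B_def carrier \<kappa> k P.minus_mem)
  have graph: "(\<lambda>z. (f z, p z)) \<in> fominus ?D B \<longleftrightarrow> f \<in> fcarrier H \<and> p \<in> fcarrier P \<and> M p = f" for f p
  proof
    assume *: "(\<lambda>z. (f z, p z)) \<in> fominus ?D B"
    then have fp: "f \<in> fcarrier H" "p \<in> fcarrier P"
      by (auto simp: fominus_def carrier)
    have "finner P p (k \<zeta> y) = cinner (f \<zeta>) y" if "\<zeta> \<in> \<bbbD>" for \<zeta> y
    proof -
      have "finner ?D (\<lambda>z. (f z, p z)) (\<lambda>z. (\<kappa> \<zeta> y z, - k \<zeta> y z)) = 0"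
        using * that unfolding fominus_def B_def by blast
      then show ?thesis
        using fp that by (simp add: inner \<kappa> P.finner_minus_right k)
    qed
    then show "f \<in> fcarrier H \<and> p \<in> fcarrier P \<and> M p = f"
      using fp M_eqI by blast
  next
    assume "f \<in> fcarrier H \<and> p \<in> fcarrier P \<and> M p = f"
    then show "(\<lambda>z. (f z, p z)) \<in> fominus ?D B"
      by (auto simp: fominus_def B_def carrier inner \<kappa> P.finner_minus_right k ev[symmetric])
  qed
  \<comment> \<open>\<open>(M p0, p0)\<close> is the projection of \<open>(g, p)\<close> onto the
    graph. Its two components pair with the graph element
    \<open>(\<kappa> \<zeta> y, k \<zeta> y)\<close> to the same value, hence the factor 2.\<close>
  have decomp: "\<exists>f0 p0. f0 \<in> fcarrier H \<and> p0 \<in> fcarrier P \<and> M p0 = f0 \<and>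
      (\<forall>\<zeta>\<in>\<bbbD>. \<forall>y. finner P p (k \<zeta> y) + cinner (g \<zeta>) y = 2 * cinner (f0 \<zeta>) y) \<and>
      (\<forall>q\<in>fcarrier P. M q \<in> fcarrier H \<longrightarrow>
        finner H g (M q) + finner P p q = finner H f0 (M q) + finner P p0 q)"
    if g: "g \<in> fcarrier H" and p: "p \<in> fcarrier P" for g p
  proof -
    have "(\<lambda>z. (g z, p z)) \<in> fcarrier ?D"
      using g p by (simp add: carrier)
    then obtain q where q: "q \<in> fominus ?D B"
      and orth: "\<And>q'. q' \<in> fominus ?D B \<Longrightarrow> finner ?D (\<lambda>z. (g z, p z) - q z) q' = 0"
      using D.projection_fominus[OF B] by blast
    define f0 p0 where "f0 z = fst (q z)" and "p0 z = snd (q z)" for z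
    have qq: "q = (\<lambda>z. (f0 z, p0 z))"
      by (simp add: f0_def p0_def)
    with q graph have q0: "f0 \<in> fcarrier H" "p0 \<in> fcarrier P" "M p0 = f0"
      by auto
    have orth': "finner H g (M q) + finner P p q = finner H f0 (M q) + finner P p0 q"
      if "q \<in> fcarrier P" "M q \<in> fcarrier H" for q
    proof -
      have "finner H g (M q) - finner H f0 (M q) + (finner P p q - finner P p0 q) = 0"
        using orth[of "\<lambda>z. (M q z, q z)"] that graph[of "M q" q] g p q0
        by (simp add: qq inner H.finner_diff_left P.finner_diff_left)
      then show ?thesis
        by algebra
    qed
    moreover have "finner P p (k \<zeta> y) + cinner (g \<zeta>) y = 2 * cinner (f0 \<zeta>) y" if "\<zeta> \<in> \<bbbD>" for \<zeta> y
      using orth'[of "k \<zeta> y"] that g q0 ev[of \<zeta> p0 y] by (simp add: M\<kappa> \<kappa> k add.commute)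
    ultimately show ?thesis
      using q0 by blast
  qed
  have half: "\<exists>p0. p0 \<in> fcarrier P \<and> M p0 \<in> fcarrier H \<and> M p = (\<lambda>z. 2 *\<^sub>C M p0 z) \<and>
      (\<forall>q\<in>fcarrier P. M q \<in> fcarrier H \<longrightarrow> finner P p q = finner H (M p0) (M q) + finner P p0 q)"
    if p: "p \<in> fcarrier P" for p
  proof -
    obtain p0 where p0: "M p0 \<in> fcarrier H" "p0 \<in> fcarrier P"
      and ev0: "\<And>\<zeta> y. \<zeta> \<in> \<bbbD> \<Longrightarrow> finner P p (k \<zeta> y) = 2 * cinner (M p0 \<zeta>) y"
      and orth: "\<And>q. q \<in> fcarrier P \<Longrightarrow> M q \<in> fcarrier H \<Longrightarrow>
        finner P p q = finner H (M p0) (M q) + finner P p0 q"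
      using decomp[OF H.zero_mem p] by (force simp: H.finner_zero_left)
    have "M p = (\<lambda>z. 2 *\<^sub>C M p0 z)"
      by (rule M_eqI) (simp_all add: p p0 H.mem ev0 cinner_scaleC_left)
    with p0 orth show ?thesis
      by blast
  qed
  have M_mem: "M p \<in> fcarrier H" if "p \<in> fcarrier P" for p
    using half[OF that] H.scale_mem by auto
  show "?partial p" if p: "p \<in> fcarrier P" for p
  proof -
    obtain p0 where p0: "p0 \<in> fcarrier P" and Mp: "M p = (\<lambda>z. 2 *\<^sub>C M p0 z)"
      and orth: "\<And>q. q \<in> fcarrier P \<Longrightarrow> finner P p q = finner H (M p0) (M q) + finner P p0 q"
      using half[OF p] M_mem by blast
    \<comment> \<open>This is the adjoint of \<open>M\<close> applied to \<open>M p\<close>: by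
      \<open>orth\<close>, \<open>p - p0\<close> is that adjoint applied to \<open>M p0\<close>, and
      \<open>M p\<close> is twice \<open>M p0\<close>.\<close>
    let ?r = "\<lambda>z. 2 *\<^sub>C (p z - p0 z)"
    have "M ?r = M p"
    proof (rule M_eqI)
      fix \<zeta> y assume \<zeta>: "\<zeta> \<in> \<bbbD>"
      have "finner P ?r (k \<zeta> y) = 2 * (cinner (M p \<zeta>) y - cinner (M p0 \<zeta>) y)"
        using p p0 \<zeta> by (simp add: P.mem P.finner_scale_left P.finner_diff_left k ev)
      then show "finner P ?r (k \<zeta> y) = cinner (M p \<zeta>) y"
        by (simp add: Mp cinner_scaleC_left)
    qed (simp_all add: p p0 P.mem M_mem)
    moreover have "finner P q ?r = finner H (M q) (M p)" if q: "q \<in> fcarrier P" for q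
    proof -
      have "finner P ?r q = finner H (M p) (M q)"
        using orth[OF q] p0 p q
        by (simp add: Mp P.finner_scale_left P.finner_diff_left P.mem H.finner_scale_left M_mem)
      moreover have "?r \<in> fcarrier P"
        by (simp add: p p0 P.mem)
      ultimately show ?thesis
        using P.finner_commute[of q ?r] H.finner_commute[of "M q" "M p"] p q M_mem by simp
    qed
    ultimately show ?thesis
      using p p0 by (intro bexI[of _ ?r]) (auto simp: P.mem)
  qed
  have "g \<in> M ` fcarrier P" if g: "g \<in> fcarrier H" for g
  proof -
    obtain p0 where p0: "p0 \<in> fcarrier P"
      "\<And>\<zeta> y. \<zeta> \<in> \<bbbD> \<Longrightarrow> cinner (g \<zeta>) y = 2 * cinner (M p0 \<zeta>) y"
      using decomp[OF g P.zero_mem] by (force simp: P.finner_zero_left k)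
    have "M (\<lambda>z. 2 *\<^sub>C p0 z) = g"
      using p0 g by (intro M_eqI) (simp_all add: P.mem P.finner_scale_left k ev)
    then show ?thesis
      using p0 P.scale_mem by blast
  qed
  then show ?surj
    using M_mem by blast
qed

section \<open>Closing a unitary colligation with a Schur-class load\<close>

text \<open>\<open>Q\<close> is merely nonexpansive; the factor \<open>z\<close> makes the map a
  strict contraction for the Banach fixed point theorem. It serves the open-loop state map
  \<open>blk_A\<close> as well as the closed-loop map \<open>feedback\<close>.\<close>

lemma affine_fixed_point:
  fixes X :: "'x::complex_hilbert set"
  assumes X: "csubspace X" "closed X" and z: "cmod z < 1" and b: "b \<in> X"
    and Q: "\<And>a. a \<in> X \<Longrightarrow> Q a \<in> X"
    and nonexp: "\<And>a a'. a \<in> X \<Longrightarrow> a' \<in> X \<Longrightarrow> norm (Q a - Q a') \<le> norm (a - a')"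
  shows "\<exists>!a. a \<in> X \<and> z *\<^sub>C Q a + b = a"
  proof (rule Banach_fix[of X "cmod z"])
    show "complete X"
      using X by (simp add: complete_eq_closed)
    show "X \<noteq> {}"
      using b by blast
    show "(\<lambda>a. z *\<^sub>C Q a + b) ` X \<subseteq> X"
      using X b Q unfolding csubspace_def by blast
    show "dist (z *\<^sub>C Q a + b) (z *\<^sub>C Q a' + b) \<le> cmod z * dist a a'" if "a \<in> X" "a' \<in> X" for a a'
      using that nonexp[of a a']
      by (auto simp: dist_norm scaleC_diff_right[symmetric] norm_scaleC intro: mult_left_mono)
  qed (use z in auto)

text \<open>\<open>U\<close> is unconstrained outside \<open>X \<times> UNIV \<times> UNIV\<close>,
  hence the premises \<open>a \<in> X\<close> throughout. \<open>D22\<close> is the zero corner of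
  the block matrix.\<close>

locale colligation =
  fixes X :: "'x::complex_hilbert set"
    and U :: "'x \<times> 'u::complex_hilbert \<times> 'e::complex_hilbert \<Rightarrow>
      'x \<times> 'y::complex_hilbert \<times> 'd::complex_hilbert"
  assumes X: "csubspace X" "closed X"
    and U: "unitary_onto U (X \<times> UNIV \<times> UNIV) (X \<times> UNIV \<times> UNIV)"
    and D22: "snd (snd (U (0, 0, w))) = 0"
begin

lemma zero_X: "0 \<in> X" and add_X: "a \<in> X \<Longrightarrow> b \<in> X \<Longrightarrow> a + b \<in> X"
  and scale_X: "a \<in> X \<Longrightarrow> c *\<^sub>C a \<in> X" and diff_X: "a \<in> X \<Longrightarrow> b \<in> X \<Longrightarrow> a - b \<in> X"
  using X csubspace_diff[of X] by (auto simp: csubspace_def)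

lemma U_add: "a \<in> X \<Longrightarrow> b \<in> X \<Longrightarrow> U (a + b, u + v, e + f) = U (a, u, e) + U (b, v, f)"
  using U unfolding unitary_onto_def by (auto dest!: bspec[of _ _ "(a, u, e)"] bspec[of _ _ "(b, v, f)"])

lemma U_scale: "a \<in> X \<Longrightarrow> U (c *\<^sub>C a, c *\<^sub>C u, c *\<^sub>C e) = c *\<^sub>C U (a, u, e)"
  using U unfolding unitary_onto_def by (auto simp: scaleC_prod_def)

lemma U_cinner:
  "a \<in> X \<Longrightarrow> b \<in> X \<Longrightarrow> cinner (U (a, u, e)) (U (b, v, f)) = cinner a b + cinner u v + cinner e f"
  using U unfolding unitary_onto_def by (simp add: cinner_prod_def add.assoc)

lemma U_X: "a \<in> X \<Longrightarrow> fst (U (a, u, e)) \<in> X"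
  using U unfolding unitary_onto_def by (metis (no_types) UNIV_I image_eqI mem_Sigma_iff mem_Times_iff)

lemma U_norm:
  assumes "a \<in> X" "U (a, u, e) = (b, y, d)"
  shows "(norm b)\<^sup>2 + (norm y)\<^sup>2 + (norm d)\<^sup>2 = (norm a)\<^sup>2 + (norm u)\<^sup>2 + (norm e)\<^sup>2"
proof -
  have "cinner b b + cinner y y + cinner d d = cinner a a + cinner u u + cinner e e"
    using U_cinner[OF assms(1) assms(1), of u e u e] assms(2) by (simp add: cinner_prod_def add.assoc)
  then show ?thesis
    unfolding cinner_self by (simp flip: of_real_add of_real_power)
qed

lemma U_blocks:
  assumes a: "a \<in> X"
  shows "U (a, u, e) = (blk_A U a + blk_B1 U u + blk_B2 U e,
    blk_C1 U a + blk_D11 U u + blk_D12 U e, blk_C2 U a + blk_D21 U u)"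
proof -
  have "U (a, u, e) = U (a, 0, 0) + U (0, u, 0) + U (0, 0, e)"
    using U_add[OF a zero_X, of 0 u 0 0] U_add[OF a zero_X, of u 0 0 e] by simp
  then show ?thesis
    using D22[of e]
    by (simp add: prod_eq_iff blk_A_def blk_B1_def blk_B2_def blk_C1_def blk_D11_def blk_D12_def
        blk_C2_def blk_D21_def)
qed

lemma blk_X: "a \<in> X \<Longrightarrow> blk_A U a \<in> X" "blk_B1 U u \<in> X" "blk_B2 U e \<in> X"
  by (simp_all add: blk_A_def blk_B1_def blk_B2_def U_X zero_X)

lemma blk_add:
  "a \<in> X \<Longrightarrow> b \<in> X \<Longrightarrow> blk_A U (a + b) = blk_A U a + blk_A U b"
  "a \<in> X \<Longrightarrow> b \<in> X \<Longrightarrow> blk_C1 U (a + b) = blk_C1 U a + blk_C1 U b"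
  "a \<in> X \<Longrightarrow> b \<in> X \<Longrightarrow> blk_C2 U (a + b) = blk_C2 U a + blk_C2 U b"
  "blk_B1 U (u + v) = blk_B1 U u + blk_B1 U v"
  "blk_B2 U (e + f) = blk_B2 U e + blk_B2 U f"
  "blk_D12 U (e + f) = blk_D12 U e + blk_D12 U f"
  using U_add[of a b 0 0 0 0] U_add[OF zero_X zero_X, of u v 0 0] U_add[OF zero_X zero_X, of 0 0 e f]
  by (simp_all add: blk_A_def blk_B1_def blk_B2_def blk_C1_def blk_D12_def blk_C2_def)

lemma blk_scale:
  "a \<in> X \<Longrightarrow> blk_A U (c *\<^sub>C a) = c *\<^sub>C blk_A U a"
  "a \<in> X \<Longrightarrow> blk_C1 U (c *\<^sub>C a) = c *\<^sub>C blk_C1 U a"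
  "a \<in> X \<Longrightarrow> blk_C2 U (c *\<^sub>C a) = c *\<^sub>C blk_C2 U a"
  "blk_B1 U (c *\<^sub>C u) = c *\<^sub>C blk_B1 U u"
  "blk_B2 U (c *\<^sub>C e) = c *\<^sub>C blk_B2 U e"
  "blk_D12 U (c *\<^sub>C e) = c *\<^sub>C blk_D12 U e"
  using U_scale[of a c 0 0] U_scale[OF zero_X, of c u 0] U_scale[OF zero_X, of c 0 e]
  by (simp_all add: blk_A_def blk_B1_def blk_B2_def blk_C1_def blk_D12_def blk_C2_def scaleC_prod_def)

lemma blk_diff:
  "a \<in> X \<Longrightarrow> b \<in> X \<Longrightarrow> blk_A U (a - b) = blk_A U a - blk_A U b"
  "a \<in> X \<Longrightarrow> b \<in> X \<Longrightarrow> blk_C2 U (a - b) = blk_C2 U a - blk_C2 U b"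
  "blk_B2 U (e - f) = blk_B2 U e - blk_B2 U f"
  using blk_add(1)[of "a - b" b] blk_add(3)[of "a - b" b] blk_add(5)[of "e - f" f]
  by (simp_all add: diff_X)

lemma blk_zero: "blk_C2 U 0 = 0"
  using blk_scale(3)[OF zero_X, of 0] by simp

lemma norm_blk_A: "a \<in> X \<Longrightarrow> norm (blk_A U a) \<le> norm a"
proof -
  assume a: "a \<in> X"
  obtain b y d where b: "U (a, 0, 0) = (b, y, d)"
    by (metis prod.exhaust)
  have "(norm b)\<^sup>2 \<le> (norm a)\<^sup>2"
    using U_norm[OF a b] zero_le_power2[of "norm y"] zero_le_power2[of "norm d"]
    unfolding norm_zero zero_power2 by linarith
  then have "norm b \<le> norm a"
    by (rule power2_le_imp_le) simp
  then show ?thesis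
    using b by (simp add: blk_A_def)
qed

text \<open>Injectivity holds because inner products, and so distances, are preserved. The inverse
  of a unitary is its adjoint, so the adjoint colligation becomes another instance of the same
  locale.\<close>

lemma unitary_onto_inverse:
  "unitary_onto (inv_into (X \<times> UNIV \<times> UNIV) U) (X \<times> UNIV \<times> UNIV) (X \<times> UNIV \<times> UNIV)"
  "inj_on U (X \<times> UNIV \<times> UNIV)"
proof -
  let ?M = "X \<times> (UNIV :: 'u set) \<times> (UNIV :: 'e set)"
  let ?L = "X \<times> (UNIV :: 'y set) \<times> (UNIV :: 'd set)"
  let ?W = "inv_into ?M U"
  have img: "U ` ?M = ?L"
    using U by (simp add: unitary_onto_def)
  have U_p: "cinner (U p) (U q) = cinner p q" "U (p + q) = U p + U q" "U (c *\<^sub>C p) = c *\<^sub>C U p"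
    if "p \<in> ?M" "q \<in> ?M" for p q c
    using U that unfolding unitary_onto_def by blast+
  have M: "p + q \<in> ?M" "c *\<^sub>C p \<in> ?M" if "p \<in> ?M" "q \<in> ?M" for p q c
    using that by (auto simp: add_X scale_X scaleC_prod_def)
  show inj: "inj_on U ?M"
  proof (rule inj_onI)
    fix p q assume pq: "p \<in> ?M" "q \<in> ?M" "U p = U q"
    have "cinner (p - q) (p - q) = cinner (U p) (U p) - cinner (U p) (U q) - cinner (U q) (U p)
        + cinner (U q) (U q)"
      using pq(1,2) by (simp add: cinner_diff_left cinner_diff_right U_p(1))
    also have "\<dots> = 0"
      using pq by simp
    finally show "p = q"
      by (simp add: cinner_self_eq_0_iff)
  qed
  have W: "?W q \<in> ?M" "U (?W q) = q" if "q \<in> ?L" for q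
    using that img by (auto intro: inv_into_into f_inv_into_f)
  have W_eqI: "?W q = p" if "p \<in> ?M" "U p = q" for p q
    using that inj inv_into_f_f by fastforce
  show "unitary_onto ?W ?L ?M"
    unfolding unitary_onto_def
  proof (intro conjI ballI allI)
    show "?W ` ?L = ?M"
    proof
      show "?M \<subseteq> ?W ` ?L"
      proof
        fix p assume p: "p \<in> ?M"
        then have "U p \<in> ?L"
          using img by blast
        with W_eqI[OF p refl] show "p \<in> ?W ` ?L"
          by (metis imageI)
      qed
    qed (use W(1) in blast)
    show "?W (a + b) = ?W a + ?W b" if "a \<in> ?L" "b \<in> ?L" for a b
      by (rule W_eqI) (use W[OF that(1)] W[OF that(2)] U_p(2) M(1) in auto)
    show "?W (c *\<^sub>C a) = c *\<^sub>C ?W a" if "a \<in> ?L" for c a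
      by (rule W_eqI) (use W[OF that] U_p(3) M(2) in auto)
    show "cinner (?W a) (?W b) = cinner a b" if "a \<in> ?L" "b \<in> ?L" for a b
      using W[OF that(1)] W[OF that(2)] U_p(1)[of "?W a" "?W b"] by simp
  qed
qed

end

text \<open>Loading takes place at one fixed point \<open>z\<close> and involves the operator
  \<open>\<E> z\<close> alone. The adjoint system is therefore again an instance, with the constant
  load \<open>cadj (\<E> z)\<close> at the point \<open>cnj z\<close>.\<close>

locale loaded_colligation = colligation X U
  for X and U :: "'x::complex_hilbert \<times> 'u::complex_hilbert \<times> 'e::complex_hilbert \<Rightarrow>
      'x \<times> 'y::complex_hilbert \<times> 'd::complex_hilbert" +
  fixes \<E> :: "complex \<Rightarrow> 'd \<Rightarrow> 'e" and z :: complex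
  assumes z: "cmod z < 1"
    and \<E>_clinear: "bounded_clinear (\<E> z)"
    and \<E>_contraction: "norm (\<E> z d) \<le> norm d"
begin

lemmas \<E>_simps = bounded_clinear_simps[OF \<E>_clinear]

definition feedback :: "'x \<Rightarrow> 'x"
  where "feedback a = blk_A U a + blk_B2 U (\<E> z (blk_C2 U a))"

text \<open>Since the block \<open>D\<^sub>2\<^sub>2\<close> of \<open>U\<close> vanishes, closing the loop keeps the state map contractive
  even though the load is not strictly contractive.\<close>

lemma norm_feedback:
  assumes a: "a \<in> X"
  shows "norm (feedback a) \<le> norm a"
proof -
  let ?d = "blk_C2 U a"
  obtain b y d where U': "U (a, 0, \<E> z ?d) = (b, y, d)"
    by (metis prod.exhaust)
  have zero: "blk_B1 U 0 = 0" "blk_D21 U 0 = 0"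
    using U_scale[OF zero_X, of 0 0 0] by (auto simp: blk_B1_def blk_D21_def)
  have b: "b = feedback a" and d: "d = ?d"
    using U_blocks[OF a, of 0 "\<E> z ?d"] U' by (auto simp: feedback_def zero)
  have "(norm (\<E> z ?d))\<^sup>2 \<le> (norm ?d)\<^sup>2"
    by (simp add: \<E>_contraction power_mono)
  then have "(norm b)\<^sup>2 + (norm y)\<^sup>2 \<le> (norm a)\<^sup>2"
    using U_norm[OF a U'] unfolding d norm_zero zero_power2 by linarith
  then have "(norm b)\<^sup>2 \<le> (norm a)\<^sup>2"
    using zero_le_power2[of "norm y"] by linarith
  then show ?thesis
    unfolding b by (rule power2_le_imp_le) simp
qed

lemma feedback_X: "a \<in> X \<Longrightarrow> feedback a \<in> X"
  by (simp add: feedback_def add_X blk_X)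

lemma feedback_diff: "a \<in> X \<Longrightarrow> b \<in> X \<Longrightarrow> feedback (a - b) = feedback a - feedback b"
  by (simp add: feedback_def blk_diff \<E>_simps)

lemma ex1_state: "b \<in> X \<Longrightarrow> \<exists>!a. a \<in> X \<and> z *\<^sub>C feedback a + b = a"
  by (rule affine_fixed_point[OF X z])
    (simp_all add: feedback_X feedback_diff[symmetric] norm_feedback diff_X)

text \<open>By the zero corner, \<open>d\<close> depends on \<open>a\<close> and \<open>u\<close>
  only. So \<open>e\<close> can be eliminated, and the two loop equations reduce to one fixed-point
  equation for the state \<open>a\<close>.\<close>

lemma ex_loop:
  assumes a0: "a0 \<in> X"
  obtains a b y d e where "a \<in> X" "U (a, u, e) = (b, y, d)" "a = z *\<^sub>C b + a0" "e = \<E> z d + w"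
proof -
  \<comment> \<open>The part of \<open>e\<close> that does not depend on the state.\<close>
  let ?load = "\<E> z (blk_D21 U u) + w"
  obtain a where a: "a \<in> X" "z *\<^sub>C feedback a + (z *\<^sub>C (blk_B1 U u + blk_B2 U ?load) + a0) = a"
    using ex1_state[of "z *\<^sub>C (blk_B1 U u + blk_B2 U ?load) + a0"] a0 by (auto simp: add_X scale_X blk_X)
  let ?d = "blk_C2 U a + blk_D21 U u"
  let ?e = "\<E> z ?d + w"
  show thesis
  proof (rule that[OF a(1) U_blocks[OF a(1), of u ?e]])
    have eq: "blk_A U a + blk_B1 U u + blk_B2 U ?e = feedback a + (blk_B1 U u + blk_B2 U ?load)"
    proof -
      have "?e = \<E> z (blk_C2 U a) + ?load"
        by (simp add: \<E>_simps add.assoc)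
      then have "blk_B2 U ?e = blk_B2 U (\<E> z (blk_C2 U a)) + blk_B2 U ?load"
        by (simp only: blk_add(5))
      then show ?thesis
        by (simp only: feedback_def ac_simps)
    qed
    show "a = z *\<^sub>C (blk_A U a + blk_B1 U u + blk_B2 U ?e) + a0"
      unfolding eq using a(2) by (simp add: scaleC_add_right add.assoc)
  qed simp
qed

section \<open>Resolvent, transfer functions and invertibility of the loop\<close>

lemma ex1_resolv: "b \<in> X \<Longrightarrow> \<exists>!a. a \<in> X \<and> z *\<^sub>C blk_A U a + b = a"
  by (rule affine_fixed_point[OF X z]) (simp_all add: blk_X blk_diff[symmetric] norm_blk_A diff_X)

text \<open>\<open>resolv\<close> is an \<open>inv_into\<close>, which can be evaluated only once I
  - zA is known to be injective on \<open>X\<close>; uniqueness of the fixed point provides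
  this.\<close>

lemma resolv_eqI:
  assumes "a \<in> X" "b \<in> X" "a = z *\<^sub>C blk_A U a + b"
  shows "resolv U X z b = a"
proof -
  have "inj_on (\<lambda>a. a - z *\<^sub>C blk_A U a) X"
  proof (rule inj_onI)
    fix a a' assume a: "a \<in> X" "a' \<in> X" and eq: "a - z *\<^sub>C blk_A U a = a' - z *\<^sub>C blk_A U a'"
    have "a - z *\<^sub>C blk_A U a \<in> X"
      using a by (simp add: diff_X scale_X blk_X)
    from ex1_resolv[OF this] show "a = a'"
      using a eq by (metis add.commute diff_add_cancel)
  qed
  then have "inv_into X (\<lambda>a. a - z *\<^sub>C blk_A U a) (a - z *\<^sub>C blk_A U a) = a"
    using assms(1) by (rule inv_into_f_f)
  moreover have "a - z *\<^sub>C blk_A U a = b"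
    using assms(3) by (metis add_diff_cancel_left')
  ultimately show ?thesis
    by (simp add: resolv_def)
qed

lemma resolv:
  assumes "b \<in> X"
  shows "resolv U X z b \<in> X" "resolv U X z b = z *\<^sub>C blk_A U (resolv U X z b) + b"
  using ex1_resolv[OF assms] resolv_eqI[OF _ assms] by metis+

lemma resolv_add: "a \<in> X \<Longrightarrow> b \<in> X \<Longrightarrow> resolv U X z (a + b) = resolv U X z a + resolv U X z b"
proof (rule resolv_eqI)
  assume a: "a \<in> X" and b: "b \<in> X"
  have "resolv U X z a + resolv U X z b =
      (z *\<^sub>C blk_A U (resolv U X z a) + a) + (z *\<^sub>C blk_A U (resolv U X z b) + b)"
    by (simp only: resolv(2)[OF a, symmetric] resolv(2)[OF b, symmetric])
  also have "\<dots> = z *\<^sub>C blk_A U (resolv U X z a + resolv U X z b) + (a + b)"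
    by (simp add: blk_add resolv(1) a b scaleC_add_right)
  finally show "resolv U X z a + resolv U X z b =
      z *\<^sub>C blk_A U (resolv U X z a + resolv U X z b) + (a + b)" .
qed (simp_all add: resolv(1) add_X)

lemma resolv_scale: "a \<in> X \<Longrightarrow> resolv U X z (c *\<^sub>C a) = c *\<^sub>C resolv U X z a"
proof (rule resolv_eqI)
  assume a: "a \<in> X"
  have "z *\<^sub>C blk_A U (c *\<^sub>C resolv U X z a) + c *\<^sub>C a = c *\<^sub>C (z *\<^sub>C blk_A U (resolv U X z a) + a)"
    using a by (simp add: blk_scale resolv(1) scaleC_add_right scaleC_scaleC mult.commute)
  also have "\<dots> = c *\<^sub>C resolv U X z a"
    by (simp only: resolv(2)[OF a, symmetric])
  finally show "c *\<^sub>C resolv U X z a = z *\<^sub>C blk_A U (c *\<^sub>C resolv U X z a) + c *\<^sub>C a" ..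
qed (simp_all add: resolv(1) scale_X)

lemma Sigma22_state: "Sigma22 U X z e = blk_C2 U (resolv U X z (z *\<^sub>C blk_B2 U e))"
  by (simp add: Sigma22_def resolv_scale blk_X blk_scale resolv(1))

lemma Sigma22_add: "Sigma22 U X z (e + f) = Sigma22 U X z e + Sigma22 U X z f"
  by (simp add: Sigma22_def blk_add blk_X resolv_add resolv(1) scaleC_add_right)

lemma Sigma22_scale: "Sigma22 U X z (c *\<^sub>C e) = c *\<^sub>C Sigma22 U X z e"
  by (simp add: Sigma22_def blk_scale blk_X resolv_scale resolv(1) scaleC_scaleC mult.commute)

lemma Sigma12_add: "Sigma12 U X z (e + f) = Sigma12 U X z e + Sigma12 U X z f"
  by (simp add: Sigma12_def blk_add blk_X resolv_add resolv(1) scaleC_add_right)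

lemma Sigma12_scale: "Sigma12 U X z (c *\<^sub>C e) = c *\<^sub>C Sigma12 U X z e"
  by (simp add: Sigma12_def blk_scale blk_X resolv_scale resolv(1) scaleC_scaleC scaleC_add_right mult.commute)

definition loop :: "'e \<Rightarrow> 'e"
  where "loop e = e - \<E> z (Sigma22 U X z e)"

lemma loop_add: "loop (e + f) = loop e + loop f"
  by (simp add: loop_def Sigma22_add \<E>_simps)

lemma loop_scale: "loop (c *\<^sub>C e) = c *\<^sub>C loop e"
  by (simp add: loop_def Sigma22_scale \<E>_simps scaleC_diff_right)

text \<open>Both halves are read off the state equation. A kernel vector of \<open>loop\<close>
  arises from a state fixed by \<open>z\<close> times \<open>feedback\<close>, and such a state is
  0. A preimage of \<open>w\<close> is the signal \<open>e\<close> of the loop run with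
  \<open>u = 0\<close>, \<open>a0 = 0\<close> and external load input \<open>w\<close>.\<close>

lemma bij_loop: "bij loop"
proof (rule bijI)
  have zero: "blk_B1 U 0 = 0" "blk_D21 U 0 = 0"
    using U_scale[OF zero_X, of 0 0 0] by (auto simp: blk_B1_def blk_D21_def)
  have e0: "e = 0" if "loop e = 0" for e
  proof -
    let ?a = "resolv U X z (z *\<^sub>C blk_B2 U e)"
    have zB: "z *\<^sub>C blk_B2 U e \<in> X"
      by (simp add: scale_X blk_X)
    have e: "e = \<E> z (blk_C2 U ?a)"
      using that by (simp add: loop_def Sigma22_state)
    have "z *\<^sub>C feedback ?a + 0 = ?a"
      using resolv(2)[OF zB] e by (simp add: feedback_def scaleC_add_right)
    moreover have "z *\<^sub>C feedback 0 + 0 = 0"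
      using feedback_diff[OF zero_X zero_X] by simp
    ultimately have "?a = 0"
      using ex1_state[OF zero_X] zero_X resolv(1)[OF zB] by blast
    then show "e = 0"
      using e by (simp add: blk_zero \<E>_simps)
  qed
  show "inj loop"
  proof (rule injI)
    fix e f assume "loop e = loop f"
    then have "loop (e - f) = 0"
      using loop_add[of "e - f" f] by simp
    then show "e = f"
      using e0 by fastforce
  qed
  show "surj loop"
    unfolding surj_def
  proof
    fix w
    obtain a b y d e where a: "a \<in> X" "U (a, 0, e) = (b, y, d)" "a = z *\<^sub>C b + 0" "e = \<E> z d + w"
      by (rule ex_loop[OF zero_X])
    have b: "b = blk_A U a + blk_B2 U e" and d: "d = blk_C2 U a"
      using U_blocks[OF a(1), of 0 e] a(2) by (auto simp: zero)
    have "a = z *\<^sub>C blk_A U a + z *\<^sub>C blk_B2 U e"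
      using a(3) unfolding b by (simp only: scaleC_add_right add_0_right)
    then have "resolv U X z (z *\<^sub>C blk_B2 U e) = a"
      using a(1) by (intro resolv_eqI) (simp_all add: scale_X blk_X)
    then have "Sigma22 U X z e = d"
      by (simp add: Sigma22_state d)
    then have "w = loop e"
      using a(4) by (simp add: loop_def)
    then show "\<exists>e. w = loop e" ..
  qed
qed

lemma inv_loop_add: "inv loop (e + f) = inv loop e + inv loop f"
  using bij_loop by (intro inv_f_eq) (simp_all add: bij_is_inj loop_add surj_f_inv_f bij_is_surj)

lemma inv_loop_scale: "inv loop (c *\<^sub>C e) = c *\<^sub>C inv loop e"
  using bij_loop by (intro inv_f_eq) (simp_all add: bij_is_inj loop_scale surj_f_inv_f bij_is_surj)

lemma G_fun_loop: "G_fun U X \<E> z w = Sigma12 U X z (inv loop w)"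
  by (simp add: G_fun_def loop_def[abs_def])

lemma redheffer_loop:
  "redheffer U X \<E> z u = Sigma11 U X z u + G_fun U X \<E> z (\<E> z (Sigma21 U X z u))"
  by (simp add: redheffer_def G_fun_def)

lemma G_fun_add: "G_fun U X \<E> z (e + f) = G_fun U X \<E> z e + G_fun U X \<E> z f"
  by (simp add: G_fun_loop inv_loop_add Sigma12_add)

lemma G_fun_scale: "G_fun U X \<E> z (c *\<^sub>C e) = c *\<^sub>C G_fun U X \<E> z e"
  by (simp add: G_fun_loop inv_loop_scale Sigma12_scale)

lemma Gamma_fun_scale: "a \<in> X \<Longrightarrow> Gamma_fun U X \<E> z (c *\<^sub>C a) = c *\<^sub>C Gamma_fun U X \<E> z a"
  by (simp add: Gamma_fun_def resolv_scale blk_scale resolv(1) \<E>_simps G_fun_scale scaleC_add_right)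

text \<open>The loop of \<open>ex_loop\<close> eliminated in the other order: the state is removed
  by the resolvent of A, which leaves an equation for \<open>e\<close> with the operator
  \<open>loop\<close>. This order reproduces the formulas that define \<open>Gamma_fun\<close>,
  \<open>redheffer\<close> and \<open>G_fun\<close>.\<close>

lemma loop_output:
  assumes a: "a \<in> X" and a0: "a0 \<in> X" and U': "U (a, u, e) = (b, y, d)"
    and state: "a = z *\<^sub>C b + a0" and load: "e = \<E> z d + w"
  shows "y = Gamma_fun U X \<E> z a0 + redheffer U X \<E> z u + G_fun U X \<E> z w"
proof -
  let ?r = "resolv U X z"
  have b: "b = blk_A U a + blk_B1 U u + blk_B2 U e"
    and y: "y = blk_C1 U a + blk_D11 U u + blk_D12 U e"
    and d: "d = blk_C2 U a + blk_D21 U u"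
    using U_blocks[OF a, of u e] U' by auto
  have "?r (a0 + z *\<^sub>C blk_B1 U u + z *\<^sub>C blk_B2 U e) = a"
  proof (rule resolv_eqI[OF a])
    show "a = z *\<^sub>C blk_A U a + (a0 + z *\<^sub>C blk_B1 U u + z *\<^sub>C blk_B2 U e)"
      by (subst state) (simp add: b scaleC_add_right)
  qed (simp add: a0 add_X scale_X blk_X)
  then have a_eq: "a = ?r a0 + z *\<^sub>C ?r (blk_B1 U u) + z *\<^sub>C ?r (blk_B2 U e)"
    by (simp add: resolv_add resolv_scale a0 add_X scale_X blk_X)
  have y': "y = blk_C1 U (?r a0) + Sigma11 U X z u + Sigma12 U X z e"
    unfolding y a_eq by (simp add: Sigma11_def Sigma12_def blk_add blk_scale resolv(1) a0 add_X scale_X blk_X)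
  have d': "d = blk_C2 U (?r a0) + Sigma21 U X z u + Sigma22 U X z e"
    unfolding d a_eq by (simp add: Sigma21_def Sigma22_def blk_add blk_scale resolv(1) a0 add_X scale_X blk_X)
  have "loop e = w + \<E> z (blk_C2 U (?r a0)) + \<E> z (Sigma21 U X z u)"
    unfolding loop_def by (subst load) (simp add: d' \<E>_simps)
  then have "inv loop (w + \<E> z (blk_C2 U (?r a0)) + \<E> z (Sigma21 U X z u)) = e"
    using bij_loop by (simp add: bij_is_inj inv_f_eq)
  then have "Sigma12 U X z e = G_fun U X \<E> z (w + \<E> z (blk_C2 U (?r a0)) + \<E> z (Sigma21 U X z u))"
    by (simp add: G_fun_loop)
  then show ?thesis
    by (simp add: y' Gamma_fun_def redheffer_loop G_fun_add)
qed

text \<open>The premise \<open>onto\<close> is the zero corner of the inverse of \<open>U\<close>.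
  So \<open>ex_loop\<close> applies to that inverse, with load \<open>cadj (\<E> z)\<close>, input
  \<open>y\<close> and no external state or load input.\<close>

lemma ex_adjoint_loop:
  assumes onto: "\<And>d. \<exists>a u. a \<in> X \<and> U (a, u, 0) = (0, 0, d)"
  obtains a u e where "a \<in> X" "U (a, u, e) = (cnj z *\<^sub>C a, y, cadj (\<E> z) e)"
proof -
  let ?M = "X \<times> (UNIV :: 'u set) \<times> (UNIV :: 'e set)"
  let ?W = "inv_into ?M U"
  have W: "?W (U p) = p" if "p \<in> ?M" for p
    using unitary_onto_inverse(2) that by (rule inv_into_f_f)
  have UW: "U (?W q) = q" if "fst q \<in> X" for q
  proof (rule f_inv_into_f)
    show "q \<in> U ` ?M"
      using U that by (simp add: unitary_onto_def mem_Times_iff)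
  qed
  interpret dual: loaded_colligation X ?W "\<lambda>_. cadj (\<E> z)" "cnj z"
  proof
    show "snd (snd (?W (0, 0, d))) = 0" for d
    proof -
      obtain a u where "a \<in> X" "U (a, u, 0) = (0, 0, d)"
        using onto by blast
      then show ?thesis
        using W[of "(a, u, 0)"] by simp
    qed
    show "bounded_clinear (cadj (\<E> z))"
      unfolding bounded_clinear_def
    proof
      show "bounded_linear (cadj (\<E> z))"
      proof (rule bounded_linear_intro[of _ 1])
        show "cadj (\<E> z) (r *\<^sub>R x) = r *\<^sub>R cadj (\<E> z) x" for r x
          using cadj_linear(2)[OF \<E>_clinear, of "of_real r" x] by (simp add: scaleC_of_real)
      qed (simp_all add: cadj_linear[OF \<E>_clinear] norm_cadj_le[OF \<E>_clinear \<E>_contraction])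
    qed (simp add: cadj_linear[OF \<E>_clinear])
  qed (use X z unitary_onto_inverse(1) norm_cadj_le[OF \<E>_clinear \<E>_contraction] in \<open>simp_all only: complex_mod_cnj\<close>)
  obtain b a u e d where *: "b \<in> X" "?W (b, y, d) = (a, u, e)" "b = cnj z *\<^sub>C a + 0" "d = cadj (\<E> z) e + 0"
    by (rule dual.ex_loop[OF zero_X])
  have "a \<in> X"
    using dual.U_X[OF *(1), of y d] *(2) by simp
  moreover have "U (a, u, e) = (cnj z *\<^sub>C a, y, cadj (\<E> z) e)"
    using UW[of "(b, y, d)"] * by simp
  ultimately show thesis
    by (rule that)
qed

text \<open>In the inner product of a forward run with the adjoint run, unitarity of
  \<open>U\<close> makes the terms \<open>z * cinner b a'\<close> and
  \<open>cinner (\<E> z d) e'\<close> cancel. What remains says that the adjoints of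
  \<open>Gamma_fun\<close>, \<open>redheffer\<close> and \<open>G_fun\<close> at \<open>z\<close>
  send \<open>y'\<close> to \<open>a'\<close>, \<open>u'\<close> and \<open>e'\<close>.\<close>

lemma adjoint_loop_pairing:
  assumes a': "a' \<in> X" and U': "U (a', u', e') = (cnj z *\<^sub>C a', y', cadj (\<E> z) e')" and a0: "a0 \<in> X"
  shows "cinner (Gamma_fun U X \<E> z a0 + redheffer U X \<E> z u + G_fun U X \<E> z w) y' =
    cinner a0 a' + cinner u u' + cinner w e'"
proof -
  obtain a b y d e where a: "a \<in> X" "U (a, u, e) = (b, y, d)" "a = z *\<^sub>C b + a0" "e = \<E> z d + w"
    by (rule ex_loop[OF a0])
  have "cinner a a' + cinner u u' + cinner e e' =
      cinner b (cnj z *\<^sub>C a') + cinner y y' + cinner d (cadj (\<E> z) e')"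
    using U_cinner[OF a(1) a', of u e u' e'] a(2) U' by (simp add: cinner_prod_def add.assoc)
  also have "cinner d (cadj (\<E> z) e') = cinner (\<E> z d) e'"
    by (simp add: cinner_cadj[OF \<E>_clinear])
  finally have "cinner y y' = cinner a0 a' + cinner u u' + cinner w e'"
    unfolding a(3,4) cinner_add_left cinner_scaleC_left cinner_scaleC_right by (simp add: algebra_simps)
  then show ?thesis
    using loop_output[OF a(1) a0 a(2-4)] by simp
qed

end

text \<open>Intended for the norms \<open>\<rho> k\<close> of R T^k v and \<open>\<nu> k\<close> of
  N T^k v. Summing \<open>step\<close> shows that \<open>\<rho> k\<close> grows at most like the
  square root of \<open>k\<close> over \<open>r ^ k\<close>, and \<open>s ^ k\<close> beats this
  because \<open>s < r\<close>.\<close>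

lemma weighted_orbit_tendsto_0:
  fixes \<rho> \<nu> :: "nat \<Rightarrow> real"
  assumes step: "\<And>k. (\<rho> (Suc k))\<^sup>2 \<le> (\<rho> k)\<^sup>2 + (\<nu> k)\<^sup>2"
    and \<nu>: "\<And>k. r ^ k * \<bar>\<nu> k\<bar> \<le> C"
    and s: "0 \<le> s" "s < r" "r < 1"
  shows "(\<lambda>k. s ^ k * \<rho> k) \<longlonglongrightarrow> 0"
proof -
  have r: "0 < r"
    using s by simp
  have growth: "(\<rho> k)\<^sup>2 \<le> (\<rho> 0)\<^sup>2 + real k * (C / r ^ k)\<^sup>2" for k
  proof (induction k)
    case (Suc k)
    have "0 \<le> C"
      using \<nu>[of 0] by simp
    have "\<bar>\<nu> k\<bar> \<le> C / r ^ k"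
      using \<nu>[of k] r by (simp add: field_simps)
    then have "(\<nu> k)\<^sup>2 \<le> (C / r ^ k)\<^sup>2"
      by (metis abs_ge_zero power2_abs power_mono)
    then have "(\<rho> (Suc k))\<^sup>2 \<le> (\<rho> 0)\<^sup>2 + real (Suc k) * (C / r ^ k)\<^sup>2"
      using step[of k] Suc by (simp add: algebra_simps)
    also have "\<dots> \<le> (\<rho> 0)\<^sup>2 + real (Suc k) * (C / r ^ Suc k)\<^sup>2"
    proof -
      have "C / r ^ k \<le> C / r ^ Suc k"
        using r s \<open>0 \<le> C\<close> by (intro divide_left_mono) (auto simp: mult_left_le_one_le)
      then have "(C / r ^ k)\<^sup>2 \<le> (C / r ^ Suc k)\<^sup>2"
        using r \<open>0 \<le> C\<close> by (intro power_mono) auto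
      then show ?thesis
        by (intro add_left_mono mult_left_mono) auto
    qed
    finally show ?case .
  qed simp
  let ?b = "\<lambda>k. (s\<^sup>2) ^ k * (\<rho> 0)\<^sup>2 + C\<^sup>2 * (real k * ((s / r)\<^sup>2) ^ k)"
  have bound: "\<bar>s ^ k * \<rho> k\<bar> \<le> sqrt (?b k)" for k
  proof -
    have "(s ^ k * \<rho> k)\<^sup>2 \<le> (s ^ k)\<^sup>2 * ((\<rho> 0)\<^sup>2 + real k * (C / r ^ k)\<^sup>2)"
      unfolding power_mult_distrib by (intro mult_left_mono growth) simp
    also have "\<dots> = ?b k"
      by (simp add: algebra_simps power_divide power_mult_distrib flip: power_mult)
    finally have "sqrt ((s ^ k * \<rho> k)\<^sup>2) \<le> sqrt (?b k)"
      by (rule real_sqrt_le_mono)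
    then show "\<bar>s ^ k * \<rho> k\<bar> \<le> sqrt (?b k)"
      by (simp only: real_sqrt_abs)
  qed
  have lim1: "(\<lambda>k. (s\<^sup>2) ^ k) \<longlonglongrightarrow> 0"
    using s by (intro LIMSEQ_power_zero) (simp add: power_less_one_iff)
  have "\<bar>s / r\<bar> < 1"
    using s r by simp
  then have "norm ((s / r)\<^sup>2) < 1"
    by (simp add: abs_square_less_1 del: power_divide)
  then have lim2: "(\<lambda>k. real k * ((s / r)\<^sup>2) ^ k) \<longlonglongrightarrow> 0"
    by (rule powser_times_n_limit_0)
  have "(\<lambda>k. sqrt (?b k)) \<longlonglongrightarrow> sqrt (0 * (\<rho> 0)\<^sup>2 + C\<^sup>2 * 0)"
    by (intro tendsto_real_sqrt tendsto_add tendsto_mult lim1 lim2 tendsto_const)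
  then have "(\<lambda>k. sqrt (?b k)) \<longlonglongrightarrow> 0"
    by simp
  moreover have "\<forall>\<^sub>F k in sequentially. norm (s ^ k * \<rho> k) \<le> sqrt (?b k)"
    using bound by (intro always_eventually) (simp only: real_norm_def, blast)
  ultimately show ?thesis
    by (rule Lim_null_comparison[rotated])
qed

lemma bounded_linear_cinner_left: "bounded_linear (\<lambda>v. cinner v (y::'a::complex_hilbert))"
proof (rule bounded_linear_intro[of _ "norm y"])
  show "cinner (r *\<^sub>R v) y = r *\<^sub>R cinner v y" for r v
    using cinner_scaleC_left[of "of_real r" v y] by (simp add: scaleC_of_real scaleR_conv_of_real)
qed (simp_all add: cinner_add_left norm_cinner_le)

lemma schur_classD:
  assumes "S \<in> schur_class" "z \<in> \<bbbD>"
  shows "bounded_clinear (S z)" "norm (S z u) \<le> norm u"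
proof -
  show *: "bounded_clinear (S z)"
    using assms by (simp add: schur_class_def)
  have "norm (S z u) \<le> onorm (S z) * norm u"
    using * by (intro onorm) (simp add: bounded_clinear_def)
  also have "\<dots> \<le> 1 * norm u"
    using assms by (intro mult_right_mono) (simp_all add: schur_class_def)
  finally show "norm (S z u) \<le> norm u"
    by simp
qed

section \<open>The kernel identity and the coisometry\<close>

locale schur_loaded_colligation = colligation X U
  for X and U :: "'x::complex_hilbert \<times> 'u::complex_hilbert \<times> 'e::complex_hilbert \<Rightarrow>
      'x \<times> 'y::complex_hilbert \<times> 'd::complex_hilbert" +
  fixes \<E> :: "complex \<Rightarrow> 'd \<Rightarrow> 'e" and S :: "complex \<Rightarrow> 'u \<Rightarrow> 'y"
    and HS :: "'y fun_space" and HE :: "'e fun_space"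
  assumes D22_adjoint: "\<exists>a u. a \<in> X \<and> U (a, u, 0) = (0, 0, d)"
    and \<E>: "\<E> \<in> schur_class"
    and S: "S \<in> schur_class"
    and S_eq: "\<zeta> \<in> \<bbbD> \<Longrightarrow> S \<zeta> = redheffer U X \<E> \<zeta>"
    and HS: "dbr_space S HS"
    and HE: "dbr_space \<E> HE"
begin

sublocale HS: function_hilbert_space HS
  using HS by unfold_locales (simp add: dbr_space_def is_rkhs_def)

sublocale HE: function_hilbert_space HE
  using HE by unfold_locales (simp add: dbr_space_def is_rkhs_def)

abbreviation "\<Gamma> \<equiv> Gamma_fun U X \<E>"
abbreviation "G \<equiv> G_fun U X \<E>"
abbreviation "M\<Gamma> \<equiv> M_Gamma U X \<E>"
abbreviation "MG \<equiv> M_G U X \<E>"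

lemma loaded: "\<zeta> \<in> \<bbbD> \<Longrightarrow> loaded_colligation X U \<E> \<zeta>"
  using schur_classD[OF \<E>] by unfold_locales simp_all

text \<open>The components \<open>\<alpha>\<close>, \<open>\<upsilon>\<close>,
  \<open>\<epsilon>\<close> are the adjoints of \<open>\<Gamma> \<zeta>\<close>,
  \<open>S \<zeta>\<close>, \<open>G \<zeta>\<close> applied to \<open>y\<close>. The choice by
  \<open>SOME\<close> is harmless, since \<open>pairing\<close> determines the triple.\<close>

definition adjoint_state :: "complex \<Rightarrow> 'y \<Rightarrow> 'x \<times> 'u \<times> 'e"
  where "adjoint_state \<zeta> y =
    (SOME t. fst t \<in> X \<and> U t = (cnj \<zeta> *\<^sub>C fst t, y, cadj (\<E> \<zeta>) (snd (snd t))))"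

definition "\<alpha> \<zeta> y = fst (adjoint_state \<zeta> y)"
definition "\<upsilon> \<zeta> y = fst (snd (adjoint_state \<zeta> y))"
definition "\<epsilon> \<zeta> y = snd (snd (adjoint_state \<zeta> y))"

lemma adjoint_state:
  assumes "\<zeta> \<in> \<bbbD>"
  shows "\<alpha> \<zeta> y \<in> X" "U (\<alpha> \<zeta> y, \<upsilon> \<zeta> y, \<epsilon> \<zeta> y) = (cnj \<zeta> *\<^sub>C \<alpha> \<zeta> y, y, cadj (\<E> \<zeta>) (\<epsilon> \<zeta> y))"
proof -
  interpret loaded_colligation X U \<E> \<zeta>
    by (rule loaded[OF assms])
  obtain a u e where "a \<in> X" "U (a, u, e) = (cnj \<zeta> *\<^sub>C a, y, cadj (\<E> \<zeta>) e)"
    by (rule ex_adjoint_loop[OF D22_adjoint])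
  then have "\<exists>t. fst t \<in> X \<and> U t = (cnj \<zeta> *\<^sub>C fst t, y, cadj (\<E> \<zeta>) (snd (snd t)))"
    by (intro exI[of _ "(a, u, e)"]) simp
  from someI_ex[OF this] show "\<alpha> \<zeta> y \<in> X"
    "U (\<alpha> \<zeta> y, \<upsilon> \<zeta> y, \<epsilon> \<zeta> y) = (cnj \<zeta> *\<^sub>C \<alpha> \<zeta> y, y, cadj (\<E> \<zeta>) (\<epsilon> \<zeta> y))"
    by (simp_all add: adjoint_state_def[symmetric] \<alpha>_def \<upsilon>_def \<epsilon>_def)
qed

lemma pairing:
  assumes "\<zeta> \<in> \<bbbD>" "a \<in> X"
  shows "cinner (\<Gamma> \<zeta> a + S \<zeta> u + G \<zeta> w) y =
    cinner a (\<alpha> \<zeta> y) + cinner u (\<upsilon> \<zeta> y) + cinner w (\<epsilon> \<zeta> y)"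
  using loaded_colligation.adjoint_loop_pairing[OF loaded adjoint_state] assms by (simp add: S_eq)

lemma Gamma_G_0:
  assumes "\<zeta> \<in> \<bbbD>"
  shows "\<Gamma> \<zeta> 0 = 0" "G \<zeta> 0 = 0" "S \<zeta> 0 = 0"
proof -
  interpret loaded_colligation X U \<E> \<zeta>
    by (rule loaded[OF assms])
  show "\<Gamma> \<zeta> 0 = 0" "G \<zeta> 0 = 0"
    using Gamma_fun_scale[OF zero_X, of 0] G_fun_scale[of 0] by simp_all
  show "S \<zeta> 0 = 0"
    by (rule bounded_clinear_simps(3)[OF schur_classD(1)[OF S assms]])
qed

lemma pairing_S: "\<zeta> \<in> \<bbbD> \<Longrightarrow> cinner (S \<zeta> u) y = cinner u (\<upsilon> \<zeta> y)"
  using pairing[of \<zeta> 0 u 0 y] by (simp add: zero_X Gamma_G_0)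

lemma pairing_Gamma_G:
  "\<zeta> \<in> \<bbbD> \<Longrightarrow> a \<in> X \<Longrightarrow> cinner (\<Gamma> \<zeta> a + G \<zeta> w) y = cinner a (\<alpha> \<zeta> y) + cinner w (\<epsilon> \<zeta> y)"
  using pairing[of \<zeta> a 0 w y] by (simp add: Gamma_G_0)

lemma kernel_identity:
  assumes \<zeta>: "\<zeta> \<in> \<bbbD>" and z: "z \<in> \<bbbD>"
  shows "\<Gamma> z (\<alpha> \<zeta> y) + G z (dbr_kernel \<E> z \<zeta> (\<epsilon> \<zeta> y)) = dbr_kernel S z \<zeta> y"
proof -
  interpret loaded_colligation X U \<E> z
    by (rule loaded[OF z])
  let ?c = "1 - z * cnj \<zeta>"
  have "cmod (z * cnj \<zeta>) < 1 * 1"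
    using z \<zeta> unfolding norm_mult by (intro mult_strict_mono') auto
  then have c: "?c \<noteq> 0"
    by auto
  let ?a = "\<alpha> \<zeta> y" and ?e = "\<epsilon> \<zeta> y"
  let ?w = "?e - \<E> z (cadj (\<E> \<zeta>) ?e)"
  \<comment> \<open>The adjoint run at \<open>\<zeta>\<close> is read as a forward run at
    \<open>z\<close>: its next state is \<open>cnj \<zeta>\<close> times \<open>?a\<close>, so the
    injected state must be \<open>?c\<close> times \<open>?a\<close>, and \<open>?w\<close> is the
    external load input. Division by \<open>?c\<close> turns \<open>?w\<close> into the kernel of
    \<open>\<E>\<close>.\<close>
  have "y = \<Gamma> z (?c *\<^sub>C ?a) + redheffer U X \<E> z (\<upsilon> \<zeta> y) + G z ?w"
  proof (rule loop_output[OF adjoint_state(1)[OF \<zeta>] _ adjoint_state(2)[OF \<zeta>]])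
    show "?a = z *\<^sub>C cnj \<zeta> *\<^sub>C ?a + ?c *\<^sub>C ?a"
      by (simp add: scaleC_diff_left scaleC_scaleC)
  qed (simp_all add: scale_X adjoint_state(1)[OF \<zeta>])
  then have "y - S z (\<upsilon> \<zeta> y) = \<Gamma> z (?c *\<^sub>C ?a) + G z ?w"
    using z by (simp add: S_eq algebra_simps)
  also have "\<dots> = ?c *\<^sub>C \<Gamma> z ?a + G z ?w"
    by (simp add: Gamma_fun_scale adjoint_state(1)[OF \<zeta>])
  finally have "inverse ?c *\<^sub>C (y - S z (\<upsilon> \<zeta> y)) = inverse ?c *\<^sub>C (?c *\<^sub>C \<Gamma> z ?a + G z ?w)"
    by simp
  also have "\<dots> = \<Gamma> z ?a + G z (dbr_kernel \<E> z \<zeta> ?e)"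
    using c by (simp add: scaleC_add_right scaleC_scaleC dbr_kernel_def G_fun_scale)
  finally show ?thesis
    using cadj_eqI[OF pairing_S[OF \<zeta>], of y] by (simp add: dbr_kernel_def)
qed

text \<open>The row operator with entries \<open>M\<Gamma>\<close> and \<open>MG\<close>. On the
  direct sum the first component of \<open>p\<close> is constant on the disk, so it is read at
  0.\<close>

definition "M_row p = on_disk (\<lambda>z. \<Gamma> z (fst (p 0)) + G z (snd (p z)))"

lemma M_row_pair: "M_row (\<lambda>z. (on_disk (\<lambda>_. a) z, h z)) = (\<lambda>z. M\<Gamma> a z + MG h z)"
  by (auto simp: M_row_def M_Gamma_def M_G_def on_disk_def fun_eq_iff)

lemma pair_mem:
  "(\<lambda>z. (on_disk (\<lambda>_. a) z, h z)) \<in> fcarrier (prod_space (const_space X) HE) \<longleftrightarrow> a \<in> X \<and> h \<in> fcarrier HE"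
proof -
  have "on_disk (\<lambda>_. a) = on_disk (\<lambda>_. b) \<Longrightarrow> a = b" for a b :: 'x
    by (metis on_disk_0)
  then show ?thesis
    by (auto simp: prod_space_def const_space_def)
qed

lemma pair_exhaust:
  assumes "p \<in> fcarrier (prod_space (const_space X) HE)"
  obtains a h where "p = (\<lambda>z. (on_disk (\<lambda>_. a) z, h z))" "a \<in> X" "h \<in> fcarrier HE"
proof -
  from assms obtain a where a: "a \<in> X" "(\<lambda>z. fst (p z)) = on_disk (\<lambda>_. a)"
    and h: "(\<lambda>z. snd (p z)) \<in> fcarrier HE"
    by (auto simp: prod_space_def const_space_def)
  have "p = (\<lambda>z. (on_disk (\<lambda>_. a) z, snd (p z)))"
    by (simp add: a(2)[symmetric])
  then show thesis
    using a h by (intro that)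
qed

lemma finner_pair:
  "finner (prod_space (const_space X) HE) (\<lambda>z. (on_disk (\<lambda>_. a) z, h z)) (\<lambda>z. (on_disk (\<lambda>_. b) z, k z))
    = cinner a b + finner HE h k"
  by (simp add: prod_space_def const_space_def)

lemma coisometry:
  "M_row ` fcarrier (prod_space (const_space X) HE) = fcarrier HS" (is ?surj)
  "p \<in> fcarrier (prod_space (const_space X) HE) \<Longrightarrow>
    \<exists>r\<in>fcarrier (prod_space (const_space X) HE). M_row r = M_row p \<and>
      (\<forall>q\<in>fcarrier (prod_space (const_space X) HE).
        finner (prod_space (const_space X) HE) q r = finner HS (M_row q) (M_row p))"
proof -
  let ?P = "prod_space (const_space X) HE"
  let ?\<kappa> = "\<lambda>\<zeta> y. on_disk (\<lambda>z. dbr_kernel \<E> z \<zeta> (\<epsilon> \<zeta> y))"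
  \<comment> \<open>\<open>?k \<zeta> y\<close> represents the functional
    \<open>p \<mapsto> cinner (M_row p \<zeta>) y\<close>; \<open>kernel_identity\<close> says that
    \<open>M_row\<close> maps it to the kernel function of \<open>HS\<close>.\<close>
  let ?k = "\<lambda>\<zeta> y z. (on_disk (\<lambda>_. \<alpha> \<zeta> y) z, ?\<kappa> \<zeta> y z)"
  have rk: "is_rkhs (dbr_kernel S) HS"
    using HS by (simp add: dbr_space_def)
  have P: "fun_hilbert ?P"
    by (intro fun_hilbert_prod_space fun_hilbert_const_space X HE.H)
  have \<kappa>: "?\<kappa> \<zeta> y \<in> fcarrier HE"
    "h \<in> fcarrier HE \<Longrightarrow> finner HE h (?\<kappa> \<zeta> y) = cinner (h \<zeta>) (\<epsilon> \<zeta> y)"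
    if "\<zeta> \<in> \<bbbD>" for \<zeta> y h
    using HE that unfolding dbr_space_def is_rkhs_def by blast+
  have k: "?k \<zeta> y \<in> fcarrier ?P" if "\<zeta> \<in> \<bbbD>" for \<zeta> y
    unfolding pair_mem using adjoint_state[OF that] \<kappa>[OF that] by blast
  have ev: "cinner (M_row p \<zeta>) y = finner ?P p (?k \<zeta> y)" if \<zeta>: "\<zeta> \<in> \<bbbD>" and p: "p \<in> fcarrier ?P" for p \<zeta> y
  proof -
    obtain a h where p: "p = (\<lambda>z. (on_disk (\<lambda>_. a) z, h z))" "a \<in> X" "h \<in> fcarrier HE"
      using p by (rule pair_exhaust)
    have "cinner (M_row p \<zeta>) y = cinner (\<Gamma> \<zeta> a + G \<zeta> (h \<zeta>)) y"
      unfolding M_row_def on_disk_eq[OF \<zeta>] p(1) by simp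
    then show ?thesis
      unfolding p(1) finner_pair \<kappa>(2)[OF \<zeta> p(3)] pairing_Gamma_G[OF \<zeta> p(2)] .
  qed
  have Mk: "M_row (?k \<zeta> y) z = dbr_kernel S z \<zeta> y" if "\<zeta> \<in> \<bbbD>" "z \<in> \<bbbD>" for \<zeta> y z
    unfolding M_row_def on_disk_eq[OF that(2)] kernel_identity[OF that, symmetric] by simp
  have off: "on_disk (M_row p) = M_row p" for p
    by (auto simp: M_row_def on_disk_def)
  note co = coisometry_of_kernel[where K = "dbr_kernel S" and H = HS and P = ?P and k = ?k and M = M_row]
  show ?surj
    by (rule co(1)) (fact rk P k ev Mk off)+
  show "\<exists>r\<in>fcarrier ?P. M_row r = M_row p \<and>
      (\<forall>q\<in>fcarrier ?P. finner ?P q r = finner HS (M_row q) (M_row p))" if p: "p \<in> fcarrier ?P"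
    by (rule co(2)) (fact rk P k ev Mk off p)+
qed

lemma M_row_mem: "a \<in> X \<Longrightarrow> h \<in> fcarrier HE \<Longrightarrow> (\<lambda>z. M\<Gamma> a z + MG h z) \<in> fcarrier HS"
  unfolding coisometry(1)[symmetric] M_row_pair[symmetric] by (intro imageI) (simp add: pair_mem)

lemma M_row_surj:
  assumes "f \<in> fcarrier HS"
  obtains a h where "a \<in> X" "h \<in> fcarrier HE" "f = (\<lambda>z. M\<Gamma> a z + MG h z)"
proof -
  from assms obtain p where p: "p \<in> fcarrier (prod_space (const_space X) HE)" "f = M_row p"
    unfolding coisometry(1)[symmetric] by blast
  from p(1) show thesis
    by (rule pair_exhaust) (use that p(2) M_row_pair in blast)
qed

text \<open>\<open>(r, g)\<close> is the adjoint of the row operator applied to its value at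
  \<open>(a, h)\<close>, that is, the component of \<open>(a, h)\<close> orthogonal to the kernel of
  the row.\<close>

lemma M_row_adjoint:
  assumes "a \<in> X" "h \<in> fcarrier HE"
  obtains r g where "r \<in> X" "g \<in> fcarrier HE"
    "(\<lambda>z. M\<Gamma> r z + MG g z) = (\<lambda>z. M\<Gamma> a z + MG h z)"
    "\<And>b k. b \<in> X \<Longrightarrow> k \<in> fcarrier HE \<Longrightarrow>
      cinner b r + finner HE k g = finner HS (\<lambda>z. M\<Gamma> b z + MG k z) (\<lambda>z. M\<Gamma> a z + MG h z)"
proof -
  let ?P = "prod_space (const_space X) HE"
  let ?p = "\<lambda>z. (on_disk (\<lambda>_. a) z, h z)"
  have "?p \<in> fcarrier ?P"
    using assms by (simp only: pair_mem)
  from coisometry(2)[OF this] obtain r where r: "r \<in> fcarrier ?P" "M_row r = M_row ?p"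
    "\<And>q. q \<in> fcarrier ?P \<Longrightarrow> finner ?P q r = finner HS (M_row q) (M_row ?p)"
    by blast
  from r(1) obtain r1 g where r1: "r = (\<lambda>z. (on_disk (\<lambda>_. r1) z, g z))" "r1 \<in> X" "g \<in> fcarrier HE"
    by (rule pair_exhaust)
  have "(\<lambda>z. M\<Gamma> r1 z + MG g z) = (\<lambda>z. M\<Gamma> a z + MG h z)"
    using r(2) unfolding r1(1) M_row_pair .
  moreover have "cinner b r1 + finner HE k g = finner HS (\<lambda>z. M\<Gamma> b z + MG k z) (\<lambda>z. M\<Gamma> a z + MG h z)"
    if "b \<in> X" "k \<in> fcarrier HE" for b k
  proof -
    have "(\<lambda>z. (on_disk (\<lambda>_. b) z, k z)) \<in> fcarrier ?P"
      using that by (simp only: pair_mem)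
    from r(3)[OF this] show ?thesis
      unfolding r1(1) finner_pair M_row_pair .
  qed
  ultimately show thesis
    using r1 by (intro that)
qed

lemma M_zero: "M\<Gamma> 0 = (\<lambda>z. 0)" "MG (\<lambda>z. 0) = (\<lambda>z. 0)"
  by (auto simp: M_Gamma_def M_G_def on_disk_def fun_eq_iff Gamma_G_0)

lemma M_mem: "a \<in> X \<Longrightarrow> M\<Gamma> a \<in> fcarrier HS" "h \<in> fcarrier HE \<Longrightarrow> MG h \<in> fcarrier HS"
  using M_row_mem[of a "\<lambda>z. 0"] M_row_mem[of 0 h] by (simp_all add: M_zero HE.zero_mem zero_X)

text \<open>The partial sums of \<open>F\<^sup>S(z)v\<close> telescope to \<open>\<Gamma>(z)(Rv - z\<^sup>kRT\<^sup>kv)\<close>. As \<open>V\<close> is isometric, the growth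
  of \<open>RT\<^sup>kv\<close> is controlled by that of \<open>NT\<^sup>kv\<close>, so the remainder vanishes weakly.\<close>

lemma M_F_eq:
  assumes R: "\<And>v. R v \<in> X" and U_R: "\<And>v. U (R v, N v, 0) = (R (T v), E v, 0)"
    and E: "analytic_output_pair E T" and N: "analytic_output_pair N T"
  shows "M_F S T E N v = M\<Gamma> (R v)"
proof
  fix z
  show "M_F S T E N v z = M\<Gamma> (R v) z"
  proof (cases "z \<in> \<bbbD>")
    case zD: True
    let ?En = "\<lambda>n. z ^ n *\<^sub>C E ((T ^^ n) v)" and ?Nn = "\<lambda>n. z ^ n *\<^sub>C N ((T ^^ n) v)"
    have Sz: "bounded_clinear (S z)"
      by (rule schur_classD(1)[OF S zD])
    have sumE: "?En sums out_op E T v z" and sumN: "?Nn sums out_op N T v z"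
      using E N zD by (auto simp: out_op_def on_disk_def analytic_output_pair_def intro!: summable_sums)
    have "bounded_linear (S z)"
      using Sz by (simp add: bounded_clinear_def)
    then have "(\<lambda>n. S z (?Nn n)) sums S z (out_op N T v z)"
      using sumN by (rule bounded_linear.sums)
    then have sumF: "(\<lambda>n. ?En n - S z (?Nn n)) sums (out_op E T v z - S z (out_op N T v z))"
      by (rule sums_diff[OF sumE])
    show ?thesis
      unfolding M_F_def M_Gamma_def on_disk_eq[OF zD]
    \<comment> \<open>Against a fixed \<open>y\<close> the operator \<open>\<Gamma> z\<close>
      becomes the functional given by \<open>\<alpha> z y\<close>, so the limit can be taken without
      a norm bound for \<open>\<Gamma> z\<close>.\<close>
    proof (rule cinner_ext)
      fix y
      let ?a = "\<lambda>n. cinner (R ((T ^^ n) v)) (\<alpha> z y)"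
      \<comment> \<open>One run with input \<open>N w\<close> and no load signal: the state
        \<open>R w\<close> moves to \<open>R (T w)\<close>, so the injected state is
        \<open>R w - z *\<^sub>C R (T w)\<close>.\<close>
      have defect: "cinner (E w - S z (N w)) y = cinner (R w) (\<alpha> z y) - z * cinner (R (T w)) (\<alpha> z y)" for w
      proof -
        interpret loaded_colligation X U \<E> z
          by (rule loaded[OF zD])
        have "E w = \<Gamma> z (R w - z *\<^sub>C R (T w)) + redheffer U X \<E> z (N w) + G z 0"
          by (rule loop_output[OF R _ U_R]) (simp_all add: R scale_X diff_X \<E>_simps)
        then have "E w - S z (N w) = \<Gamma> z (R w - z *\<^sub>C R (T w)) + G z 0"
          using zD by (simp add: S_eq Gamma_G_0)
        then have "cinner (E w - S z (N w)) y = cinner (R w - z *\<^sub>C R (T w)) (\<alpha> z y)"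
          using pairing_Gamma_G[OF zD, of "R w - z *\<^sub>C R (T w)" 0 y] by (simp add: R scale_X diff_X)
        then show ?thesis
          by (simp add: cinner_diff_left cinner_scaleC_left)
      qed
      have "cinner (?En n - S z (?Nn n)) y = z ^ n * ?a n - z ^ Suc n * ?a (Suc n)" for n
      proof -
        have "?En n - S z (?Nn n) = z ^ n *\<^sub>C (E ((T ^^ n) v) - S z (N ((T ^^ n) v)))"
          by (simp add: bounded_clinear_simps[OF Sz] scaleC_diff_right)
        then show ?thesis
          by (simp add: cinner_scaleC_left defect algebra_simps)
      qed
      then have sum1: "(\<lambda>n. z ^ n * ?a n - z ^ Suc n * ?a (Suc n)) sums
          cinner (out_op E T v z - S z (out_op N T v z)) y"
        using bounded_linear.sums[OF bounded_linear_cinner_left sumF, of y] by simp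
      have "(\<lambda>n. z ^ n * ?a n) \<longlonglongrightarrow> 0"
      proof -
        \<comment> \<open>The series for \<open>N\<close> is used at a radius strictly beyond
          \<open>cmod z\<close>; bounded terms there leave the margin that
          \<open>weighted_orbit_tendsto_0\<close> requires.\<close>
        obtain r where r: "cmod z < r" "r < 1"
          using zD dense[of "cmod z" 1] by auto
        have "0 \<le> r"
          using r norm_ge_zero[of z] by linarith
        have "summable (\<lambda>n. of_real r ^ n *\<^sub>C N ((T ^^ n) v))"
          using N r \<open>0 \<le> r\<close> by (auto simp: analytic_output_pair_def)
        then have "Bseq (\<lambda>n. of_real r ^ n *\<^sub>C N ((T ^^ n) v))"
          by (rule convergent_imp_Bseq[OF convergentI[OF summable_LIMSEQ_zero]])
        then obtain C where "\<And>n. norm (of_real r ^ n *\<^sub>C N ((T ^^ n) v)) \<le> C"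
          by (meson BseqE)
        then have C: "r ^ n * \<bar>norm (N ((T ^^ n) v))\<bar> \<le> C" for n
          using \<open>0 \<le> r\<close> by (simp add: norm_scaleC norm_power)
        have "(\<lambda>n. cmod z ^ n * norm (R ((T ^^ n) v))) \<longlonglongrightarrow> 0"
        proof (rule weighted_orbit_tendsto_0[OF _ C _ r])
          show "(norm (R ((T ^^ Suc k) v)))\<^sup>2 \<le> (norm (R ((T ^^ k) v)))\<^sup>2 + (norm (N ((T ^^ k) v)))\<^sup>2" for k
            using U_norm[OF R U_R, of "(T ^^ k) v"] zero_le_power2[of "norm (E ((T ^^ k) v))"]
            unfolding funpow.simps o_apply norm_zero zero_power2 by linarith
        qed simp
        then have "(\<lambda>n. cmod z ^ n * norm (R ((T ^^ n) v)) * norm (\<alpha> z y)) \<longlonglongrightarrow> 0"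
          by (rule tendsto_mult_left_zero)
        moreover have "\<forall>\<^sub>F n in sequentially.
            cmod (z ^ n * ?a n) \<le> cmod z ^ n * norm (R ((T ^^ n) v)) * norm (\<alpha> z y)"
          by (simp add: norm_mult norm_power mult.assoc mult_left_mono norm_cinner_le)
        ultimately show ?thesis
          by (rule Lim_null_comparison[rotated])
      qed
      from telescope_sums'[OF this]
      have "(\<lambda>n. z ^ n * ?a n - z ^ Suc n * ?a (Suc n)) sums cinner (R v) (\<alpha> z y)"
        by simp
      with sum1 have "cinner (out_op E T v z - S z (out_op N T v z)) y = cinner (R v) (\<alpha> z y)"
        by (rule sums_unique2)
      then show "cinner (out_op E T v z - S z (out_op N T v z)) y = cinner (\<Gamma> z (R v)) y"
        using pairing_Gamma_G[OF zD R, of v 0 y] zD by (simp add: Gamma_G_0)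
    qed
  next
    case False
    then show ?thesis
      by (simp add: M_F_def M_Gamma_def on_disk_def)
  qed
qed

end

section \<open>Solutions of the interpolation problem\<close>

lemma cinner_closure_le:
  assumes a: "a \<in> closure A" and le: "\<And>b. b \<in> A \<Longrightarrow> cmod (cinner b (y::'a::complex_hilbert)) \<le> c * norm b"
  shows "cmod (cinner a y) \<le> c * norm a"
proof -
  obtain s where s: "\<And>n::nat. s n \<in> A" "s \<longlonglongrightarrow> a"
    using a unfolding closure_sequential by blast
  have "(\<lambda>n. cmod (cinner (s n) y)) \<longlonglongrightarrow> cmod (cinner a y)"
    by (intro tendsto_norm tendsto_cinner_left s)
  moreover have "(\<lambda>n. c * norm (s n)) \<longlonglongrightarrow> c * norm a"
    by (intro tendsto_mult tendsto_const tendsto_norm s)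
  ultimately show ?thesis
    using le s(1) by (intro LIMSEQ_le[of "\<lambda>n. cmod (cinner (s n) y)" _ "\<lambda>n. c * norm (s n)"]) auto
qed

lemma eq_0_if_orthogonal_dense:
  assumes "a \<in> closure A" "\<And>b. b \<in> A \<Longrightarrow> cinner b a = 0"
  shows "a = (0::'a::complex_hilbert)"
  using cinner_closure_le[OF assms(1), of a 0] assms(2) by (simp add: cinner_self_eq_0_iff)

text \<open>Polarization: reality of the quadratic form at \<open>v + w\<close> compares the
  imaginary parts of \<open>cinner (R v) w\<close> and \<open>cinner (R w) v\<close>, and reality at
  \<open>v + \<i> *\<^sub>C w\<close> their real parts.\<close>

lemma positive_op_self_adjoint:
  assumes R: "bounded_clinear R" "positive_op R"
  shows "cinner (R v) w = cinner v (R w)"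
proof -
  have real: "Im (cinner (R u) u) = 0" for u
    using R(2) by (simp add: positive_op_def complex_is_Real_iff)
  have 1: "Im (cinner (R v) w) + Im (cinner (R w) v) = 0"
    using real[of "v + w"] real[of v] real[of w]
    by (simp add: bounded_clinear_simps[OF R(1)] cinner_add_left cinner_add_right)
  have 2: "Re (cinner (R w) v) - Re (cinner (R v) w) = 0"
    using real[of "v + \<i> *\<^sub>C w"] real[of v] real[of w]
    by (simp add: bounded_clinear_simps[OF R(1)] cinner_add_left cinner_add_right cinner_scaleC_left
        cinner_scaleC_right)
  have "cinner (R v) w = cnj (cinner (R w) v)"
    using 1 2 by (intro complex_eqI) simp_all
  then show ?thesis
    by (metis cinner_commute)
qed

text \<open>The bound makes \<open>R v \<mapsto> cinner v x\<close> a well-defined functional of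
  norm at most 1 on the range of \<open>R\<close>, with Riesz vector \<open>xt\<close>. The same
  bound, extended to the closure and evaluated at \<open>xt\<close> itself, gives
  \<open>norm xt \<le> 1\<close>.\<close>

lemma douglas_vector:
  fixes R :: "'a::complex_hilbert \<Rightarrow> 'a"
  assumes R: "bounded_clinear R" "\<And>v w. cinner (R v) w = cinner v (R w)"
    and le: "\<And>v. cmod (cinner v x) \<le> norm (R v)"
  obtains xt where "xt \<in> closure (range R)" "x = R xt" "norm xt \<le> 1"
proof -
  define \<phi> where "\<phi> a = cinner (SOME v. R v = a) x" for a
  have \<phi>: "\<phi> (R v) = cinner v x" for v
  proof -
    let ?w = "SOME w. R w = R v"
    have "R ?w = R v"
      by (rule someI) simp
    then have "R (?w - v) = 0"
      by (simp add: bounded_clinear_simps[OF R(1)])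
    then have "cinner (?w - v) x = 0"
      using le[of "?w - v"] by simp
    then show ?thesis
      by (simp add: \<phi>_def cinner_diff_left)
  qed
  obtain xt where xt: "xt \<in> closure (range R)" "\<And>a. a \<in> range R \<Longrightarrow> \<phi> a = cinner a xt"
  proof (rule riesz_on_csubspace[of "range R" \<phi> 1])
    show "csubspace (range R)"
      by (rule csubspace_range[OF R(1)])
    show "\<phi> (a + b) = \<phi> a + \<phi> b" if "a \<in> range R" "b \<in> range R" for a b
      using that by (auto simp: \<phi> cinner_add_left bounded_clinear_simps(1)[OF R(1), symmetric])
    show "\<phi> (c *\<^sub>C a) = c * \<phi> a" if "a \<in> range R" for c a
      using that by (auto simp: \<phi> cinner_scaleC_left bounded_clinear_simps(4)[OF R(1), symmetric])
    show "cmod (\<phi> a) \<le> 1 * norm a" if "a \<in> range R" for a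
      using that le by (auto simp: \<phi>)
  qed blast
  have eq: "cinner v x = cinner (R v) xt" for v
    using xt(2)[of "R v"] \<phi> by simp
  have "x = R xt"
    by (rule cinner_ext_right) (simp only: eq R(2))
  moreover have "cmod (cinner xt xt) \<le> 1 * norm xt"
    by (rule cinner_closure_le[OF xt(1)]) (use le in \<open>auto simp: eq[symmetric]\<close>)
  then have "norm xt \<le> 1"
    using mult_right_le_imp_le[of "norm xt" "norm xt" 1]
    by (cases "xt = 0") (simp_all add: cinner_self norm_power power2_eq_square norm_mult)
  ultimately show thesis
    using xt(1) by (intro that)
qed

lemma fadj_eqI:
  assumes "\<And>v. finner H (M v) f = cinner v x"
  shows "fadj H M f = x"
  unfolding fadj_def using assms by (intro the_equality) (auto intro: cinner_ext_right)

text \<open>\<open>F\<close> stands for \<open>M_F S T E N\<close>; the solution set depends on it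
  only through its factorization over \<open>R\<close> and its Gram operator.\<close>

locale interpolation_colligation = schur_loaded_colligation X U \<E> S HS HE
  for X and U :: "'x::complex_hilbert \<times> 'u::complex_hilbert \<times> 'e::complex_hilbert \<Rightarrow>
      'x \<times> 'y::complex_hilbert \<times> 'd::complex_hilbert"
    and \<E> :: "complex \<Rightarrow> 'd \<Rightarrow> 'e" and S :: "complex \<Rightarrow> 'u \<Rightarrow> 'y" and HS HE +
  fixes R :: "'x \<Rightarrow> 'x" and F :: "'x \<Rightarrow> complex \<Rightarrow> 'y"
  assumes R_adjoint: "cinner (R v) w = cinner v (R w)"
    and X_closure: "X = closure (range R)"
    and F: "F v = M\<Gamma> (R v)"
    and fadj_F: "fadj HS F (F v) = R (R v)"
begin

lemma R_X: "R v \<in> X"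
  using closure_subset[of "range R"] by (auto simp: X_closure)

lemma eq_if_orthogonal:
  assumes "a \<in> X" "b \<in> X" "\<And>v. cinner (R v) a = cinner (R v) b"
  shows "a = b"
  using eq_0_if_orthogonal_dense[of "a - b" "range R"] assms diff_X[OF assms(1,2)]
  by (auto simp: cinner_diff_right X_closure)

text \<open>The kernel of the self-adjoint \<open>R\<close> is orthogonal to its range. Uniqueness
  of the vector representing \<open>x\<close> comes from here.\<close>

lemma R_inj: "a \<in> X \<Longrightarrow> b \<in> X \<Longrightarrow> R a = R b \<Longrightarrow> a = b"
  by (rule eq_if_orthogonal) (simp_all add: R_adjoint)

text \<open>\<open>fadj_F\<close> concerns a definite description and carries no information until
  some vector is known to represent the functional. \<open>M_row_adjoint\<close> produces one of the
  form \<open>R r\<close>, and \<open>fadj_F\<close> identifies it with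
  \<open>R (R v)\<close>.\<close>

lemma gram: "finner HS (F w) (F v) = cinner (R w) (R v)"
proof -
  obtain r g where "r \<in> X" and g: "g \<in> fcarrier HE"
    and "(\<lambda>z. M\<Gamma> r z + MG g z) = (\<lambda>z. M\<Gamma> (R v) z + MG (\<lambda>z. 0) z)"
    and r: "\<And>b k. b \<in> X \<Longrightarrow> k \<in> fcarrier HE \<Longrightarrow>
      cinner b r + finner HE k g = finner HS (\<lambda>z. M\<Gamma> b z + MG k z) (\<lambda>z. M\<Gamma> (R v) z + MG (\<lambda>z. 0) z)"
    by (rule M_row_adjoint[OF R_X HE.zero_mem, of v]) (rule that)
  have *: "finner HS (F w) (F v) = cinner w (R r)" for w
    using r[OF R_X[of w] HE.zero_mem] g by (simp add: F M_zero HE.finner_zero_left R_adjoint)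
  then have "R r = R (R v)"
    using fadj_eqI[of HS F "F v" "R r"] fadj_F[of v] by simp
  then show ?thesis
    by (simp add: * R_adjoint)
qed

text \<open>The adjoint vector \<open>(r, g)\<close> of \<open>(R v, 0)\<close> has the same norm as
  \<open>R v\<close>, by \<open>gram\<close>, and its inner product with \<open>(R v, 0)\<close> is
  the square of that norm. Expanding the squared distance forces
  \<open>(r, g) = (R v, 0)\<close>.\<close>

lemma M_Gamma_isometry_range:
  assumes "b \<in> X" "k \<in> fcarrier HE"
  shows "finner HS (\<lambda>z. M\<Gamma> b z + MG k z) (M\<Gamma> (R v)) = cinner b (R v)"
proof -
  obtain r g where r: "r \<in> X" and g: "g \<in> fcarrier HE"
    and eq: "(\<lambda>z. M\<Gamma> r z + MG g z) = (\<lambda>z. M\<Gamma> (R v) z + MG (\<lambda>z. 0) z)"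
    and adj: "\<And>b k. b \<in> X \<Longrightarrow> k \<in> fcarrier HE \<Longrightarrow>
      cinner b r + finner HE k g = finner HS (\<lambda>z. M\<Gamma> b z + MG k z) (\<lambda>z. M\<Gamma> (R v) z + MG (\<lambda>z. 0) z)"
    by (rule M_row_adjoint[OF R_X HE.zero_mem, of v]) (rule that)
  have eq': "(\<lambda>z. M\<Gamma> r z + MG g z) = M\<Gamma> (R v)"
    using eq by (simp add: M_zero)
  have n: "finner HS (M\<Gamma> (R v)) (M\<Gamma> (R v)) = complex_of_real ((norm (R v))\<^sup>2)"
    using gram[of v v] by (simp add: F cinner_self)
  have "cinner (R v) r = complex_of_real ((norm (R v))\<^sup>2)"
    using adj[OF R_X[of v] HE.zero_mem] g n by (simp add: M_zero HE.finner_zero_left)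
  moreover from this have "cinner r (R v) = complex_of_real ((norm (R v))\<^sup>2)"
    using cinner_commute[of r "R v"] by simp
  moreover have "cinner r r + finner HE g g = complex_of_real ((norm (R v))\<^sup>2)"
    using adj[OF r g] n by (simp add: eq' M_zero)
  ultimately have "cinner (r - R v) (r - R v) + finner HE g g = 0"
    unfolding cinner_diff_left cinner_diff_right cinner_self[of "R v"]
    by (simp add: diff_add_eq flip: of_real_power)
  then have "complex_of_real ((norm (r - R v))\<^sup>2 + (fnorm HE g)\<^sup>2) = 0"
    unfolding cinner_self HE.finner_self[OF g] of_real_add .
  then have "(norm (r - R v))\<^sup>2 + (fnorm HE g)\<^sup>2 = 0"
    by (simp only: of_real_eq_0_iff)
  then have "r = R v" "fnorm HE g = 0"
    by (simp_all add: sum_power2_eq_zero_iff)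
  then show ?thesis
    using adj[OF assms] HE.fnorm_eq_0[OF g] assms by (simp add: M_zero HE.finner_zero_right)
qed

text \<open>The extension from the range of \<open>R\<close> to \<open>X\<close> avoids continuity
  of \<open>M\<Gamma>\<close>: the adjoint vector \<open>r\<close> of \<open>a\<close> has the same
  inner products with the range as \<open>a\<close>, so \<open>r = a\<close>, and two evaluations of
  the squared norm of \<open>M\<Gamma> a\<close> leave \<open>g = 0\<close>. The free
  \<open>k\<close> also yields orthogonality to the range of \<open>MG\<close>.\<close>

lemma M_Gamma_isometry:
  assumes a: "a \<in> X" and b: "b \<in> X" and k: "k \<in> fcarrier HE"
  shows "finner HS (\<lambda>z. M\<Gamma> b z + MG k z) (M\<Gamma> a) = cinner b a"
proof -
  obtain r g where r: "r \<in> X" and g: "g \<in> fcarrier HE"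
    and "(\<lambda>z. M\<Gamma> r z + MG g z) = (\<lambda>z. M\<Gamma> a z + MG (\<lambda>z. 0) z)"
    and "\<And>b k. b \<in> X \<Longrightarrow> k \<in> fcarrier HE \<Longrightarrow>
      cinner b r + finner HE k g = finner HS (\<lambda>z. M\<Gamma> b z + MG k z) (\<lambda>z. M\<Gamma> a z + MG (\<lambda>z. 0) z)"
    by (rule M_row_adjoint[OF a HE.zero_mem]) (rule that)
  then have eq: "(\<lambda>z. M\<Gamma> r z + MG g z) = M\<Gamma> a"
    and adj: "\<And>b k. b \<in> X \<Longrightarrow> k \<in> fcarrier HE \<Longrightarrow>
      cinner b r + finner HE k g = finner HS (\<lambda>z. M\<Gamma> b z + MG k z) (M\<Gamma> a)"
    by (simp_all add: M_zero)
  have "r = a"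
  proof (rule eq_if_orthogonal[OF r a])
    fix v
    have "cinner (R v) r = finner HS (M\<Gamma> (R v)) (M\<Gamma> a)"
      using adj[OF R_X[of v] HE.zero_mem] g by (simp add: M_zero HE.finner_zero_left)
    also have "\<dots> = cnj (finner HS (M\<Gamma> a) (M\<Gamma> (R v)))"
      by (intro HS.finner_commute M_mem R_X a)
    also have "\<dots> = cinner (R v) a"
      using M_Gamma_isometry_range[OF a HE.zero_mem, of v] cinner_commute[of "R v" a]
      by (simp add: M_zero)
    finally show "cinner (R v) r = cinner (R v) a" .
  qed
  have "cinner a a = finner HS (M\<Gamma> a) (M\<Gamma> a)"
    using adj[OF a HE.zero_mem] g by (simp add: M_zero HE.finner_zero_left \<open>r = a\<close>)
  moreover have "cinner a a + finner HE g g = finner HS (M\<Gamma> a) (M\<Gamma> a)"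
    using adj[OF r g, unfolded eq] by (simp only: \<open>r = a\<close>)
  ultimately have "g = (\<lambda>z. 0)"
    by (intro HE.finner_definite[OF g]) simp
  then show ?thesis
    using adj[OF b k] k by (simp add: HE.finner_zero_right \<open>r = a\<close>)
qed

lemma M_Gamma_inner: "a \<in> X \<Longrightarrow> b \<in> X \<Longrightarrow> finner HS (M\<Gamma> b) (M\<Gamma> a) = cinner b a"
  using M_Gamma_isometry[of a b "\<lambda>z. 0"] by (simp add: M_zero HE.zero_mem)

lemma M_Gamma_norm: "a \<in> X \<Longrightarrow> fnorm HS (M\<Gamma> a) = norm a"
  by (simp add: fnorm_def M_Gamma_inner cinner_self)

lemma M_G_orthogonal:
  assumes "a \<in> X" "h \<in> fcarrier HE"
  shows "finner HS (MG h) (M\<Gamma> a) = 0" "finner HS (M\<Gamma> a) (MG h) = 0"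
proof -
  show 1: "finner HS (MG h) (M\<Gamma> a) = 0"
    using M_Gamma_isometry[of a 0 h] assms by (simp add: M_zero zero_X)
  show "finner HS (M\<Gamma> a) (MG h) = 0"
    using HS.finner_commute[of "M\<Gamma> a" "MG h"] assms 1 by (simp add: M_mem)
qed

lemma pythagoras:
  assumes "a \<in> X" "h \<in> fcarrier HE"
  shows "(fnorm HS (\<lambda>z. M\<Gamma> a z + MG h z))\<^sup>2 = (norm a)\<^sup>2 + (fnorm HS (MG h))\<^sup>2"
  using assms by (simp add: HS.fnorm_square HS.mem M_mem HS.finner_add_left HS.finner_add_right
      M_G_orthogonal M_Gamma_inner cinner_self)

lemma MG_linear:
  "MG (\<lambda>z. h z - g z) = (\<lambda>z. MG h z - MG g z)"
  "MG (\<lambda>z. c *\<^sub>C h z) = (\<lambda>z. c *\<^sub>C MG h z)"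
proof -
  have add: "G z (v + w) = G z v + G z w" and scale: "G z (c *\<^sub>C v) = c *\<^sub>C G z v"
    if "z \<in> \<bbbD>" for z v w c
    using loaded_colligation.G_fun_add[OF loaded[OF that]] loaded_colligation.G_fun_scale[OF loaded[OF that]]
    by blast+
  have "G z (v - w) = G z v - G z w" if "z \<in> \<bbbD>" for z v w
    using add[OF that, of "v - w" w] by simp
  with scale show "MG (\<lambda>z. h z - g z) = (\<lambda>z. MG h z - MG g z)"
    "MG (\<lambda>z. c *\<^sub>C h z) = (\<lambda>z. c *\<^sub>C MG h z)"
    by (auto simp: M_G_def on_disk_def fun_eq_iff)
qed

text \<open>Orthogonality of the two ranges makes the adjoint vector of \<open>(0, h)\<close> equal
  to \<open>(0, k)\<close>. This \<open>k\<close> has the same image as \<open>h\<close> and is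
  orthogonal to the kernel, so it is the projection of \<open>h\<close>, and \<open>MG\<close>
  preserves its norm.\<close>

lemma MG_projection:
  assumes h: "h \<in> fcarrier HE"
  defines "g \<equiv> fproj HE (fominus HE (ker_M HE MG)) h"
  shows "g \<in> fcarrier HE" "MG g = MG h" "fnorm HE g = fnorm HS (MG h)" "fnorm HE g \<le> fnorm HE h"
proof -
  obtain r k where r: "r \<in> X" and k: "k \<in> fcarrier HE"
    and "(\<lambda>z. M\<Gamma> r z + MG k z) = (\<lambda>z. M\<Gamma> 0 z + MG h z)"
    and "\<And>b l. b \<in> X \<Longrightarrow> l \<in> fcarrier HE \<Longrightarrow>
      cinner b r + finner HE l k = finner HS (\<lambda>z. M\<Gamma> b z + MG l z) (\<lambda>z. M\<Gamma> 0 z + MG h z)"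
    by (rule M_row_adjoint[OF zero_X h]) (rule that)
  then have eq: "(\<lambda>z. M\<Gamma> r z + MG k z) = MG h"
    and adj: "\<And>b l. b \<in> X \<Longrightarrow> l \<in> fcarrier HE \<Longrightarrow>
      cinner b r + finner HE l k = finner HS (\<lambda>z. M\<Gamma> b z + MG l z) (MG h)"
    by (simp_all add: M_zero)
  have "cinner r r = 0"
    using adj[OF r HE.zero_mem] r k h by (simp add: M_zero HE.finner_zero_left M_G_orthogonal)
  then have "r = 0"
    by (simp add: cinner_self_eq_0_iff)
  have MGk: "MG k = MG h"
    using eq by (simp add: \<open>r = 0\<close> M_zero)
  have adj': "finner HE l k = finner HS (MG l) (MG h)" if "l \<in> fcarrier HE" for l
    using adj[OF zero_X that] by (simp add: M_zero)
  have g: "g = k"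
    unfolding g_def
  proof (rule HE.fproj_eqI[OF _ h])
    show "ker_M HE MG \<subseteq> fcarrier HE"
      by (auto simp: ker_M_def)
    show "k \<in> fominus HE (ker_M HE MG)"
      unfolding fominus_def
    proof (intro CollectI conjI ballI k)
      fix l assume "l \<in> ker_M HE MG"
      then have l: "l \<in> fcarrier HE" "MG l = (\<lambda>z. 0)"
        by (auto simp: ker_M_def)
      then have "finner HE l k = 0"
        using h by (simp add: adj' HS.finner_zero_left M_mem)
      then show "finner HE k l = 0"
        using HE.finner_commute[OF k l(1)] by simp
    qed
    show "finner HE (\<lambda>z. h z - k z) l = 0" if l: "l \<in> fominus HE (ker_M HE MG)" for l
    proof -
      have "(\<lambda>z. h z - k z) \<in> ker_M HE MG"
        using h k by (simp add: ker_M_def HE.mem MG_linear MGk)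
      then have "finner HE l (\<lambda>z. h z - k z) = 0"
        using l by (simp add: fominus_def)
      then show ?thesis
        using HE.finner_commute[of "\<lambda>z. h z - k z" l] l h k by (simp add: HE.mem fominus_def)
    qed
  qed
  show "g \<in> fcarrier HE" "MG g = MG h"
    by (simp_all add: g k MGk)
  show n: "fnorm HE g = fnorm HS (MG h)"
    by (simp add: fnorm_def g adj'[OF k] MGk)
  have "finner HE h k = complex_of_real ((fnorm HE k)\<^sup>2)"
    using adj'[OF h] n h by (simp add: g HS.finner_self M_mem)
  then have "fnorm HE k * fnorm HE k \<le> fnorm HE h * fnorm HE k"
    using HE.cauchy_schwarz[OF h k] by (simp add: norm_power power2_eq_square norm_mult)
  then show "fnorm HE g \<le> fnorm HE h"
    unfolding g using HE.fnorm_nonneg[OF k] HE.fnorm_nonneg[OF h]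
    by (cases "fnorm HE k = 0") (auto simp: mult_le_cancel_right)
qed

lemma fadj_MM: "a \<in> X \<Longrightarrow> h \<in> fcarrier HE \<Longrightarrow> fadj HS F (\<lambda>z. M\<Gamma> a z + MG h z) = R a"
  by (rule fadj_eqI)
    (simp add: F HS.finner_add_right M_mem R_X M_Gamma_inner M_G_orthogonal R_adjoint)

section \<open>Parametrization, minimal norm and uniqueness\<close>

definition "solutions xt = {f \<in> fcarrier HS. fadj HS F f = R xt \<and> fnorm HS f \<le> 1}"

context
  fixes xt :: 'x
  assumes xt: "xt \<in> X" and xt_le: "norm xt \<le> 1"
begin

lemma fnorm_le_radius_iff:
  "0 \<le> t \<Longrightarrow> t \<le> sqrt (1 - (norm xt)\<^sup>2) \<longleftrightarrow> (norm xt)\<^sup>2 + t\<^sup>2 \<le> 1"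
  using real_le_rsqrt[of t "1 - (norm xt)\<^sup>2"] real_sqrt_le_iff[of "t\<^sup>2" "1 - (norm xt)\<^sup>2"] by auto

lemma M_row_solution_iff:
  assumes a: "a \<in> X" and h: "h \<in> fcarrier HE"
  shows "(\<lambda>z. M\<Gamma> a z + MG h z) \<in> solutions xt \<longleftrightarrow>
    a = xt \<and> fnorm HS (MG h) \<le> sqrt (1 - (norm xt)\<^sup>2)"
proof -
  have le1: "fnorm HS (\<lambda>z. M\<Gamma> a z + MG h z) \<le> 1 \<longleftrightarrow> (norm a)\<^sup>2 + (fnorm HS (MG h))\<^sup>2 \<le> 1"
    unfolding pythagoras[OF a h, symmetric]
    using HS.fnorm_nonneg[OF M_row_mem[OF a h]] by (simp add: abs_square_le_1)
  show ?thesis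
    unfolding solutions_def mem_Collect_eq fadj_MM[OF a h] le1
      fnorm_le_radius_iff[OF HS.fnorm_nonneg[OF M_mem(2)[OF h]]]
    using M_row_mem[OF a h] R_inj[OF a xt] by auto
qed

text \<open>A solution comes with some \<open>h\<close> for which only the norm of
  \<open>MG h\<close> is controlled. Replacing \<open>h\<close> by its projection off the kernel
  keeps \<open>MG h\<close> and lowers the norm to that of \<open>MG h\<close>; conversely
  \<open>MG\<close> is contractive.\<close>

lemma solutions_eq:
  "solutions xt = {(\<lambda>z. M\<Gamma> xt z + MG h z) | h.
    h \<in> fcarrier HE \<and> fnorm HE h \<le> sqrt (1 - (norm xt)\<^sup>2)}" (is "_ = ?rhs")
proof (intro equalityI subsetI)
  fix f assume f: "f \<in> solutions xt"
  then have "f \<in> fcarrier HS"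
    by (simp add: solutions_def)
  then obtain a h where a: "a \<in> X" and h: "h \<in> fcarrier HE" and f_eq: "f = (\<lambda>z. M\<Gamma> a z + MG h z)"
    by (rule M_row_surj)
  have "a = xt" "fnorm HS (MG h) \<le> sqrt (1 - (norm xt)\<^sup>2)"
    using f M_row_solution_iff[OF a h] by (auto simp: f_eq)
  then show "f \<in> ?rhs"
    using MG_projection[OF h] f_eq by (intro CollectI exI conjI) auto
next
  fix f assume "f \<in> ?rhs"
  then obtain h where h: "h \<in> fcarrier HE" "fnorm HE h \<le> sqrt (1 - (norm xt)\<^sup>2)"
    and f: "f = (\<lambda>z. M\<Gamma> xt z + MG h z)"
    by blast
  have "fnorm HS (MG h) \<le> sqrt (1 - (norm xt)\<^sup>2)"
    using MG_projection[OF h(1)] h(2) by simp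
  then show "f \<in> solutions xt"
    using M_row_solution_iff[OF xt h(1)] by (simp add: f)
qed

lemma M_Gamma_solution: "M\<Gamma> xt \<in> solutions xt"
  using M_row_solution_iff[OF xt HE.zero_mem] xt_le
  by (simp add: M_zero HS.fnorm_zero abs_square_le_1)

lemma M_Gamma_minimal:
  assumes f: "f \<in> solutions xt" "f \<noteq> M\<Gamma> xt"
  shows "fnorm HS (M\<Gamma> xt) < fnorm HS f"
proof -
  obtain h where h: "h \<in> fcarrier HE" and f_eq: "f = (\<lambda>z. M\<Gamma> xt z + MG h z)"
    using f(1) unfolding solutions_eq by blast
  have "fnorm HS (MG h) \<noteq> 0"
    using f(2) HS.fnorm_eq_0[OF M_mem(2)[OF h]] by (auto simp: f_eq)
  then have "(norm xt)\<^sup>2 < (fnorm HS f)\<^sup>2"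
    by (simp add: f_eq pythagoras[OF xt h])
  moreover have "0 \<le> fnorm HS f"
    unfolding f_eq by (rule HS.fnorm_nonneg[OF M_row_mem[OF xt h]])
  ultimately show ?thesis
    unfolding M_Gamma_norm[OF xt] by (rule power_less_imp_less_base)
qed

text \<open>\<open>MG h\<close> is orthogonal to the range of \<open>F\<close>, so subtracting an
  approximant \<open>F v\<close> from one factor does not change its inner product with
  itself.\<close>

lemma MG_eq_0_if_dense:
  assumes dense: "fclosure HS (range F) = fcarrier HS" and h: "h \<in> fcarrier HE"
  shows "MG h = (\<lambda>z. 0)"
proof (rule HS.fnorm_eq_0[OF M_mem(2)[OF h]])
  let ?n = "fnorm HS (MG h)"
  have "?n \<le> e" if e: "e > 0" for e
  proof -
    have "MG h \<in> fclosure HS (range F)"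
      using M_mem(2)[OF h] dense by simp
    then obtain v where v: "fnorm HS (\<lambda>z. MG h z - F v z) < e"
      using e unfolding fclosure_def by blast
    have "F v \<in> fcarrier HS"
      by (simp add: F M_mem R_X)
    have "finner HS (\<lambda>z. MG h z - F v z) (MG h) = complex_of_real (?n\<^sup>2)"
      using h by (simp add: F HS.finner_diff_left M_mem R_X M_G_orthogonal HS.finner_self)
    then have "?n * ?n \<le> fnorm HS (\<lambda>z. MG h z - F v z) * ?n"
      using HS.cauchy_schwarz[of "\<lambda>z. MG h z - F v z" "MG h"] M_mem(2)[OF h] \<open>F v \<in> fcarrier HS\<close>
      by (simp add: HS.mem norm_power power2_eq_square norm_mult)
    then show ?thesis
      using v e HS.fnorm_nonneg[OF M_mem(2)[OF h]] by (cases "?n = 0") (auto simp: mult_le_cancel_right)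
  qed
  then have "?n \<le> 0"
    using field_le_epsilon[of ?n 0] by simp
  then show "?n = 0"
    using HS.fnorm_nonneg[OF M_mem(2)[OF h]] by simp
qed

text \<open>Without the \<open>MG\<close> part every function is some \<open>M\<Gamma> a\<close>,
  and the isometry \<open>M\<Gamma>\<close> carries density of the range of \<open>R\<close> in
  \<open>X\<close> over to \<open>HS\<close>.\<close>

lemma dense_if_MG_eq_0:
  assumes MG0: "\<And>h. h \<in> fcarrier HE \<Longrightarrow> MG h = (\<lambda>z. 0)"
  shows "fclosure HS (range F) = fcarrier HS"
proof
  show "fcarrier HS \<subseteq> fclosure HS (range F)"
  proof
    fix f assume f: "f \<in> fcarrier HS"
    then obtain a h where a: "a \<in> X" and h: "h \<in> fcarrier HE" and "f = (\<lambda>z. M\<Gamma> a z + MG h z)"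
      by (rule M_row_surj)
    then have f_eq: "f = M\<Gamma> a"
      by (simp add: MG0)
    have "\<exists>g\<in>range F. fnorm HS (\<lambda>z. f z - g z) < e" if "e > 0" for e
    proof -
      obtain v where v: "dist (R v) a < e"
        using a \<open>e > 0\<close> unfolding X_closure closure_approachable by blast
      have "finner HS (\<lambda>z. M\<Gamma> a z - M\<Gamma> (R v) z) (\<lambda>z. M\<Gamma> a z - M\<Gamma> (R v) z)
          = cinner (a - R v) (a - R v)"
        using a by (simp add: HS.finner_diff_left HS.finner_diff_right HS.mem M_mem R_X M_Gamma_inner
            cinner_diff_left cinner_diff_right)
      then have "fnorm HS (\<lambda>z. f z - F v z) = norm (a - R v)"
        by (simp add: fnorm_def f_eq F cinner_self)
      then show ?thesis
        using v by (intro bexI[of _ "F v"]) (auto simp: dist_norm norm_minus_commute)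
    qed
    with f show "f \<in> fclosure HS (range F)"
      by (simp add: fclosure_def)
  qed
qed (auto simp: fclosure_def)

lemma unique_solution_iff:
  "(\<exists>!f. f \<in> solutions xt) \<longleftrightarrow> norm xt = 1 \<or> fclosure HS (range F) = fcarrier HS"
proof
  assume "norm xt = 1 \<or> fclosure HS (range F) = fcarrier HS"
  then have "MG h = (\<lambda>z. 0)" if "h \<in> fcarrier HE" "fnorm HE h \<le> sqrt (1 - (norm xt)\<^sup>2)" for h
  proof
    assume "norm xt = 1"
    then have "fnorm HE h = 0"
      using that HE.fnorm_nonneg[OF that(1)] by simp
    then show ?thesis
      using HE.fnorm_eq_0[OF that(1)] M_zero by simp
  qed (rule MG_eq_0_if_dense[OF _ that(1)])
  then have "f = M\<Gamma> xt" if "f \<in> solutions xt" for f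
    using that unfolding solutions_eq by auto
  then show "\<exists>!f. f \<in> solutions xt"
    using M_Gamma_solution by blast
next
  assume unique: "\<exists>!f. f \<in> solutions xt"
  show "norm xt = 1 \<or> fclosure HS (range F) = fcarrier HS"
  proof (rule disjCI)
    assume not_dense: "fclosure HS (range F) \<noteq> fcarrier HS"
    show "norm xt = 1"
    proof (rule ccontr)
      assume "norm xt \<noteq> 1"
      then have "(norm xt)\<^sup>2 < 1"
        using xt_le by (simp add: abs_square_less_1)
      define c where "c = sqrt (1 - (norm xt)\<^sup>2)"
      have c: "c > 0"
        using \<open>(norm xt)\<^sup>2 < 1\<close> by (simp add: c_def)
      have "MG h = (\<lambda>z. 0)" if h: "h \<in> fcarrier HE" for h
      proof -
        \<comment> \<open>Scales an arbitrary \<open>h\<close> into the ball of radius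
          \<open>c\<close>; the added 1 covers the case of norm 0.\<close>
        define t where "t = c / (fnorm HE h + 1)"
        have n: "0 \<le> fnorm HE h"
          by (rule HE.fnorm_nonneg[OF h])
        then have t: "t > 0"
          using c by (simp add: t_def)
        let ?h = "\<lambda>z. complex_of_real t *\<^sub>C h z"
        have "fnorm HE ?h = t * fnorm HE h"
          using t by (simp add: HE.fnorm_scale[OF h])
        also have "\<dots> \<le> c"
          using n c by (simp add: t_def field_simps)
        finally have "(\<lambda>z. M\<Gamma> xt z + MG ?h z) \<in> solutions xt"
          unfolding solutions_eq using HE.scale_mem[OF h] by (auto simp: c_def)
        then have "(\<lambda>z. M\<Gamma> xt z + MG ?h z) = M\<Gamma> xt"
          using unique M_Gamma_solution by blast
        then have "of_real t *\<^sub>C MG h z = 0" for z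
          by (simp add: fun_eq_iff MG_linear)
        then show ?thesis
          using t by (simp add: fun_eq_iff scaleC_of_real)
      qed
      then show False
        using not_dense dense_if_MG_eq_0 by blast
    qed
  qed
qed

end

end

lemma universal_colligation_U_R:
  assumes "universal_colligation R T E N V i istar U"
  shows "U (R v, N v, 0) = (R (T v), E v, 0)"
proof -
  have "(R v, N v) \<in> dom_V R N"
    unfolding dom_V_def using closure_subset by fastforce
  then show ?thesis
    using assms unfolding universal_colligation_def by fastforce
qed

text \<open>\<open>istar\<close> and \<open>i\<close> are onto. So every \<open>w\<close> comes from
  the defect space of the range of V, which \<open>U\<close> sends to zero
  \<open>'d\<close>-component, and every \<open>d\<close> is reached from the defect space of the
  domain of V, with zero \<open>'e\<close>-component.\<close>

lemma universal_colligation_D22: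
  assumes "universal_colligation R T E N V i istar U"
  shows "snd (snd (U (0, 0, w))) = 0" "\<exists>a u. a \<in> X0 R \<and> U (a, u, 0) = (0, 0, d)"
proof -
  have *: "istar ` defect_star R T E = UNIV" "i ` defect R N = UNIV"
    "\<forall>(a, u) \<in> defect R N. U (a, u, 0) = (0, 0, i (a, u))"
    "\<forall>(a, y) \<in> defect_star R T E. U (0, 0, istar (a, y)) = (a, y, 0)"
    using assms[unfolded universal_colligation_def unitary_onto_def] by - (elim conjE, assumption)+
  obtain a y where "(a, y) \<in> defect_star R T E" "w = istar (a, y)"
    using *(1) by (metis UNIV_I imageE prod.exhaust)
  then show "snd (snd (U (0, 0, w))) = 0"
    using *(4) by fastforce
  obtain b u where "(b, u) \<in> defect R N" "d = i (b, u)"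
    using *(2) by (metis UNIV_I imageE prod.exhaust)
  moreover from this have "b \<in> X0 R"
    by (auto simp: defect_def ominus_def)
  ultimately show "\<exists>a u. a \<in> X0 R \<and> U (a, u, 0) = (0, 0, d)"
    using *(3) by fastforce
qed

theorem theorem5p1:
  fixes S :: "complex \<Rightarrow> 'u::complex_hilbert \<Rightarrow> 'y::complex_hilbert"
    and T :: "'x::complex_hilbert \<Rightarrow> 'x" and E :: "'x \<Rightarrow> 'y" and N :: "'x \<Rightarrow> 'u"
    and x :: 'x
    and HS :: "'y fun_space" and HE :: "'e::complex_hilbert fun_space"
    and R :: "'x \<Rightarrow> 'x"
    and V :: "'x \<times> 'u \<Rightarrow> 'x \<times> 'y"
    and i :: "'x \<times> 'u \<Rightarrow> 'd::complex_hilbert" and istar :: "'x \<times> 'y \<Rightarrow> 'e"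
    and U :: "'x \<times> 'u \<times> 'e \<Rightarrow> 'x \<times> 'y \<times> 'd"
    and \<E> :: "complex \<Rightarrow> 'd \<Rightarrow> 'e"
  assumes HS: "dbr_space S HS"
    and admissible: "aip_admissible HS S T E N"
    and P_ge: "op_le (rank_one x) (aip_gram HS S T E N)"
    and R: "is_positive_sqrt (aip_gram HS S T E N) R"
    and U: "universal_colligation R T E N V i istar U"
    and schur: "\<E> \<in> schur_class"
    and S_eq: "\<forall>z\<in>\<bbbD>. S z = redheffer U (X0 R) \<E> z"
    and HE: "dbr_space \<E> HE"
  shows "let M\<Gamma> = M_Gamma U (X0 R) \<E>;
             MG = M_G U (X0 R) \<E>;
             sols = aip_solutions HS S T E N x
         in
    (\<exists>!xt. xt \<in> X0 R \<and> x = R xt) \<and>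
    (\<forall>xt. xt \<in> X0 R \<and> x = R xt \<longrightarrow>
      sols = {(\<lambda>z. M\<Gamma> xt z + MG h z) | h.
                h \<in> fcarrier HE \<and> fnorm HE h \<le> sqrt (1 - (norm xt)\<^sup>2)} \<and>
      (\<forall>h f. h \<in> fcarrier HE \<and> fnorm HE h \<le> sqrt (1 - (norm xt)\<^sup>2) \<and>
           f = (\<lambda>z. M\<Gamma> xt z + MG h z) \<longrightarrow>
         M\<Gamma> xt \<in> fcarrier HS \<and> MG h \<in> fcarrier HS \<and>
         (fnorm HS f)\<^sup>2 = (fnorm HS (M\<Gamma> xt))\<^sup>2 + (fnorm HS (MG h))\<^sup>2 \<and>
         (fnorm HS f)\<^sup>2 =
           (norm xt)\<^sup>2 + (fnorm HE (fproj HE (fominus HE (ker_M HE MG)) h))\<^sup>2) \<and>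
      M\<Gamma> xt \<in> sols \<and>
      (\<forall>f\<in>sols. f \<noteq> M\<Gamma> xt \<longrightarrow> fnorm HS (M\<Gamma> xt) < fnorm HS f) \<and>
      ((\<exists>!f. f \<in> sols) \<longleftrightarrow>
         norm xt = 1 \<or> fclosure HS (range (M_F S T E N)) = fcarrier HS))"
proof -
  have R_clinear: "bounded_clinear R" and R_pos: "positive_op R"
    and RR: "\<And>v. R (R v) = aip_gram HS S T E N v"
    using R by (auto simp: is_positive_sqrt_def)
  note R_adj = positive_op_self_adjoint[OF R_clinear R_pos]
  have S: "S \<in> schur_class" and EN: "analytic_output_pair E T" "analytic_output_pair N T"
    using admissible by (auto simp: aip_admissible_def)
  note U_R = universal_colligation_U_R[OF U]
  interpret schur_loaded_colligation "X0 R" U \<E> S HS HE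
  proof
    show "csubspace (X0 R)"
      unfolding X0_def by (intro csubspace_closure csubspace_range R_clinear)
    show "unitary_onto U (X0 R \<times> UNIV \<times> UNIV) (X0 R \<times> UNIV \<times> UNIV)"
      using U unfolding universal_colligation_def by (elim conjE)
    show "closed (X0 R)"
      by (simp add: X0_def)
    show "S \<zeta> = redheffer U (X0 R) \<E> \<zeta>" if "\<zeta> \<in> \<bbbD>" for \<zeta>
      using S_eq that by blast
  qed (rule universal_colligation_D22[OF U] S schur HS HE)+
  have "R v \<in> X0 R" for v
    unfolding X0_def using closure_subset[of "range R"] by blast
  then have F: "M_F S T E N v = M\<Gamma> (R v)" for v
    using U_R EN by (rule M_F_eq)
  interpret interpolation_colligation "X0 R" U \<E> S HS HE R "M_F S T E N"
    by unfold_locales (simp_all add: R_adj X0_def F RR aip_gram_def flip: X0_def)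
  \<comment> \<open>The operator inequality tested at \<open>v\<close>, in the form that
    \<open>douglas_vector\<close> requires.\<close>
  have "cmod (cinner v x) \<le> norm (R v)" for v
  proof -
    have "0 \<le> Re (cinner (R (R v) - rank_one x v) v)"
      using P_ge by (simp add: op_le_def positive_op_def RR)
    also have "cinner (R (R v) - rank_one x v) v = cinner (R v) (R v) - cinner v x * cnj (cinner v x)"
      using cinner_commute[of x v]
      by (simp add: cinner_diff_left rank_one_def cinner_scaleC_left R_adj)
    also have "\<dots> = complex_of_real ((norm (R v))\<^sup>2 - (cmod (cinner v x))\<^sup>2)"
      unfolding of_real_diff complex_norm_square cinner_self[symmetric] ..
    finally have "(cmod (cinner v x))\<^sup>2 \<le> (norm (R v))\<^sup>2"
      by simp
    then show ?thesis
      by (rule power2_le_imp_le) simp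
  qed
  then obtain x0 where x0: "x0 \<in> X0 R" "x = R x0" "norm x0 \<le> 1"
    unfolding X0_def by (rule douglas_vector[OF R_clinear R_adj])
  have x0_unique: "xt = x0" if "xt \<in> X0 R" "x = R xt" for xt
    using R_inj[OF that(1) x0(1)] that(2) x0(2) by simp
  have sols: "aip_solutions HS S T E N x = solutions x0"
    by (simp add: aip_solutions_def solutions_def x0(2))
  show ?thesis
    unfolding Let_def sols
  proof (intro conjI allI impI)
    show "\<exists>!xt. xt \<in> X0 R \<and> x = R xt"
      using x0 x0_unique by blast
  next
    fix xt assume "xt \<in> X0 R \<and> x = R xt"
    then have xt: "xt = x0"
      using x0_unique by blast
    show "solutions x0 = {(\<lambda>z. M\<Gamma> xt z + MG h z) | h.
        h \<in> fcarrier HE \<and> fnorm HE h \<le> sqrt (1 - (norm xt)\<^sup>2)}"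
      unfolding xt by (rule solutions_eq[OF x0(1,3)])
    show "M\<Gamma> xt \<in> solutions x0"
      unfolding xt by (rule M_Gamma_solution[OF x0(1,3)])
    show "(\<exists>!f. f \<in> solutions x0) \<longleftrightarrow>
        norm xt = 1 \<or> fclosure HS (range (M_F S T E N)) = fcarrier HS"
      unfolding xt by (rule unique_solution_iff[OF x0(1,3)])
    show "\<forall>f\<in>solutions x0. f \<noteq> M\<Gamma> xt \<longrightarrow> fnorm HS (M\<Gamma> xt) < fnorm HS f"
      unfolding xt using M_Gamma_minimal[OF x0(1,3)] by blast
    fix h f assume hf: "h \<in> fcarrier HE \<and> fnorm HE h \<le> sqrt (1 - (norm xt)\<^sup>2) \<and>
      f = (\<lambda>z. M\<Gamma> xt z + MG h z)"
    then have h: "h \<in> fcarrier HE"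
      by blast
    show "M\<Gamma> xt \<in> fcarrier HS" "MG h \<in> fcarrier HS"
      using M_mem x0(1) h by (auto simp: xt)
    show "(fnorm HS f)\<^sup>2 = (fnorm HS (M\<Gamma> xt))\<^sup>2 + (fnorm HS (MG h))\<^sup>2"
      using hf pythagoras[OF x0(1) h] by (simp add: xt M_Gamma_norm[OF x0(1)])
    show "(fnorm HS f)\<^sup>2 =
        (norm xt)\<^sup>2 + (fnorm HE (fproj HE (fominus HE (ker_M HE MG)) h))\<^sup>2"
      using hf pythagoras[OF x0(1) h] by (simp add: xt MG_projection(3)[OF h])
  qed
qed

end
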